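(* Let $f\in L^2(\mathbb{R}^{p,q},Cl(p,q))$, put $F=\int_{\mathbb{R}^{p,q}}|f(x)|^2\,d^nx$, and let $a$ be an arbitrary constant vector in $\mathbb{R}^{p,q}$. Then $$\int_{\mathbb{R}^{n}}(a\cdot x)^2|f(x)|^2\,d^nx\;\frac{1}{(2\pi)^n}\int_{\mathbb{R}^{n}}(a\cdot w)^2\,|\mathcal{F}^i\{f\}(w)|^2\,d^nw\;\geq\;\frac14\,F^2 ,$$ with equality when $f(x)=C_0e^{-k|x|^2}$, where $C_0\in Cl(p,q)$ is an arbitrary constant multivector and $0<k\in\mathbb{R}$.
   Context: Let $n=p+q$. $Cl(p,q)$ is the real associative unital Clifford algebra generated by $e_1,\dots,e_n$ with $e_ke_l+e_le_k=2\epsilon_k\delta_{k,l}$, where $\epsilon_k=+1$ for $1\le k\le p$ and $\epsilon_k=-1$ for $p+1\le k\le n$. It has the basis $e_A=e_{i_1}\cdots e_{i_k}$, $A=\{i_1<\cdots<i_k\}\subseteq\{1,\dots,n\}$, $e_\emptyset=1$; elements (multivectors) are written $M=\sum_A M_Ae_A$ with $M_A\in\mathbb{R}$, and $\langle M\rangle_k$ denotes the grade-$k$ part. The scalar product is $M\ast N=\langle MN\rangle_0$. The principal reverse is $\widetilde{M}=\sum_{k=0}^n(-1)^{k(k-1)/2}\,\overline{\langle M\rangle_k}$, where the bar is linear with $\overline{e_{i_1}\cdots e_{i_k}}=\epsilon_{i_1}e_{i_1}\cdots\epsilon_{i_k}e_{i_k}$; one has $M\ast\widetilde N=\sum_AM_AN_A$,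 and the modulus is given by $|M|^2=M\ast\widetilde M=\sum_AM_A^2$. Vectors $x\in\mathbb{R}^{p,q}$ are identified with $x=\sum_{l}x_le^l=\sum_l x^le_l$, where $e^l=\epsilon_le_l$ (so $x^l=\epsilon_lx_l$). For vectors, $a\cdot b=a\ast b=\sum_l a^lb_l$, and $|x|^2=\sum_l x_l^2$. $d^nx=dx_1\cdots dx_n$ is Lebesgue measure, and integrals over $\mathbb{R}^n$ and over $\mathbb{R}^{p,q}$ mean the same thing. $L^2(\mathbb{R}^{p,q},Cl(p,q))$ is the space of (measurable) $f=\sum_Af_Ae_A:\mathbb{R}^{p,q}\to Cl(p,q)$, $f_A$ real-valued, with $\int|f(x)|^2d^nx<\infty$. Fix $i\in Cl(p,q)$ with $i^2=-1$ and $\widetilde i=-i$. For $f\in L^1(\mathbb{R}^{p,q},Cl(p,q))$ the Clifford Fourier transform with respect to $i$ is $$\mathcal{F}^i\{f\}(w)=\int_{\mathbb{R}^{p,q}}f(x)e^{-iu(x,w)}\,d^nx,\qquad u(x,w)=x\ast\widetilde w=\sum_{l=1}^nx_lw_l,$$ where $e^{-i\theta}=\cos\theta-i\sin\theta$ for $\theta\in\mathbb{R}$; for $f\in L^2$ it is understood as extended by continuity in the usual Plancherel sense.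
   Formalization: The printed bound F²/4 fails for an arbitrary vector a (for a = 0 the left side is 0; for Gaussians it equals |a|⁴F²/4), so the right side is corrected to |a|⁴F²/4, both in the inequality and in the Gaussian equality; for |a| = 1 this is the printed claim. *)

theory Defs
  imports "HOL-Analysis.Analysis"
begin

section \<open>The Clifford algebra Cl(p,q)\<close>

text \<open>
  The index set 1, ..., n is an arbitrary finite linearly ordered type \<open>'n\<close>, with n = CARD('n);
  \<open>card {j. j \<le> k}\<close> is the position of \<open>k\<close>. A multivector is the family of its
  coefficients over the basis \<open>e\<^sub>A\<close>, where \<open>A\<close> ranges over all subsets of the index set.
  The number q enters only through n = p + q.
\<close>

type_synonym 'n multivector = "(real, 'n set) vec"
type_synonym 'n coords = "(real, 'n) vec"

definition eps :: "nat \<Rightarrow> 'n::{finite,linorder} \<Rightarrow> real" where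
  "eps p k = (if card {j. j \<le> k} \<le> p then 1 else -1)"

definition blade :: "'n::finite set \<Rightarrow> 'n multivector" where
  "blade A = axis A 1"

abbreviation gen :: "'n::finite \<Rightarrow> 'n multivector" where
  "gen k \<equiv> blade {k}"

abbreviation cl_one :: "'n::finite multivector" where
  "cl_one \<equiv> blade {}"

text \<open>
  Sorting the word \<open>e\<^sub>A e\<^sub>B\<close> costs one sign for each inversion, and each repeated
  generator \<open>e\<^sub>c\<close> then contracts to \<open>e\<^sub>c\<^sup>2 = \<epsilon>\<^sub>c\<close>.
\<close>

definition blade_sign :: "nat \<Rightarrow> 'n::{finite,linorder} set \<Rightarrow> 'n set \<Rightarrow> real" where
  "blade_sign p A B =
     (-1) ^ card {(a, b). a \<in> A \<and> b \<in> B \<and> b < a} * (\<Prod>c\<in>A \<inter> B. eps p c)"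

definition cl_mult ::
  "nat \<Rightarrow> 'n::{finite,linorder} multivector \<Rightarrow> 'n multivector \<Rightarrow> 'n multivector" where
  "cl_mult p M N =
     (\<Sum>A\<in>UNIV. \<Sum>B\<in>UNIV. (M $ A * N $ B * blade_sign p A B) *\<^sub>R blade ((A - B) \<union> (B - A)))"

definition grade :: "nat \<Rightarrow> 'n::finite multivector \<Rightarrow> 'n multivector" where
  "grade k M = (\<chi> A. if card A = k then M $ A else 0)"

definition bar :: "nat \<Rightarrow> 'n::{finite,linorder} multivector \<Rightarrow> 'n multivector" where
  "bar p M = (\<chi> A. (\<Prod>l\<in>A. eps p l) * M $ A)"

definition principal_reverse ::
  "nat \<Rightarrow> 'n::{finite,linorder} multivector \<Rightarrow> 'n multivector" where
  "principal_reverse p M =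
     (\<Sum>k\<le>CARD('n). ((-1) ^ (k * (k - 1) div 2)) *\<^sub>R bar p (grade k M))"

text \<open>The grade-0 part is identified with its coefficient at \<open>e\<^sub>\<emptyset> = 1\<close>.\<close>

definition scalar_prod ::
  "nat \<Rightarrow> 'n::{finite,linorder} multivector \<Rightarrow> 'n multivector \<Rightarrow> real" where
  "scalar_prod p M N = cl_mult p M N $ {}"

definition modulus :: "nat \<Rightarrow> 'n::{finite,linorder} multivector \<Rightarrow> real" where
  "modulus p M = sqrt (scalar_prod p M (principal_reverse p M))"

text \<open>
  Points of \<open>\<real>\<^sup>p\<^sup>,\<^sup>q\<close> are given by their lower coordinates \<open>x $ l = x\<^sub>l\<close>, so the vector is
  the sum of the \<open>x\<^sub>l e\<^sup>l\<close> with \<open>e\<^sup>l = \<epsilon>\<^sub>l e\<^sub>l\<close>.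
\<close>

definition vec_of :: "nat \<Rightarrow> 'n::{finite,linorder} coords \<Rightarrow> 'n multivector" where
  "vec_of p x = (\<Sum>l\<in>UNIV. (x $ l * eps p l) *\<^sub>R gen l)"

abbreviation vdot :: "nat \<Rightarrow> 'n::{finite,linorder} coords \<Rightarrow> 'n coords \<Rightarrow> real" where
  "vdot p a b \<equiv> scalar_prod p (vec_of p a) (vec_of p b)"

abbreviation vmod :: "nat \<Rightarrow> 'n::{finite,linorder} coords \<Rightarrow> real" where
  "vmod p x \<equiv> modulus p (vec_of p x)"


section \<open>The Clifford Fourier transform\<close>

definition L2_set_cl :: "nat \<Rightarrow> ('n::{finite,linorder} coords \<Rightarrow> 'n multivector) set" where
  "L2_set_cl p = {f \<in> borel_measurable lebesgue.
     (\<integral>\<^sup>+x. ennreal ((modulus p (f x))\<^sup>2) \<partial>lebesgue) < \<infinity>}"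

definition phase :: "nat \<Rightarrow> 'n::{finite,linorder} coords \<Rightarrow> 'n coords \<Rightarrow> real" where
  "phase p x w = scalar_prod p (vec_of p x) (principal_reverse p (vec_of p w))"

definition cl_exp_minus :: "'n::finite multivector \<Rightarrow> real \<Rightarrow> 'n multivector" where
  "cl_exp_minus i \<theta> = cos \<theta> *\<^sub>R cl_one - sin \<theta> *\<^sub>R i"

definition cft_L1 ::
  "nat \<Rightarrow> 'n multivector \<Rightarrow> ('n coords \<Rightarrow> 'n multivector)
    \<Rightarrow> 'n::{finite,linorder} coords \<Rightarrow> 'n multivector" where
  "cft_L1 p i f w = (\<integral>x. cl_mult p (f x) (cl_exp_minus i (phase p x w)) \<partial>lebesgue)"

text \<open>
  Extension by continuity to \<open>L\<^sup>2\<close>: \<open>g\<close> is an \<open>L\<^sup>2\<close>-limit of transforms of functions in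
  \<open>L\<^sup>1 \<inter> L\<^sup>2\<close> that approximate \<open>f\<close> in \<open>L\<^sup>2\<close>. By Plancherel's theorem such a \<open>g\<close> exists and
  is unique up to a null set; \<open>cft\<close> is a representative.
\<close>

definition is_cft ::
  "nat \<Rightarrow> 'n multivector \<Rightarrow> ('n coords \<Rightarrow> 'n multivector)
    \<Rightarrow> ('n::{finite,linorder} coords \<Rightarrow> 'n multivector) \<Rightarrow> bool" where
  "is_cft p i f g \<longleftrightarrow> g \<in> L2_set_cl p \<and>
     (\<exists>\<phi> :: nat \<Rightarrow> 'n coords \<Rightarrow> 'n multivector.
        (\<forall>m. \<phi> m \<in> L2_set_cl p \<and> integrable lebesgue (\<phi> m)) \<and>
        (\<lambda>m. \<integral>\<^sup>+x. ennreal ((modulus p (\<phi> m x - f x))\<^sup>2) \<partial>lebesgue) \<longlonglongrightarrow> 0 \<and>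
        (\<lambda>m. \<integral>\<^sup>+w. ennreal ((modulus p (cft_L1 p i (\<phi> m) w - g w))\<^sup>2) \<partial>lebesgue) \<longlonglongrightarrow> 0)"

definition cft ::
  "nat \<Rightarrow> 'n multivector \<Rightarrow> ('n coords \<Rightarrow> 'n multivector)
    \<Rightarrow> 'n::{finite,linorder} coords \<Rightarrow> 'n multivector" where
  "cft p i f = (SOME g. is_cft p i f g)"

text \<open>
  The product of the two second moments in direction \<open>a\<close> is homogeneous of degree 4 in \<open>a\<close>,
  so a lower bound \<open>F\<^sup>2 / 4\<close> presupposes the normalization \<open>|a| = 1\<close> (it fails for \<open>a = 0\<close>).
  For arbitrary \<open>a\<close> the bound is \<open>|a|\<^sup>4 F\<^sup>2 / 4\<close>. Integrals of nonnegative functions are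
  taken in \<open>[0, \<infinity>]\<close>, so divergent second moments are allowed.
\<close>


section \<open>Adequacy of the model\<close>

abbreviation symd :: "'a set \<Rightarrow> 'a set \<Rightarrow> 'a set" where
  "symd A B \<equiv> (A - B) \<union> (B - A)"

lemma prod_symd:
  fixes h :: "'a::finite \<Rightarrow> real"
  assumes "\<And>x. h x * h x = 1"
  shows "prod h (symd A B) = prod h A * prod h B"
proof -
  have 1: "prod h A = prod h (A - B) * prod h (A \<inter> B)"
    by (subst prod.union_disjoint[symmetric]) (auto intro: arg_cong[where f = "prod h"])
  have 2: "prod h B = prod h (B - A) * prod h (A \<inter> B)"
    by (subst prod.union_disjoint[symmetric]) (auto intro: arg_cong[where f = "prod h"])
  have 3: "prod h (symd A B) = prod h (A - B) * prod h (B - A)"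
    by (subst prod.union_disjoint) auto
  have "prod h (A \<inter> B) * prod h (A \<inter> B) = 1"
    unfolding prod.distrib[symmetric] using assms by simp
  then show ?thesis unfolding 1 2 3 by (simp add: algebra_simps)
qed

lemma eps_sq [simp]: "eps p k * eps p k = 1"
  by (simp add: eps_def)

definition inv_sign :: "'n::{finite,linorder} set \<Rightarrow> 'n set \<Rightarrow> real" where
  "inv_sign A B = (-1) ^ card {(a, b). a \<in> A \<and> b \<in> B \<and> b < a}"

lemma inv_sign_prod:
  "inv_sign A B = (\<Prod>a\<in>A. \<Prod>b\<in>B. if b < a then -1 else 1)"
proof -
  have "{(a, b). a \<in> A \<and> b \<in> B \<and> b < a} = (A \<times> B) \<inter> {z. snd z < fst z}"
    by auto
  moreover have "(\<Prod>z\<in>A \<times> B. if snd z < fst z then -1 else 1 :: real)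
      = (-1) ^ card ((A \<times> B) \<inter> {z. snd z < fst z})"
    by (simp add: prod.If_cases)
  ultimately show ?thesis
    by (simp add: inv_sign_def prod.cartesian_product case_prod_beta)
qed

lemma inv_sign_symd_left: "inv_sign (symd A B) C = inv_sign A C * inv_sign B C"
  unfolding inv_sign_prod
  by (rule prod_symd) (simp add: prod.distrib[symmetric] if_distrib cong: if_cong)

lemma inv_sign_symd_right: "inv_sign A (symd B C) = inv_sign A B * inv_sign A C"
proof -
  have "\<And>a. (\<Prod>b\<in>symd B C. if b < a then -1 else 1 :: real)
     = (\<Prod>b\<in>B. if b < a then -1 else 1) * (\<Prod>b\<in>C. if b < a then -1 else 1)"
    by (rule prod_symd) auto
  then show ?thesis unfolding inv_sign_prod by (simp add: prod.distrib)
qed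

lemma blade_sign_alt: "blade_sign p A B = inv_sign A B * prod (eps p) (A \<inter> B)"
  by (simp add: blade_sign_def inv_sign_def)

lemma blade_sign_cocycle:
  "blade_sign p A B * blade_sign p (symd A B) C = blade_sign p A (symd B C) * blade_sign p B C"
proof -
  have a: "symd A B \<inter> C = symd (A \<inter> C) (B \<inter> C)" "A \<inter> symd B C = symd (A \<inter> B) (A \<inter> C)"
    by blast+
  have "prod (eps p) (symd A B \<inter> C) = prod (eps p) (A \<inter> C) * prod (eps p) (B \<inter> C)"
    "prod (eps p) (A \<inter> symd B C) = prod (eps p) (A \<inter> B) * prod (eps p) (A \<inter> C)"
    unfolding a by (rule prod_symd, simp)+
  then show ?thesis
    by (simp only: blade_sign_alt inv_sign_symd_left inv_sign_symd_right) (simp add: mult_ac)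
qed

lemma cl_mult_add_left: "cl_mult p (M + M') N = cl_mult p M N + cl_mult p M' N"
  by (simp add: cl_mult_def algebra_simps sum.distrib)

lemma cl_mult_add_right: "cl_mult p M (N + N') = cl_mult p M N + cl_mult p M N'"
  by (simp add: cl_mult_def algebra_simps sum.distrib)

lemma cl_mult_scale_left: "cl_mult p (c *\<^sub>R M) N = c *\<^sub>R cl_mult p M N"
  by (simp add: cl_mult_def scaleR_sum_right mult_ac)

lemma cl_mult_scale_right: "cl_mult p M (c *\<^sub>R N) = c *\<^sub>R cl_mult p M N"
  by (simp add: cl_mult_def scaleR_sum_right mult_ac)

lemma bilinear_cl_mult: "bilinear (cl_mult p)"
  unfolding bilinear_def
  by (auto intro!: linearI simp: cl_mult_add_left cl_mult_add_right
      cl_mult_scale_left cl_mult_scale_right)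

lemma cl_mult_sum_left: "cl_mult p (sum g S) N = (\<Sum>s\<in>S. cl_mult p (g s) N)"
  by (rule linear_sum[of "\<lambda>M. cl_mult p M N"])
    (use bilinear_cl_mult[of p] in \<open>auto simp: bilinear_def\<close>)

lemma cl_mult_sum_right: "cl_mult p M (sum g S) = (\<Sum>s\<in>S. cl_mult p M (g s))"
  by (rule linear_sum[of "\<lambda>N. cl_mult p M N"])
    (use bilinear_cl_mult[of p] in \<open>auto simp: bilinear_def\<close>)

lemma blade_nth: "blade A $ B = (if B = A then 1 else 0)"
  by (simp add: blade_def axis_def)

lemma blade_expansion: "M = (\<Sum>A\<in>UNIV. M $ A *\<^sub>R blade A)"
  by (simp add: vec_eq_iff blade_nth if_distrib cong: if_cong)

lemma cl_mult_blade: "cl_mult p (blade A) (blade B) = blade_sign p A B *\<^sub>R blade (symd A B)"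
proof -
  have "cl_mult p (blade A) (blade B) =
    (\<Sum>A'\<in>UNIV. \<Sum>B'\<in>UNIV. if B' = B then (if A' = A then
        blade_sign p A B *\<^sub>R blade (symd A B) else 0) else 0)"
    unfolding cl_mult_def by (intro sum.cong refl) (auto simp: blade_nth)
  then show ?thesis by simp
qed

theorem cl_mult_assoc: "cl_mult p (cl_mult p L M) N = cl_mult p L (cl_mult p M N)"
proof -
  have b: "cl_mult p (cl_mult p (blade A) (blade B)) (blade C)
      = cl_mult p (blade A) (cl_mult p (blade B) (blade C))" for A B C :: "'a set"
  proof -
    have "symd (symd A B) C = symd A (symd B C)" by blast
    then show ?thesis
      using blade_sign_cocycle[of p A B C]
      by (simp only: cl_mult_blade cl_mult_scale_left cl_mult_scale_right scaleR_scaleR)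
         (simp add: mult.commute)
  qed
  show ?thesis
    by (subst (1 2) blade_expansion[of L], subst (1 2) blade_expansion[of M],
        subst (1 2) blade_expansion[of N])
       (simp only: cl_mult_sum_left cl_mult_sum_right cl_mult_scale_left cl_mult_scale_right b
         scaleR_sum_right)
qed

theorem cl_mult_one: "cl_mult p cl_one M = M" "cl_mult p M cl_one = M"
proof -
  have "blade_sign p {} A = 1" "blade_sign p A {} = 1" for A :: "'a set"
    by (simp_all add: blade_sign_alt inv_sign_prod)
  then have b: "cl_mult p cl_one (blade A) = blade A" "cl_mult p (blade A) cl_one = blade A"
    for A :: "'a set"
    by (simp_all add: cl_mult_blade)
  show "cl_mult p cl_one M = M"
    by (subst (1 2) blade_expansion[of M])
       (simp only: cl_mult_sum_right cl_mult_scale_right b)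
  show "cl_mult p M cl_one = M"
    by (subst (1 2) blade_expansion[of M])
       (simp only: cl_mult_sum_left cl_mult_scale_left b)
qed

theorem gen_relations:
  "cl_mult p (gen k) (gen l) + cl_mult p (gen l) (gen k) = (if k = l then 2 * eps p k else 0) *\<^sub>R cl_one"
proof (cases "k = l")
  case True
  then show ?thesis
    by (simp add: cl_mult_blade blade_sign_alt inv_sign_prod scaleR_left_distrib[symmetric])
next
  case False
  then have s: "symd {k} {l} = symd {l} {k}" by auto
  have "blade_sign p {k} {l} + blade_sign p {l} {k} = 0"
    using False by (auto simp: blade_sign_alt inv_sign_prod not_less)
  then show ?thesis
    unfolding cl_mult_blade s scaleR_left_distrib[symmetric] using False by simp
qed

theorem blade_insert:
  assumes "\<And>a. a \<in> A \<Longrightarrow> a < k"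
  shows "cl_mult p (blade A) (gen k) = blade (insert k A)"
proof -
  have k: "k \<notin> A" using assms by blast
  have "inv_sign A {k} = 1"
    unfolding inv_sign_prod by (rule prod.neutral) (use assms in force)
  moreover have "symd A {k} = insert k A" using k by auto
  ultimately show ?thesis using k by (simp add: cl_mult_blade blade_sign_alt)
qed

theorem principal_reverse_nth:
  "principal_reverse p M $ A =
     (-1) ^ (card A * (card A - 1) div 2) * (\<Prod>l\<in>A. eps p l) * M $ A"
proof -
  have "card A \<le> CARD('a)" by (simp add: card_mono)
  have "principal_reverse p M $ A = (\<Sum>k\<le>CARD('a). if k = card A then
     (-1) ^ (card A * (card A - 1) div 2) * (\<Prod>l\<in>A. eps p l) * M $ A else 0)"
    unfolding principal_reverse_def sum_component
    by (intro sum.cong refl) (auto simp: bar_def grade_def)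
  also have "\<dots> = (-1) ^ (card A * (card A - 1) div 2) * (\<Prod>l\<in>A. eps p l) * M $ A"
    using \<open>card A \<le> CARD('a)\<close> by simp
  finally show ?thesis .
qed

lemma card_inversions:
  fixes A :: "'n::{finite,linorder} set"
  shows "card {(a, b). a \<in> A \<and> b \<in> A \<and> b < a} = card A * (card A - 1) div 2"
proof -
  have "finite A" by simp
  then show ?thesis
  proof (induction A rule: finite_linorder_max_induct)
    case empty
    then show ?case by simp
  next
    case (insert k A)
    have "k \<notin> A" using insert by blast
    have "{(a, b). a \<in> insert k A \<and> b \<in> insert k A \<and> b < a}
        = {(a, b). a \<in> A \<and> b \<in> A \<and> b < a} \<union> {k} \<times> A"
      using insert(2) by (auto dest: less_asym)
    also have "card \<dots> = card {(a, b). a \<in> A \<and> b \<in> A \<and> b < a} + card ({k} \<times> A)"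
      using \<open>k \<notin> A\<close> by (intro card_Un_disjoint) auto
    also have "\<dots> = card A * (card A - 1) div 2 + card A"
      using insert by (simp add: card_cartesian_product_singleton)
    also have "\<dots> = (card A + 1) * card A div 2"
    proof -
      have "card A * (card A - 1) + 2 * card A = (card A + 1) * card A"
        by (cases "card A") (auto simp: algebra_simps)
      then have "(card A + 1) * card A div 2 = (card A * (card A - 1) + 2 * card A) div 2"
        by (simp only:)
      then show ?thesis by simp
    qed
    finally show ?case using \<open>k \<notin> A\<close> by simp
  qed
qed

lemma scalar_prod_alt: "scalar_prod p M N = (\<Sum>A\<in>UNIV. M $ A * N $ A * blade_sign p A A)"
proof -
  have "\<And>A B :: 'a set. {} = symd A B \<longleftrightarrow> B = A" by blast
  then have "scalar_prod p M N
    = (\<Sum>A\<in>UNIV. \<Sum>B\<in>UNIV. if B = A then M $ A * N $ A * blade_sign p A A else 0)"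
    unfolding scalar_prod_def cl_mult_def sum_component
    by (intro sum.cong refl) (auto simp: blade_nth)
  then show ?thesis by simp
qed

theorem scalar_prod_reverse: "scalar_prod p M (principal_reverse p N) = M \<bullet> N"
proof -
  have "blade_sign p A A = (-1) ^ (card A * (card A - 1) div 2) * (\<Prod>l\<in>A. eps p l)"
    for A :: "'a set"
    by (simp add: blade_sign_def card_inversions)
  moreover have "(\<Prod>l\<in>A. eps p l) * (\<Prod>l\<in>A. eps p l) = 1" for A :: "'a set"
    by (simp add: prod.distrib[symmetric])
  moreover have "((-1) ^ m * (-1) ^ m :: real) = 1" for m :: nat
    by (simp add: power_add[symmetric])
  ultimately have
    "principal_reverse p N $ A * blade_sign p A A = N $ A" for A :: "'a set"
    by (simp add: principal_reverse_nth algebra_simps)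
  then show ?thesis
    by (simp add: scalar_prod_alt inner_vec_def mult.assoc)
qed

theorem modulus_eq_norm: "modulus p M = norm M"
  by (simp add: modulus_def scalar_prod_reverse norm_eq_sqrt_inner)

lemma vec_of_inner: "vec_of p x \<bullet> vec_of p y = x \<bullet> y"
proof -
  have "blade {l} \<bullet> blade {m} = (if l = m then 1 else 0)" for l m :: 'a
    by (simp add: blade_def inner_axis_axis)
  then have "vec_of p x \<bullet> vec_of p y
      = (\<Sum>l\<in>UNIV. \<Sum>m\<in>UNIV. if m = l then x $ l * y $ l * (eps p l * eps p l) else 0)"
    unfolding vec_of_def inner_sum_left inner_sum_right
    by (intro sum.cong refl) auto
  then show ?thesis by (simp add: inner_vec_def)
qed

theorem phase_eq_inner: "phase p x w = x \<bullet> w"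
  by (simp add: phase_def scalar_prod_reverse vec_of_inner)

theorem vmod_eq_norm: "vmod p x = norm x"
  by (simp add: modulus_eq_norm norm_eq_sqrt_inner vec_of_inner)

theorem vdot_eq: "vdot p a b = (\<Sum>l\<in>UNIV. eps p l * a $ l * b $ l)"
proof -
  have g: "cl_mult p (gen l) (gen m) $ {} = (if m = l then eps p l else 0)" for l m :: 'a
    by (auto simp: cl_mult_blade blade_nth blade_sign_alt inv_sign_prod)
  have "vdot p a b = (\<Sum>l\<in>UNIV. eps p l * (eps p l * (eps p l * (a $ l * b $ l))))"
    unfolding scalar_prod_def vec_of_def cl_mult_sum_left cl_mult_sum_right cl_mult_scale_left
      cl_mult_scale_right sum_component vector_scaleR_component g
    by (simp add: if_distrib mult_ac cong: if_cong)
  also have "\<dots> = (\<Sum>l\<in>UNIV. eps p l * a $ l * b $ l)"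
    by (intro sum.cong refl) (simp only: mult.assoc[symmetric] eps_sq mult_1)
  finally show ?thesis .
qed

end

theory Submission
  imports Defs "HOL-Probability.Characteristic_Functions"
begin

text \<open>
  The map \<open>J M = M i\<close> is a complex structure on the Euclidean space of multivectors. Indeed right
  multiplication by a blade is a signed permutation of the basis, so right multiplication by the
  reverse of \<open>K\<close> is the adjoint of right multiplication by \<open>K\<close>; hence \<open>i\<^sup>2 = -1\<close> and the reverse of \<open>i\<close>
  being \<open>-i\<close> say that \<open>J\<close> is orthogonal with \<open>J\<^sup>2 = -1\<close>. The Clifford Fourier transform is then the
  ordinary Fourier transform, with kernel \<open>exp (- J (x \<bullet> w))\<close>, of functions with values in that space.
  The vector product \<open>a \<cdot> x\<close> of signature \<open>(p, q)\<close> is the Euclidean product \<open>b \<bullet> x\<close> with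
  \<open>b\<^sub>l = \<epsilon>\<^sub>l a\<^sub>l\<close>, and \<open>|b| = |a|\<close>. So everything reduces to an uncertainty principle in direction \<open>b\<close>
  for functions with values in a Euclidean space with an orthogonal complex structure
  (locale \<open>complex_structure\<close>).

  The uncertainty inequality (\<open>heisenberg\<close>) is proved with translations in place of derivatives, as \<open>f\<close>
  is only square integrable. Put \<open>f\<^sub>t(x) = f(x + t b)\<close>. A shift of the integration variable gives the
  commutation relation
  \<open>t |b|\<^sup>2 \<parallel>f\<parallel>\<^sup>2 = \<integral> (b \<bullet> x) (|f|\<^sup>2 - |f\<^sub>t|\<^sup>2) = \<integral> (b \<bullet> x) (f - f\<^sub>t) \<bullet> (f + f\<^sub>t)\<close>,
  so by Cauchy and Schwarz
  \<open>t\<^sup>2 |b|\<^sup>4 \<parallel>f\<parallel>\<^sup>4 \<le> \<parallel>f\<^sub>t - f\<parallel>\<^sup>2 \<parallel>(b \<bullet> x) (f + f\<^sub>t)\<parallel>\<^sup>2\<close>. The transform of \<open>f\<^sub>t\<close> is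
  \<open>exp (J t (b \<bullet> w))\<close> times that of \<open>f\<close>, so Plancherel and \<open>|e\<^sup>J\<^sup>\<theta> - 1| \<le> |\<theta>|\<close> bound the first factor by
  \<open>t\<^sup>2\<close> times the normalized second second_moment of the transform. The second factor tends to four times
  the second second_moment of \<open>f\<close> as \<open>t\<close> tends to 0; dividing by \<open>t\<^sup>2\<close> gives the claim.

  The Plancherel identity on \<open>L\<^sup>1 \<inter> L\<^sup>2\<close> (\<open>plancherel\<close>) comes from damping the squared modulus of
  the transform by a Gaussian of width \<open>1/r\<close>: Fubini's theorem and the Fourier transform of the
  Gaussian turn the damped energy into an average of the autocorrelation of \<open>f\<close> over a Gaussian of
  width \<open>r\<close>, and the autocorrelation is continuous at 0 with value \<open>\<parallel>f\<parallel>\<^sup>2\<close> there. Together with the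
  completeness of \<open>L\<^sup>2\<close> this shows that the extension to \<open>L\<^sup>2\<close> exists (\<open>is_FT_exists\<close>), is unique almost
  everywhere (\<open>is_FT_unique\<close>) and satisfies the same identity (\<open>is_FT_plancherel\<close>).

  For \<open>f(x) = C\<^sub>0 exp (- k |x|\<^sup>2)\<close> both \<open>|f|\<^sup>2\<close> and the squared modulus of its transform are Gaussians.
  The second second_moment of a Gaussian in direction \<open>b\<close> is its integral times \<open>|b|\<^sup>2\<close> times the variance;
  the two variances are \<open>1/(4k)\<close> and \<open>k\<close>, and their product is exactly \<open>1/4\<close>.
\<close>

section \<open>Change of variables for Lebesgue measure\<close>

lemma lborel_affine_transfer:
  fixes f :: "'a::euclidean_space \<Rightarrow> 'b::{banach, second_countable_topology}"
  assumes f[measurable]: "f \<in> borel_measurable borel" and c: "c \<noteq> 0"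
  shows "integrable lborel (\<lambda>x. f (t + c *\<^sub>R x)) \<longleftrightarrow> integrable lborel f"
    and "(\<integral>x. f x \<partial>lborel) = \<bar>c\<bar> ^ DIM('a) *\<^sub>R (\<integral>x. f (t + c *\<^sub>R x) \<partial>lborel)"
proof -
  show "integrable lborel (\<lambda>x. f (t + c *\<^sub>R x)) \<longleftrightarrow> integrable lborel f"
  proof -
    have "k \<noteq> 0 \<Longrightarrow> integrable M (\<lambda>x. k *\<^sub>R g x) \<longleftrightarrow> integrable M g"
      for k :: real and M :: "'a measure" and g :: "'a \<Rightarrow> 'b"
      using integrable_scaleR_right[of "1 / k" M "\<lambda>x. k *\<^sub>R g x"] by auto
    then show ?thesis
      by (subst (2) lborel_affine[OF c, of t], subst integrable_density)
         (use c in \<open>simp_all add: integrable_distr_eq\<close>)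
  qed
  show "(\<integral>x. f x \<partial>lborel) = \<bar>c\<bar> ^ DIM('a) *\<^sub>R (\<integral>x. f (t + c *\<^sub>R x) \<partial>lborel)"
    by (subst lborel_affine[OF c, of t], subst integral_density)
       (auto simp: integral_distr)
qed

lemma nn_integral_translate:
  fixes f :: "'a::euclidean_space \<Rightarrow> ennreal"
  assumes [measurable]: "f \<in> borel_measurable borel"
  shows "(\<integral>\<^sup>+x. f (x + t) \<partial>lborel) = (\<integral>\<^sup>+x. f x \<partial>lborel)"
  by (subst (2) lborel_distr_plus[of t, symmetric], subst nn_integral_distr)
     (auto simp: add.commute)

section \<open>The Fourier transform of Gaussians\<close>

text \<open>
  This is the characteristic function of the standard normal distribution, freed from the
  normalizing constant of the density.
\<close>

lemma gaussian_char_real: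
  "integrable lborel (\<lambda>x::real. exp (- x\<^sup>2 / 2) *\<^sub>R iexp (t * x))"
  "(CLBINT x. exp (- x\<^sup>2 / 2) *\<^sub>R iexp (t * x)) = of_real (sqrt (2 * pi) * exp (- t\<^sup>2 / 2))"
proof -
  have e: "exp (- x\<^sup>2 / 2) = sqrt (2 * pi) * std_normal_density x" for x
    by (simp add: std_normal_density_def)
  have "integrable lborel (\<lambda>x::real. sqrt (2 * pi) * (std_normal_density x * x ^ 0))"
    by (intro integrable_mult_right integrable_std_normal_moment)
  then have 1: "integrable lborel (\<lambda>x::real. exp (- x\<^sup>2 / 2))"
    unfolding e by simp
  show "integrable lborel (\<lambda>x::real. exp (- x\<^sup>2 / 2) *\<^sub>R iexp (t * x))"
    by (rule Bochner_Integration.integrable_bound[OF 1]) auto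
  have "of_real (exp (- t\<^sup>2 / 2)) = char std_normal_distribution t"
    by (simp add: char_std_normal_distribution)
  also have "\<dots> = (CLBINT x. std_normal_density x *\<^sub>R iexp (t * x))"
    unfolding char_def by (subst integral_density) auto
  finally have *: "(CLBINT x. std_normal_density x *\<^sub>R iexp (t * x)) = of_real (exp (- t\<^sup>2 / 2))" ..
  have "(CLBINT x. exp (- x\<^sup>2 / 2) *\<^sub>R iexp (t * x))
      = (CLBINT x. sqrt (2 * pi) *\<^sub>R (std_normal_density x *\<^sub>R iexp (t * x)))"
    unfolding e by (simp add: mult.assoc)
  also have "\<dots> = sqrt (2 * pi) *\<^sub>R of_real (exp (- t\<^sup>2 / 2))"
    by (simp only: integral_scaleR_right *)
  finally show "(CLBINT x. exp (- x\<^sup>2 / 2) *\<^sub>R iexp (t * x)) = of_real (sqrt (2 * pi) * exp (- t\<^sup>2 / 2))"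
    by (simp add: scaleR_conv_of_real)
qed

lemma gaussian_iexp_prod:
  fixes x w :: "'a::euclidean_space"
  shows "exp (- (norm x)\<^sup>2 / 2) *\<^sub>R iexp (w \<bullet> x)
    = (\<Prod>b\<in>Basis. exp (- (x \<bullet> b)\<^sup>2 / 2) *\<^sub>R iexp ((w \<bullet> b) * (x \<bullet> b)))"
proof -
  have 1: "exp (- (norm x)\<^sup>2 / 2) = (\<Prod>b\<in>Basis. exp (- (x \<bullet> b)\<^sup>2 / 2))"
    unfolding exp_sum[OF finite_Basis, symmetric] power2_norm_eq_inner
    by (subst euclidean_inner) (simp add: sum_negf sum_divide_distrib[symmetric] power2_eq_square)
  have 2: "iexp (w \<bullet> x) = (\<Prod>b\<in>Basis. iexp ((w \<bullet> b) * (x \<bullet> b)))"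
    unfolding exp_sum[OF finite_Basis, symmetric]
    by (subst euclidean_inner) (simp add: sum_distrib_left)
  show ?thesis unfolding 1 2 scaleR_conv_of_real by (simp add: prod.distrib of_real_prod)
qed

text \<open>
  Both the Gaussian and the character factor over the coordinates, so the integral is a product of
  one-dimensional ones.
\<close>

lemma gaussian_char:
  fixes w :: "'a::euclidean_space"
  shows "integrable lborel (\<lambda>x::'a. exp (- (norm x)\<^sup>2 / 2) *\<^sub>R iexp (w \<bullet> x))" (is ?I)
    and "(CLINT x|lborel. exp (- (norm x)\<^sup>2 / 2) *\<^sub>R iexp (w \<bullet> x))
       = of_real (sqrt (2 * pi) ^ DIM('a) * exp (- (norm w)\<^sup>2 / 2))" (is ?E)
proof -
  interpret product_sigma_finite "\<lambda>_::'a. lborel :: real measure" ..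
  let ?h = "\<lambda>b x. exp (- x\<^sup>2 / 2) *\<^sub>R iexp ((w \<bullet> b) * x)"
  let ?s = "\<lambda>f. \<Sum>b\<in>Basis. f b *\<^sub>R b :: 'a"
  have m: "?s \<in> measurable (\<Pi>\<^sub>M b\<in>Basis. lborel) borel" by measurable
  have eq: "exp (- (norm (?s f))\<^sup>2 / 2) *\<^sub>R iexp (w \<bullet> ?s f) = (\<Prod>b\<in>Basis. ?h b (f b))" for f
    unfolding gaussian_iexp_prod
    by (rule prod.cong) (simp_all add: inner_sum_left inner_Basis if_distrib cong: if_cong)
  show ?I
    apply (subst lborel_eq)
    apply (subst integrable_distr_eq[OF m])
     apply simp
    apply (simp only: eq)
    apply (rule product_integrable_prod[OF finite_Basis gaussian_char_real(1)])
    done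
  have "(CLINT x|lborel. exp (- (norm x)\<^sup>2 / 2) *\<^sub>R iexp (w \<bullet> x))
     = (CLINT f|(\<Pi>\<^sub>M b\<in>Basis. lborel). (\<Prod>b\<in>Basis. ?h b (f b)))"
    by (subst lborel_eq, subst integral_distr[OF m]) (simp_all only: eq, simp)
  also have "\<dots> = (\<Prod>b\<in>Basis. CLBINT x. ?h b x)"
    by (rule product_integral_prod[OF finite_Basis gaussian_char_real(1)])
  also have "\<dots> = (\<Prod>b\<in>Basis. of_real (sqrt (2 * pi) * exp (- (w \<bullet> b)\<^sup>2 / 2)))"
    by (simp only: gaussian_char_real)
  also have "\<dots> = of_real (sqrt (2 * pi) ^ DIM('a) * (\<Prod>b\<in>Basis. exp (- (w \<bullet> b)\<^sup>2 / 2)))"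
    by (simp add: prod.distrib of_real_prod)
  also have "(\<Prod>b\<in>Basis. exp (- (w \<bullet> b)\<^sup>2 / 2)) = exp (- (norm w)\<^sup>2 / 2)"
    unfolding exp_sum[OF finite_Basis, symmetric] power2_norm_eq_inner
    by (subst euclidean_inner[of w w]) (simp add: sum_negf sum_divide_distrib[symmetric] power2_eq_square)
  finally show ?E .
qed

lemma integrable_gaussian: "integrable lborel (\<lambda>x::'a::euclidean_space. exp (- (norm x)\<^sup>2 / 2))"
  using integrable_norm[OF gaussian_char(1)[of 0]] by simp

lemma gaussian_cos_sin:
  fixes w :: "'a::euclidean_space"
  shows "(\<integral>x. exp (- (norm x)\<^sup>2 / 2) * cos (x \<bullet> w) \<partial>lborel)
       = sqrt (2 * pi) ^ DIM('a) * exp (- (norm w)\<^sup>2 / 2)"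
    and "(\<integral>x. exp (- (norm x)\<^sup>2 / 2) * sin (x \<bullet> w) \<partial>lborel) = 0"
proof -
  have "iexp t = cos t + \<i> * sin t" for t :: real
    by (simp add: exp_Euler cos_of_real sin_of_real)
  then have "Re (exp (- (norm x)\<^sup>2 / 2) *\<^sub>R iexp (w \<bullet> x)) = exp (- (norm x)\<^sup>2 / 2) * cos (x \<bullet> w)"
     "Im (exp (- (norm x)\<^sup>2 / 2) *\<^sub>R iexp (w \<bullet> x)) = exp (- (norm x)\<^sup>2 / 2) * sin (x \<bullet> w)" for x
    by (auto simp: inner_commute)
  with integral_Re[OF gaussian_char(1)[of w]] integral_Im[OF gaussian_char(1)[of w]]
  show "(\<integral>x. exp (- (norm x)\<^sup>2 / 2) * cos (x \<bullet> w) \<partial>lborel)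
       = sqrt (2 * pi) ^ DIM('a) * exp (- (norm w)\<^sup>2 / 2)"
    and "(\<integral>x. exp (- (norm x)\<^sup>2 / 2) * sin (x \<bullet> w) \<partial>lborel) = 0"
    unfolding gaussian_char by simp_all
qed

text \<open>
  The dilation \<open>x \<mapsto> r x\<close> multiplies the integral by \<open>r\<close> to the power of the dimension and moves the
  factor \<open>1/r\<close> to the frequency.
\<close>

lemma gaussian_scaled:
  fixes v :: "'a::euclidean_space"
  assumes r: "r > 0"
  shows "integrable lborel (\<lambda>x::'a. exp (- (norm (r *\<^sub>R x))\<^sup>2 / 2))"
    and "(\<integral>x. exp (- (norm (r *\<^sub>R x))\<^sup>2 / 2) * cos (v \<bullet> x) \<partial>lborel)
       = (sqrt (2 * pi) / r) ^ DIM('a) * exp (- (norm ((1 / r) *\<^sub>R v))\<^sup>2 / 2)"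
    and "(\<integral>x. exp (- (norm (r *\<^sub>R x))\<^sup>2 / 2) * sin (v \<bullet> x) \<partial>lborel) = 0"
proof -
  show "integrable lborel (\<lambda>x::'a. exp (- (norm (r *\<^sub>R x))\<^sup>2 / 2))"
    using lborel_affine_transfer(1)[of "\<lambda>x::'a. exp (- (norm x)\<^sup>2 / 2)" r 0] r integrable_gaussian by simp
  have r': "r ^ DIM('a) \<noteq> 0" using r by simp
  have c: "(\<integral>x. exp (- (norm x)\<^sup>2 / 2) * h (x \<bullet> ((1 / r) *\<^sub>R v)) \<partial>lborel)
     = r ^ DIM('a) * (\<integral>x. exp (- (norm (r *\<^sub>R x))\<^sup>2 / 2) * h (v \<bullet> x) \<partial>lborel)"
    if [measurable]: "h \<in> borel_measurable borel" for h :: "real \<Rightarrow> real"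
    using lborel_affine_transfer(2)[of "\<lambda>x::'a. exp (- (norm x)\<^sup>2 / 2) * h (x \<bullet> ((1 / r) *\<^sub>R v))" r 0] r
    by (simp add: inner_commute)
  show "(\<integral>x. exp (- (norm (r *\<^sub>R x))\<^sup>2 / 2) * cos (v \<bullet> x) \<partial>lborel)
       = (sqrt (2 * pi) / r) ^ DIM('a) * exp (- (norm ((1 / r) *\<^sub>R v))\<^sup>2 / 2)"
    using c[of cos] r' unfolding gaussian_cos_sin by (simp add: power_divide field_simps)
  show "(\<integral>x. exp (- (norm (r *\<^sub>R x))\<^sup>2 / 2) * sin (v \<bullet> x) \<partial>lborel) = 0"
    using c[of sin] r' unfolding gaussian_cos_sin by simp
qed

section \<open>Continuity of translations\<close>

definition L1_shift_continuous :: "('a::euclidean_space \<Rightarrow> 'b::euclidean_space) \<Rightarrow> bool" where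
  "L1_shift_continuous f \<longleftrightarrow> integrable lborel f \<and>
     (\<forall>z. z \<longlonglongrightarrow> 0 \<longrightarrow> (\<lambda>n. \<integral>x. norm (f (x + z n) - f x) \<partial>lborel) \<longlonglongrightarrow> 0)"

lemma integrable_shift:
  fixes f :: "'a::euclidean_space \<Rightarrow> 'b::euclidean_space"
  assumes "integrable lborel f"
  shows "integrable lborel (\<lambda>x. f (x + z))"
  using lborel_affine_transfer(1)[of f 1 z] assms by (simp add: add.commute)

lemma integral_shift:
  fixes f :: "'a::euclidean_space \<Rightarrow> 'b::euclidean_space"
  assumes [measurable]: "f \<in> borel_measurable borel"
  shows "(\<integral>x. f (x + z) \<partial>lborel) = (\<integral>x. f x \<partial>lborel)"
  using lborel_affine_transfer(2)[of f 1 z] by (simp add: add.commute)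

text \<open>
  Shifting an approximant \<open>g\<close> and its error costs nothing in \<open>L\<^sup>1\<close> norm, so
  \<open>\<parallel>f\<^sub>z - f\<parallel> \<le> \<parallel>g\<^sub>z - g\<parallel> + 2 \<parallel>f - g\<parallel>\<close>: continuity of translations passes to limits in \<open>L\<^sup>1\<close>.
\<close>

lemma L1_shift_continuous_closed:
  fixes f :: "'a::euclidean_space \<Rightarrow> 'b::euclidean_space"
  assumes f: "integrable lborel f"
    and appr: "\<And>e::real. e > 0 \<Longrightarrow>
      \<exists>g. L1_shift_continuous g \<and> (\<integral>x. norm (f x - g x) \<partial>lborel) < e"
  shows "L1_shift_continuous f"
  unfolding L1_shift_continuous_def
proof (intro conjI allI impI f)
  fix z :: "nat \<Rightarrow> 'a" assume z: "z \<longlonglongrightarrow> 0"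
  show "(\<lambda>n. \<integral>x. norm (f (x + z n) - f x) \<partial>lborel) \<longlonglongrightarrow> 0"
  proof (rule LIMSEQ_I)
    fix e :: real assume "e > 0"
    then obtain g where g: "L1_shift_continuous g" and fg: "(\<integral>x. norm (f x - g x) \<partial>lborel) < e / 3"
      using appr[of "e / 3"] by auto
    have gi: "integrable lborel g" using g by (simp add: L1_shift_continuous_def)
    have "(\<lambda>n. \<integral>x. norm (g (x + z n) - g x) \<partial>lborel) \<longlonglongrightarrow> 0"
      using g z by (simp add: L1_shift_continuous_def)
    then obtain N where N: "\<And>n. n \<ge> N \<Longrightarrow> norm ((\<integral>x. norm (g (x + z n) - g x) \<partial>lborel) - 0) < e / 3"
      using \<open>e > 0\<close> by (meson LIMSEQ_D divide_pos_pos zero_less_numeral)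
    have "norm ((\<integral>x. norm (f (x + z n) - f x) \<partial>lborel) - 0) < e" if "n \<ge> N" for n
    proof -
      have [measurable]: "f \<in> borel_measurable borel" "g \<in> borel_measurable borel"
        using f gi by auto
      have i: "integrable lborel (\<lambda>x. norm (f x - g x))" using f gi by auto
      note i' = integrable_shift[OF i, of "z n"]
      have j: "integrable lborel (\<lambda>x. norm (g (x + z n) - g x))"
        using integrable_shift[OF gi, of "z n"] gi by auto
      have "(\<integral>x. norm (f (x + z n) - f x) \<partial>lborel)
        \<le> (\<integral>x. norm (f (x + z n) - g (x + z n)) + norm (g (x + z n) - g x) + norm (f x - g x) \<partial>lborel)"
      proof (rule integral_mono)
        show "integrable lborel (\<lambda>x. norm (f (x + z n) - f x))"
          using integrable_shift[OF f, of "z n"] f by auto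
        show "norm (f (x + z n) - f x) \<le>
            norm (f (x + z n) - g (x + z n)) + norm (g (x + z n) - g x) + norm (f x - g x)" for x
          by norm
      qed (use i i' j in auto)
      also have "\<dots> = (\<integral>x. norm (f (x + z n) - g (x + z n)) \<partial>lborel)
         + (\<integral>x. norm (g (x + z n) - g x) \<partial>lborel) + (\<integral>x. norm (f x - g x) \<partial>lborel)"
        using i i' j by simp
      also have "(\<integral>x. norm (f (x + z n) - g (x + z n)) \<partial>lborel) = (\<integral>x. norm (f x - g x) \<partial>lborel)"
        by (rule integral_shift) simp
      finally show ?thesis using N[OF that] fg by simp
    qed
    then show "\<exists>no. \<forall>n\<ge>no. norm ((\<integral>x. norm (f (x + z n) - f x) \<partial>lborel) - 0) < e" by blast
  qed
qed

text \<open>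
  For open \<open>U\<close> every point of \<open>U\<close> remains in \<open>U\<close> under small shifts. Hence the measure of the overlap
  of \<open>U\<close> with its shift tends to the measure of \<open>U\<close> by dominated convergence, and the symmetric
  difference has measure twice what the overlap misses.
\<close>

lemma L1_shift_continuous_open:
  fixes U :: "'a::euclidean_space set" and c :: "'b::euclidean_space"
  assumes U: "open U" "emeasure lborel U < \<infinity>"
  shows "L1_shift_continuous (\<lambda>x. indicator U x *\<^sub>R c)"
  unfolding L1_shift_continuous_def
proof (intro conjI allI impI)
  have [measurable]: "U \<in> sets borel" using U by simp
  have i: "integrable lborel (indicator U :: 'a \<Rightarrow> real)"
    using U by (simp add: integrable_indicator_iff)
  show "integrable lborel (\<lambda>x. indicator U x *\<^sub>R c)"
    using i by simp
  fix z :: "nat \<Rightarrow> 'a" assume z: "z \<longlonglongrightarrow> 0"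
  let ?I = "indicator U :: 'a \<Rightarrow> real"
  have p: "integrable lborel (\<lambda>x. ?I x * ?I (x + z n))" for n
    by (rule Bochner_Integration.integrable_bound[OF i]) (auto simp: indicator_def)
  have "(\<lambda>n. \<integral>x. ?I x * ?I (x + z n) \<partial>lborel) \<longlonglongrightarrow> (\<integral>x. ?I x \<partial>lborel)"
  proof (rule integral_dominated_convergence[where w = ?I])
    show "AE x in lborel. (\<lambda>n. ?I x * ?I (x + z n)) \<longlonglongrightarrow> ?I x"
    proof (rule AE_I2)
      fix x
      have xz: "(\<lambda>n. x + z n) \<longlonglongrightarrow> x + 0" using z by (intro tendsto_intros)
      show "(\<lambda>n. ?I x * ?I (x + z n)) \<longlonglongrightarrow> ?I x"
      proof (cases "x \<in> U")
        case True
        then have "eventually (\<lambda>n. x + z n \<in> U) sequentially"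
          using topological_tendstoD[OF xz, of U] U by simp
        then have "eventually (\<lambda>n. ?I x * ?I (x + z n) = ?I x) sequentially"
          by eventually_elim (simp add: True)
        then show ?thesis by (rule tendsto_eventually)
      qed simp
    qed
  qed (use i in \<open>auto simp: indicator_def\<close>)
  then have "(\<lambda>n. norm c * (2 * (\<integral>x. ?I x \<partial>lborel) - 2 * (\<integral>x. ?I x * ?I (x + z n) \<partial>lborel)))
     \<longlonglongrightarrow> norm c * (2 * (\<integral>x. ?I x \<partial>lborel) - 2 * (\<integral>x. ?I x \<partial>lborel))"
    by (intro tendsto_intros)
  moreover have "(\<integral>x. norm (?I (x + z n) *\<^sub>R c - ?I x *\<^sub>R c) \<partial>lborel)
     = norm c * (2 * (\<integral>x. ?I x \<partial>lborel) - 2 * (\<integral>x. ?I x * ?I (x + z n) \<partial>lborel))" for n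
  proof -
    have "(\<integral>x. norm (?I (x + z n) *\<^sub>R c - ?I x *\<^sub>R c) \<partial>lborel)
      = (\<integral>x. norm c * (?I (x + z n) + ?I x - 2 * (?I x * ?I (x + z n))) \<partial>lborel)"
      by (intro Bochner_Integration.integral_cong) (auto simp: indicator_def)
    also have "\<dots> = norm c * ((\<integral>x. ?I (x + z n) \<partial>lborel) + (\<integral>x. ?I x \<partial>lborel)
       - 2 * (\<integral>x. ?I x * ?I (x + z n) \<partial>lborel))"
      using i p integrable_shift[OF i, of "z n"] by simp
    also have "(\<integral>x. ?I (x + z n) \<partial>lborel) = (\<integral>x. ?I x \<partial>lborel)"
      by (rule integral_shift) simp
    finally show ?thesis by simp
  qed
  ultimately show "(\<lambda>n. \<integral>x. norm (?I (x + z n) *\<^sub>R c - ?I x *\<^sub>R c) \<partial>lborel) \<longlonglongrightarrow> 0"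
    by simp
qed

text \<open>
  Indicators of measurable sets are \<open>L\<^sup>1\<close>-limits of indicators of open sets by outer regularity, and
  simple functions are dense in \<open>L\<^sup>1\<close>.
\<close>

lemma L1_shift_continuous_integrable:
  fixes f :: "'a::euclidean_space \<Rightarrow> 'b::euclidean_space"
  assumes "integrable lborel f"
  shows "L1_shift_continuous f"
  using assms
proof (induction rule: integrable_induct)
  case (base A c)
  have A: "A \<in> sets borel" "emeasure lborel A < \<infinity>" using base by auto
  show ?case
  proof (rule L1_shift_continuous_closed)
    show "integrable lborel (\<lambda>x. indicator A x *\<^sub>R c)"
      using A by (auto simp: integrable_indicator_iff)
    fix e :: real assume "e > 0"
    obtain U where U: "open U" "A \<subseteq> U" "emeasure lborel (U - A) < ennreal (e / (norm c + 1))"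
      using outer_regular_lborel[OF A(1), of "e / (norm c + 1)"] \<open>e > 0\<close>
      by (metis add_nonneg_pos divide_pos_pos norm_ge_zero zero_less_one)
    have [measurable]: "U \<in> sets borel" "A \<in> sets borel" using U A by auto
    have fin: "emeasure lborel (U - A) < \<infinity>"
      using U(3) by (metis ennreal_less_top infinity_ennreal_def less_trans)
    have "U = A \<union> (U - A)" using U by auto
    then have "emeasure lborel U \<le> emeasure lborel A + emeasure lborel (U - A)"
      by (metis A(1) U(1) borel_open emeasure_subadditive sets.Diff sets_lborel)
    also have "\<dots> < \<infinity>" using A fin by simp
    finally have fU: "emeasure lborel U < \<infinity>" .
    have "(\<integral>x. norm (indicator A x *\<^sub>R c - indicator U x *\<^sub>R c) \<partial>lborel)
        = (\<integral>x. norm c * indicator (U - A) x \<partial>lborel)"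
      by (intro Bochner_Integration.integral_cong) (use U in \<open>auto simp: indicator_def\<close>)
    also have "\<dots> = norm c * measure lborel (U - A)" by simp
    also have "\<dots> \<le> norm c * (e / (norm c + 1))"
    proof (rule mult_left_mono)
      have "measure lborel (U - A) < e / (norm c + 1)"
        unfolding measure_def
        using U(3) fin \<open>e > 0\<close>
        by (subst enn2real_less_iff) (auto simp: add_nonneg_pos)
      then show "measure lborel (U - A) \<le> e / (norm c + 1)" by simp
    qed simp
    also have "\<dots> < e"
    proof -
      have "norm c + 1 > 0" by (simp add: add_nonneg_pos)
      then show ?thesis using \<open>e > 0\<close> by (simp add: pos_divide_less_eq algebra_simps)
    qed
    finally show "\<exists>g. L1_shift_continuous g \<and>
        (\<integral>x. norm (indicator A x *\<^sub>R c - g x) \<partial>lborel) < e"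
      using L1_shift_continuous_open[OF U(1) fU, of c] by blast
  qed
next
  case (add f g)
  show ?case
    unfolding L1_shift_continuous_def
  proof (intro conjI allI impI)
    show "integrable lborel (\<lambda>x. f x + g x)" using add by auto
    fix z :: "nat \<Rightarrow> 'a" assume z: "z \<longlonglongrightarrow> 0"
    have i: "integrable lborel (\<lambda>x. norm (f (x + z n) - f x))"
      "integrable lborel (\<lambda>x. norm (g (x + z n) - g x))" for n
      using add.hyps integrable_shift[OF add.hyps(1)] integrable_shift[OF add.hyps(2)] by simp_all
    have "(\<lambda>n. (\<integral>x. norm (f (x + z n) - f x) \<partial>lborel) + (\<integral>x. norm (g (x + z n) - g x) \<partial>lborel))
      \<longlonglongrightarrow> 0 + 0"
      using add.IH z unfolding L1_shift_continuous_def by (intro tendsto_add) blast+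
    then have lim: "(\<lambda>n. (\<integral>x. norm (f (x + z n) - f x) + norm (g (x + z n) - g x) \<partial>lborel))
      \<longlonglongrightarrow> 0"
      using i by simp
    show "(\<lambda>n. \<integral>x. norm (f (x + z n) + g (x + z n) - (f x + g x)) \<partial>lborel) \<longlonglongrightarrow> 0"
    proof (rule tendsto_sandwich[OF _ _ tendsto_const lim]; intro always_eventually allI)
      fix n
      show "0 \<le> (\<integral>x. norm (f (x + z n) + g (x + z n) - (f x + g x)) \<partial>lborel)" by simp
      show "(\<integral>x. norm (f (x + z n) + g (x + z n) - (f x + g x)) \<partial>lborel)
        \<le> (\<integral>x. norm (f (x + z n) - f x) + norm (g (x + z n) - g x) \<partial>lborel)"
      proof (rule integral_mono)
        show "integrable lborel (\<lambda>x. norm (f (x + z n) + g (x + z n) - (f x + g x)))"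
          using add.hyps integrable_shift[OF add.hyps(1), of "z n"]
            integrable_shift[OF add.hyps(2), of "z n"] by simp
        show "norm (f (x + z n) + g (x + z n) - (f x + g x))
          \<le> norm (f (x + z n) - f x) + norm (g (x + z n) - g x)" for x
          by norm
      qed (use i in auto)
    qed
  qed
next
  case (lim f s)
  show ?case
  proof (rule L1_shift_continuous_closed[OF lim.hyps(4)])
    fix e :: real assume "e > 0"
    have "(\<lambda>i. \<integral>x. norm (f x - s i x) \<partial>lborel) \<longlonglongrightarrow> (\<integral>x. 0 \<partial>(lborel :: 'a measure))"
    proof (rule integral_dominated_convergence[where w = "\<lambda>x. 3 * norm (f x)"])
      show "AE x in lborel. (\<lambda>i. norm (f x - s i x)) \<longlonglongrightarrow> 0"
      proof (rule AE_I2)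
        fix x
        have "(\<lambda>i. norm (f x - s i x)) \<longlonglongrightarrow> norm (f x - f x)"
          using lim.hyps(2)[of x] by (intro tendsto_intros) simp
        then show "(\<lambda>i. norm (f x - s i x)) \<longlonglongrightarrow> 0" by simp
      qed
      show "AE x in lborel. norm (norm (f x - s i x)) \<le> 3 * norm (f x)" for i
      proof (rule AE_I2)
        fix x
        show "norm (norm (f x - s i x)) \<le> 3 * norm (f x)"
          using lim.hyps(3)[of x i] norm_triangle_ineq4[of "f x" "s i x"] by simp
      qed
      show "(\<lambda>x. norm (f x - s i x)) \<in> borel_measurable lborel" for i
        using lim.hyps(1)[of i] lim.hyps(4) by auto
    qed (use lim.hyps(4) in auto)
    then have "eventually (\<lambda>i. (\<integral>x. norm (f x - s i x) \<partial>lborel) < e) sequentially"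
      using \<open>e > 0\<close> by (intro order_tendstoD) auto
    then obtain i where "(\<integral>x. norm (f x - s i x) \<partial>lborel) < e"
      by (auto simp: eventually_sequentially)
    with lim.IH[of i] show "\<exists>g. L1_shift_continuous g \<and> (\<integral>x. norm (f x - g x) \<partial>lborel) < e" by blast
  qed
qed

lemma integrable_inner_shift:
  fixes f :: "'a::euclidean_space \<Rightarrow> 'b::euclidean_space"
  assumes f: "f \<in> borel_measurable borel" and f2: "integrable lborel (\<lambda>x. (norm (f x))\<^sup>2)"
  shows "integrable lborel (\<lambda>x. norm (f x) * norm (f (x + z)))"
    and "(\<integral>x. norm (f x) * norm (f (x + z)) \<partial>lborel) \<le> (\<integral>x. (norm (f x))\<^sup>2 \<partial>lborel)"
    and "integrable lborel (\<lambda>x. f x \<bullet> f (x + z))"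
proof -
  note [measurable] = f
  note s = integrable_shift[OF f2, of z]
  have i: "integrable lborel (\<lambda>x. ((norm (f x))\<^sup>2 + (norm (f (x + z)))\<^sup>2) / 2)"
    using f2 s by auto
  have le: "norm (f x) * norm (f (x + z)) \<le> ((norm (f x))\<^sup>2 + (norm (f (x + z)))\<^sup>2) / 2" for x
    using sum_squares_bound[of "norm (f x)" "norm (f (x + z))"] by simp
  show 1: "integrable lborel (\<lambda>x. norm (f x) * norm (f (x + z)))"
    by (rule Bochner_Integration.integrable_bound[OF i])
       (measurable, intro AE_I2, use le in \<open>simp add: abs_mult\<close>)
  have "(\<integral>x. norm (f x) * norm (f (x + z)) \<partial>lborel)
      \<le> (\<integral>x. ((norm (f x))\<^sup>2 + (norm (f (x + z)))\<^sup>2) / 2 \<partial>lborel)"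
    by (rule integral_mono[OF 1 i le])
  also have "\<dots> = ((\<integral>x. (norm (f x))\<^sup>2 \<partial>lborel) + (\<integral>x. (norm (f (x + z)))\<^sup>2 \<partial>lborel)) / 2"
    using f2 s by simp
  also have "(\<integral>x. (norm (f (x + z)))\<^sup>2 \<partial>lborel) = (\<integral>x. (norm (f x))\<^sup>2 \<partial>lborel)"
    by (rule integral_shift) simp
  finally show "(\<integral>x. norm (f x) * norm (f (x + z)) \<partial>lborel) \<le> (\<integral>x. (norm (f x))\<^sup>2 \<partial>lborel)"
    by simp
  show "integrable lborel (\<lambda>x. f x \<bullet> f (x + z))"
    by (rule Bochner_Integration.integrable_bound[OF 1]) (auto simp: Cauchy_Schwarz_ineq2)
qed

definition autocorrelation :: "('a::euclidean_space \<Rightarrow> 'b::euclidean_space) \<Rightarrow> 'a \<Rightarrow> real" where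
  "autocorrelation f z = (\<integral>x. f x \<bullet> f (x + z) \<partial>lborel)"

lemma autocorrelation_bound:
  fixes f :: "'a::euclidean_space \<Rightarrow> 'b::euclidean_space"
  assumes f: "f \<in> borel_measurable borel" and f2: "integrable lborel (\<lambda>x. (norm (f x))\<^sup>2)"
  shows "\<bar>autocorrelation f z\<bar> \<le> (\<integral>x. (norm (f x))\<^sup>2 \<partial>lborel)"
proof -
  have "\<bar>autocorrelation f z\<bar> \<le> (\<integral>x. \<bar>f x \<bullet> f (x + z)\<bar> \<partial>lborel)"
    unfolding autocorrelation_def by (rule integral_abs_bound)
  also have "\<dots> \<le> (\<integral>x. norm (f x) * norm (f (x + z)) \<partial>lborel)"
    by (rule integral_mono)
       (use integrable_inner_shift[OF f f2, of z] in \<open>auto simp: Cauchy_Schwarz_ineq2\<close>)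
  also note integrable_inner_shift(2)[OF f f2]
  finally show ?thesis .
qed

text \<open>
  The difference to the limit is \<open>\<integral> f \<bullet> (f\<^sub>z - f)\<close>. The part of \<open>f\<close> bounded by \<open>m\<close> contributes at most
  \<open>m\<close> times the \<open>L\<^sup>1\<close> norm of \<open>f\<^sub>z - f\<close>, which tends to 0; the rest of \<open>f\<close> is small in \<open>L\<^sup>2\<close>, uniformly
  in the shift \<open>z\<close>.
\<close>

lemma autocorrelation_tendsto:
  fixes f :: "'a::euclidean_space \<Rightarrow> 'b::euclidean_space"
  assumes f: "integrable lborel f" and f2: "integrable lborel (\<lambda>x. (norm (f x))\<^sup>2)"
    and z: "z \<longlonglongrightarrow> 0"
  shows "(\<lambda>n. autocorrelation f (z n)) \<longlonglongrightarrow> (\<integral>x. (norm (f x))\<^sup>2 \<partial>lborel)"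
proof (rule LIMSEQ_I)
  let ?F = "\<integral>x. (norm (f x))\<^sup>2 \<partial>lborel"
  fix e :: real assume e: "e > 0"
  have [measurable]: "f \<in> borel_measurable borel" using f by auto
  have F0: "?F \<ge> 0" by simp
  \<comment> \<open>the weight of the inequality \<open>2 s t \<le> s\<^sup>2/d + d t\<^sup>2\<close> between the two factors of the unbounded part\<close>
  define d where "d = e / (8 * (?F + 1))"
  have d: "d > 0" "2 * d * ?F < e / 3"
    using e F0 by (auto simp: d_def field_simps add_pos_nonneg intro!: divide_pos_pos)
  define u where "u m x = (if norm (f x) \<le> real m then f x else 0)" for m :: nat and x
  have [measurable]: "u m \<in> borel_measurable borel" for m unfolding u_def by measurable
  have "(\<lambda>m. \<integral>x. (norm (f x - u m x))\<^sup>2 \<partial>lborel) \<longlonglongrightarrow> (\<integral>x. 0 \<partial>(lborel :: 'a measure))"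
  proof (rule integral_dominated_convergence[where w = "\<lambda>x. (norm (f x))\<^sup>2"])
    show "AE x in lborel. (\<lambda>m. (norm (f x - u m x))\<^sup>2) \<longlonglongrightarrow> 0"
    proof (rule AE_I2)
      fix x
      obtain M where M: "norm (f x) \<le> real M" using real_arch_simple by blast
      have "eventually (\<lambda>m. (norm (f x - u m x))\<^sup>2 = 0) sequentially"
        using eventually_ge_at_top[of M] by eventually_elim (use M in \<open>auto simp: u_def\<close>)
      then show "(\<lambda>m. (norm (f x - u m x))\<^sup>2) \<longlonglongrightarrow> 0" by (rule tendsto_eventually)
    qed
  qed (use f2 in \<open>auto simp: u_def\<close>)
  then have "eventually (\<lambda>m. (\<integral>x. (norm (f x - u m x))\<^sup>2 \<partial>lborel) < 2 * d * e / 3) sequentially"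
    using d e by (intro order_tendstoD) auto
  then obtain m where m: "(\<integral>x. (norm (f x - u m x))\<^sup>2 \<partial>lborel) < 2 * d * e / 3"
    by (auto simp: eventually_sequentially)
  have um2: "integrable lborel (\<lambda>x. (norm (f x - u m x))\<^sup>2)"
    by (rule Bochner_Integration.integrable_bound[OF f2]) (auto simp: u_def)
  have "(\<lambda>n. \<integral>x. norm (f (x + z n) - f x) \<partial>lborel) \<longlonglongrightarrow> 0"
    using L1_shift_continuous_integrable[OF f] z by (simp add: L1_shift_continuous_def)
  then have "(\<lambda>n. real m * (\<integral>x. norm (f (x + z n) - f x) \<partial>lborel)) \<longlonglongrightarrow> real m * 0"
    by (intro tendsto_intros)
  then have "eventually (\<lambda>n. real m * (\<integral>x. norm (f (x + z n) - f x) \<partial>lborel) < e / 3) sequentially"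
    using e by (intro order_tendstoD) auto
  then obtain N where N: "\<And>n. n \<ge> N \<Longrightarrow> real m * (\<integral>x. norm (f (x + z n) - f x) \<partial>lborel) < e / 3"
    by (auto simp: eventually_sequentially)
  have "norm (autocorrelation f (z n) - ?F) < e" if "n \<ge> N" for n
  proof -
    have fs: "integrable lborel (\<lambda>x. f (x + z n))" "integrable lborel (\<lambda>x. (norm (f (x + z n)))\<^sup>2)"
      using integrable_shift[OF f] integrable_shift[OF f2] by auto
    have ff: "integrable lborel (\<lambda>x. f x \<bullet> f x)"
      using f2 by (simp add: power2_norm_eq_inner)
    have i1: "integrable lborel (\<lambda>x. real m * norm (f (x + z n) - f x))"
      using f fs by auto
    have i2: "integrable lborel (\<lambda>x. (norm (f x - u m x))\<^sup>2 / (2 * d))"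
      using um2 by auto
    have i3: "integrable lborel (\<lambda>x. d * ((norm (f (x + z n)))\<^sup>2 + (norm (f x))\<^sup>2))"
      using f2 fs by auto
    note i0 = integrable_inner_shift(3)[OF _ f2, of "z n"]
    have pt: "\<bar>f x \<bullet> f (x + z n) - f x \<bullet> f x\<bar> \<le> real m * norm (f (x + z n) - f x)
       + (norm (f x - u m x))\<^sup>2 / (2 * d) + d * ((norm (f (x + z n)))\<^sup>2 + (norm (f x))\<^sup>2)" for x
    proof -
      let ?h = "f (x + z n) - f x"
      have "f x \<bullet> f (x + z n) - f x \<bullet> f x = u m x \<bullet> ?h + (f x - u m x) \<bullet> ?h"
        by (simp add: algebra_simps)
      also have "\<bar>\<dots>\<bar> \<le> norm (u m x) * norm ?h + norm (f x - u m x) * norm ?h"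
        using Cauchy_Schwarz_ineq2[of "u m x" ?h] Cauchy_Schwarz_ineq2[of "f x - u m x" ?h] by linarith
      also have "norm (u m x) * norm ?h \<le> real m * norm ?h"
        by (rule mult_right_mono) (auto simp: u_def)
      also have "norm (f x - u m x) * norm ?h \<le> (norm (f x - u m x))\<^sup>2 / (2 * d) + d / 2 * (norm ?h)\<^sup>2"
      proof -
        have "0 \<le> (norm (f x - u m x) - d * norm ?h)\<^sup>2 / (2 * d)" using d by simp
        then show ?thesis using d by (simp add: power2_diff field_simps power2_eq_square)
      qed
      also have "d / 2 * (norm ?h)\<^sup>2 \<le> d / 2 * (2 * ((norm (f (x + z n)))\<^sup>2 + (norm (f x))\<^sup>2))"
      proof (rule mult_left_mono)
        have "(norm ?h)\<^sup>2 \<le> (norm (f (x + z n)) + norm (f x))\<^sup>2"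
          by (intro power_mono norm_triangle_ineq4) simp
        also have "\<dots> \<le> 2 * ((norm (f (x + z n)))\<^sup>2 + (norm (f x))\<^sup>2)"
          using sum_squares_bound[of "norm (f (x + z n))" "norm (f x)"] by (simp add: power2_sum)
        finally show "(norm ?h)\<^sup>2 \<le> 2 * ((norm (f (x + z n)))\<^sup>2 + (norm (f x))\<^sup>2)" .
      qed (use d in simp)
      finally show ?thesis by (simp add: distrib_left)
    qed
    have "autocorrelation f (z n) - ?F = (\<integral>x. f x \<bullet> f (x + z n) - f x \<bullet> f x \<partial>lborel)"
      unfolding autocorrelation_def using i0 ff by (simp add: power2_norm_eq_inner)
    then have "norm (autocorrelation f (z n) - ?F) \<le> (\<integral>x. \<bar>f x \<bullet> f (x + z n) - f x \<bullet> f x\<bar> \<partial>lborel)"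
      by (simp only: real_norm_def integral_abs_bound)
    also have "\<dots> \<le> (\<integral>x. real m * norm (f (x + z n) - f x)
       + (norm (f x - u m x))\<^sup>2 / (2 * d) + d * ((norm (f (x + z n)))\<^sup>2 + (norm (f x))\<^sup>2) \<partial>lborel)"
      by (rule integral_mono) (use i0 ff i1 i2 i3 pt in auto)
    also have "\<dots> = real m * (\<integral>x. norm (f (x + z n) - f x) \<partial>lborel)
       + (\<integral>x. (norm (f x - u m x))\<^sup>2 \<partial>lborel) / (2 * d)
       + d * ((\<integral>x. (norm (f (x + z n)))\<^sup>2 \<partial>lborel) + ?F)"
      using i1 i2 i3 f2 fs by simp
    also have "(\<integral>x. (norm (f (x + z n)))\<^sup>2 \<partial>lborel) = ?F"
      by (rule integral_shift) simp
    also have "(\<integral>x. (norm (f x - u m x))\<^sup>2 \<partial>lborel) / (2 * d) < e / 3"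
      using m d by (simp add: field_simps)
    finally show ?thesis using N[OF that] d(2) by simp
  qed
  then show "\<exists>no. \<forall>n\<ge>no. norm (autocorrelation f (z n) - ?F) < e" by blast
qed

section \<open>Cosine and sine transforms\<close>

definition cos_transform :: "('a::euclidean_space \<Rightarrow> 'b::euclidean_space) \<Rightarrow> 'a \<Rightarrow> 'b" where
  "cos_transform f w = (\<integral>x. cos (x \<bullet> w) *\<^sub>R f x \<partial>lborel)"

definition sin_transform :: "('a::euclidean_space \<Rightarrow> 'b::euclidean_space) \<Rightarrow> 'a \<Rightarrow> 'b" where
  "sin_transform f w = (\<integral>x. sin (x \<bullet> w) *\<^sub>R f x \<partial>lborel)"

lemma integrable_cos_sin:
  fixes f :: "'a::euclidean_space \<Rightarrow> 'b::euclidean_space"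
  assumes f: "integrable lborel f"
  shows "integrable lborel (\<lambda>x. cos (x \<bullet> w) *\<^sub>R f x)" "integrable lborel (\<lambda>x. sin (x \<bullet> w) *\<^sub>R f x)"
proof -
  have [measurable]: "f \<in> borel_measurable borel" using f by auto
  show "integrable lborel (\<lambda>x. cos (x \<bullet> w) *\<^sub>R f x)" "integrable lborel (\<lambda>x. sin (x \<bullet> w) *\<^sub>R f x)"
    by (rule Bochner_Integration.integrable_bound[OF f];
        auto simp: mult_left_le_one_le abs_cos_le_one abs_sin_le_one)+
qed

lemma transform_measurable [measurable]:
  fixes f :: "'a::euclidean_space \<Rightarrow> 'b::euclidean_space"
  assumes [measurable]: "f \<in> borel_measurable borel"
  shows "cos_transform f \<in> borel_measurable borel" "sin_transform f \<in> borel_measurable borel"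
  unfolding cos_transform_def[abs_def] sin_transform_def[abs_def]
  by (rule lborel.borel_measurable_lebesgue_integral; measurable)+

lemma (in pair_sigma_finite) integrable_mult_pair:
  fixes u v :: "_ \<Rightarrow> real"
  assumes u: "integrable M1 u" and v: "integrable M2 v"
  shows "integrable (M1 \<Otimes>\<^sub>M M2) (\<lambda>p. u (fst p) * v (snd p))"
proof (rule Fubini_integrable)
  have [measurable]: "u \<in> borel_measurable M1" "v \<in> borel_measurable M2" using u v by auto
  show "(\<lambda>p. u (fst p) * v (snd p)) \<in> borel_measurable (M1 \<Otimes>\<^sub>M M2)" by measurable
  have "integrable M1 (\<lambda>x. \<bar>u x\<bar> * (\<integral>y. \<bar>v y\<bar> \<partial>M2))" using u by simp
  then show "integrable M1 (\<lambda>x. \<integral>y. norm (u (fst (x, y)) * v (snd (x, y))) \<partial>M2)"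
    by (simp add: abs_mult)
  show "AE x in M1. integrable M2 (\<lambda>y. u (fst (x, y)) * v (snd (x, y)))" using v by simp
qed

text \<open>
  Without the Gaussian factor the squared modulus of a transform is not known to be integrable. With
  it, the energy is an absolutely convergent triple integral of \<open>f x \<bullet> f y\<close> against
  \<open>cos ((x - y) \<bullet> w)\<close>. Integrating over \<open>w\<close> first gives a Gaussian in \<open>(x - y)/r\<close>, and the
  substitution \<open>y = x + r z\<close> cancels the powers of \<open>r\<close>.
\<close>

lemma regularized_energy:
  fixes f :: "'a::euclidean_space \<Rightarrow> 'b::euclidean_space"
  assumes f: "integrable lborel f" and f2: "integrable lborel (\<lambda>x. (norm (f x))\<^sup>2)" and r: "r > 0"
  shows "integrable lborel (\<lambda>w. exp (- (norm (r *\<^sub>R w))\<^sup>2 / 2)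
      * ((norm (cos_transform f w))\<^sup>2 + (norm (sin_transform f w))\<^sup>2))" (is ?I)
    and "(\<integral>w. exp (- (norm (r *\<^sub>R w))\<^sup>2 / 2)
      * ((norm (cos_transform f w))\<^sup>2 + (norm (sin_transform f w))\<^sup>2) \<partial>lborel)
    = sqrt (2 * pi) ^ DIM('a)
      * (\<integral>z. exp (- (norm z)\<^sup>2 / 2) * autocorrelation f (r *\<^sub>R z) \<partial>lborel)" (is ?E)
proof -
  have [measurable]: "f \<in> borel_measurable borel" using f by auto
  let ?g = "\<lambda>w::'a. exp (- (norm (r *\<^sub>R w))\<^sup>2 / 2)"
  let ?k = "\<lambda>v::'a. (sqrt (2 * pi) / r) ^ DIM('a) * exp (- (norm ((1 / r) *\<^sub>R v))\<^sup>2 / 2)"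
  let ?P = "\<lambda>w x y. ?g w * ((f x \<bullet> f y) * cos ((x - y) \<bullet> w))"
  note fi = integrable_cos_sin[OF f]
  have in1: "integrable lborel (\<lambda>p::'a \<times> 'a. norm (f (fst p)) * norm (f (snd p)))"
    using lborel_pair.integrable_mult_pair[of "\<lambda>x. norm (f x)" "\<lambda>x. norm (f x)"] f
    by (simp add: lborel_prod)
  have in2: "integrable (lborel \<Otimes>\<^sub>M lborel) (\<lambda>q::'a \<times> ('a \<times> 'a).
      ?g (fst q) * (norm (f (fst (snd q))) * norm (f (snd (snd q)))))"
    using lborel_pair.integrable_mult_pair[OF gaussian_scaled(1)[OF r] in1] .
  have le: "\<bar>(f x \<bullet> f y) * c\<bar> \<le> norm (f x) * norm (f y)" if "\<bar>c\<bar> \<le> 1" for x y c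
  proof -
    have "\<bar>f x \<bullet> f y\<bar> * \<bar>c\<bar> \<le> norm (f x) * norm (f y) * 1"
      by (rule mult_mono) (use that in \<open>auto simp: Cauchy_Schwarz_ineq2\<close>)
    then show ?thesis by (simp add: abs_mult)
  qed
  have K: "integrable (lborel \<Otimes>\<^sub>M lborel) (\<lambda>(w, p). ?P w (fst p) (snd p))"
  proof (rule Bochner_Integration.integrable_bound[OF in2])
    show "(\<lambda>(w, p). ?P w (fst p) (snd p)) \<in> borel_measurable (lborel \<Otimes>\<^sub>M lborel)"
    proof -
      have m: "(\<lambda>q. f (fst (snd q))) \<in> borel_measurable (borel :: ('a \<times> 'a \<times> 'a) measure)"
        "(\<lambda>q. f (snd (snd q))) \<in> borel_measurable (borel :: ('a \<times> 'a \<times> 'a) measure)"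
        by (rule measurable_compose[where g = f and N = borel];
            auto intro!: borel_measurable_continuous_onI continuous_intros)+
      have m': "(\<lambda>q. cos ((fst (snd q) - snd (snd q)) \<bullet> fst q))
          \<in> borel_measurable (borel :: ('a \<times> 'a \<times> 'a) measure)"
        "(\<lambda>q. ?g (fst q)) \<in> borel_measurable (borel :: ('a \<times> 'a \<times> 'a) measure)"
        by (intro borel_measurable_continuous_onI continuous_intros; simp)+
      show ?thesis unfolding split_beta' lborel_prod
        by (intro borel_measurable_times borel_measurable_inner) (simp_all only: measurable_lborel2 m m')
    qed
    show "AE q in lborel \<Otimes>\<^sub>M lborel. norm (case q of (w, p) \<Rightarrow> ?P w (fst p) (snd p))
       \<le> norm (?g (fst q) * (norm (f (fst (snd q))) * norm (f (snd (snd q)))))"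
      by (rule AE_I2) (auto simp: abs_mult intro!: mult_left_mono le[unfolded abs_mult])
  qed
  have pm: "(\<lambda>p. f (fst p)) \<in> borel_measurable (lborel :: ('a \<times> 'a) measure)"
    "(\<lambda>p. f (snd p)) \<in> borel_measurable (lborel :: ('a \<times> 'a) measure)"
    by (unfold measurable_lborel2, rule measurable_compose[where g = f and N = borel];
        auto intro!: borel_measurable_continuous_onI continuous_intros)+
  have Kp: "integrable (lborel \<Otimes>\<^sub>M lborel) (\<lambda>(x, y). ?P w x y)" for w
  proof -
    have "integrable lborel (\<lambda>p. ?P w (fst p) (snd p))"
    proof (rule Bochner_Integration.integrable_bound)
      show "integrable lborel (\<lambda>p::'a \<times> 'a. ?g w * (norm (f (fst p)) * norm (f (snd p))))"
        using in1 by simp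
      show "AE p in lborel. norm (?P w (fst p) (snd p)) \<le> norm (?g w * (norm (f (fst p)) * norm (f (snd p))))"
        by (rule AE_I2) (auto simp: abs_mult intro!: mult_left_mono le[unfolded abs_mult])
    qed (intro borel_measurable_times borel_measurable_inner pm;
        auto intro!: borel_measurable_continuous_onI continuous_intros)
    then show ?thesis by (simp add: lborel_prod split_beta')
  qed
  have kp: "integrable (lborel \<Otimes>\<^sub>M lborel) (\<lambda>(x, y). (f x \<bullet> f y) * ?k (x - y))"
  proof -
    have "integrable lborel (\<lambda>p. (f (fst p) \<bullet> f (snd p)) * ?k (fst p - snd p))"
    proof (rule Bochner_Integration.integrable_bound)
      show "integrable lborel (\<lambda>p::'a \<times> 'a. (sqrt (2 * pi) / r) ^ DIM('a) * (norm (f (fst p)) * norm (f (snd p))))"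
        using in1 by simp
      show "AE p in lborel. norm ((f (fst p) \<bullet> f (snd p)) * ?k (fst p - snd p))
         \<le> norm ((sqrt (2 * pi) / r) ^ DIM('a) * (norm (f (fst p)) * norm (f (snd p))))"
      proof (rule AE_I2)
        fix p :: "'a \<times> 'a"
        have "\<bar>(f (fst p) \<bullet> f (snd p)) * exp (- (norm ((1 / r) *\<^sub>R (fst p - snd p)))\<^sup>2 / 2)\<bar>
          \<le> norm (f (fst p)) * norm (f (snd p))" by (rule le) simp
        from mult_left_mono[OF this, of "(sqrt (2 * pi) / r) ^ DIM('a)"] r
        show "norm ((f (fst p) \<bullet> f (snd p)) * ?k (fst p - snd p))
         \<le> norm ((sqrt (2 * pi) / r) ^ DIM('a) * (norm (f (fst p)) * norm (f (snd p))))"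
          by (simp add: abs_mult mult_ac)
      qed
    qed (intro borel_measurable_times borel_measurable_inner pm;
        auto intro!: borel_measurable_continuous_onI continuous_intros simp: r[THEN less_imp_neq, symmetric])
    then show ?thesis by (simp add: lborel_prod split_beta')
  qed
  \<comment> \<open>the addition theorem of the cosine combines the two squares into one double integral\<close>
  have expand: "?g w * ((norm (cos_transform f w))\<^sup>2 + (norm (sin_transform f w))\<^sup>2)
      = (\<integral>p. ?P w (fst p) (snd p) \<partial>lborel)" for w
  proof -
    let ?C = "cos_transform f w" and ?S = "sin_transform f w"
    have y: "(\<integral>y. ?P w x y \<partial>lborel) = ?g w * ((cos (x \<bullet> w) *\<^sub>R f x) \<bullet> ?C + (sin (x \<bullet> w) *\<^sub>R f x) \<bullet> ?S)" for x
    proof -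
      have "(\<integral>y. ?P w x y \<partial>lborel) = (\<integral>y. ?g w * ((cos (x \<bullet> w) *\<^sub>R f x) \<bullet> (cos (y \<bullet> w) *\<^sub>R f y)
         + (sin (x \<bullet> w) *\<^sub>R f x) \<bullet> (sin (y \<bullet> w) *\<^sub>R f y)) \<partial>lborel)"
        by (intro Bochner_Integration.integral_cong)
           (simp_all add: inner_diff_left cos_diff algebra_simps)
      also have "\<dots> = ?g w * ((cos (x \<bullet> w) *\<^sub>R f x) \<bullet> ?C + (sin (x \<bullet> w) *\<^sub>R f x) \<bullet> ?S)"
        unfolding integral_mult_right_zero cos_transform_def sin_transform_def
        by (subst Bochner_Integration.integral_add; (intro integrable_inner_right fi)?)
           (simp only: integral_inner_right[OF fi(1)] integral_inner_right[OF fi(2)])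
      finally show ?thesis .
    qed
    have "(\<integral>p. ?P w (fst p) (snd p) \<partial>lborel) = (\<integral>x. \<integral>y. ?P w x y \<partial>lborel \<partial>lborel)"
      using lborel_pair.integral_fst[OF Kp[of w]] by (simp add: lborel_prod split_beta')
    also have "\<dots> = ?g w * (?C \<bullet> ?C + ?S \<bullet> ?S)"
      apply (simp only: y)
      apply (simp only: integral_mult_right_zero)
      apply (subst Bochner_Integration.integral_add; (intro integrable_inner_left fi)?)
      apply (simp only: integral_inner_left[OF fi(1)] integral_inner_left[OF fi(2)])
      apply (simp only: cos_transform_def sin_transform_def)
      done
    finally show ?thesis by (simp add: power2_norm_eq_inner)
  qed
  have sw: "(\<integral>w. \<integral>p. ?P w (fst p) (snd p) \<partial>lborel \<partial>lborel) = (\<integral>p. \<integral>w. ?P w (fst p) (snd p) \<partial>lborel \<partial>lborel)"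
    by (rule lborel_pair.Fubini_integral[OF K, symmetric])
  show ?I
    unfolding expand by (rule lborel_pair.integrable_fst[OF K])
  have inner: "(\<integral>w. ?P w x y \<partial>lborel) = (f x \<bullet> f y) * ?k (x - y)" for x y
  proof -
    have "(\<integral>w. ?P w x y \<partial>lborel) = (\<integral>w. (f x \<bullet> f y) * (?g w * cos ((x - y) \<bullet> w)) \<partial>lborel)"
      by (intro Bochner_Integration.integral_cong) simp_all
    also have "\<dots> = (f x \<bullet> f y) * ?k (x - y)"
      by (simp only: integral_mult_right_zero gaussian_scaled(2)[OF r])
    finally show ?thesis .
  qed
  have subst: "(\<integral>y. (f x \<bullet> f y) * ?k (x - y) \<partial>lborel)
     = (\<integral>z. sqrt (2 * pi) ^ DIM('a) * (exp (- (norm z)\<^sup>2 / 2) * (f x \<bullet> f (x + r *\<^sub>R z))) \<partial>lborel)" for x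
  proof -
    have "(\<integral>y. (f x \<bullet> f y) * ?k (x - y) \<partial>lborel)
      = r ^ DIM('a) * (\<integral>z. (f x \<bullet> f (x + r *\<^sub>R z)) * ?k (x - (x + r *\<^sub>R z)) \<partial>lborel)"
      using lborel_affine_transfer(2)[of "\<lambda>y. (f x \<bullet> f y) * ?k (x - y)" r x] r by simp
    also have "\<dots> = (\<integral>z. r ^ DIM('a) * ((f x \<bullet> f (x + r *\<^sub>R z)) * ?k (x - (x + r *\<^sub>R z))) \<partial>lborel)"
      by simp
    also have "\<dots> = (\<integral>z. sqrt (2 * pi) ^ DIM('a) * (exp (- (norm z)\<^sup>2 / 2) * (f x \<bullet> f (x + r *\<^sub>R z))) \<partial>lborel)"
      using r by (intro Bochner_Integration.integral_cong) (simp_all add: power_divide)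
    finally show ?thesis .
  qed
  have G: "integrable (lborel \<Otimes>\<^sub>M lborel) (\<lambda>(z, x). exp (- (norm z)\<^sup>2 / 2) * (f x \<bullet> f (x + r *\<^sub>R z)))"
  proof (rule lborel_pair.Fubini_integrable)
    show "(\<lambda>(z, x). exp (- (norm z)\<^sup>2 / 2) * (f x \<bullet> f (x + r *\<^sub>R z))) \<in> borel_measurable (lborel \<Otimes>\<^sub>M lborel)"
    proof -
      have "(\<lambda>q. f (snd q + r *\<^sub>R fst q)) \<in> borel_measurable (lborel :: ('a \<times> 'a) measure)"
        by (unfold measurable_lborel2, rule measurable_compose[where g = f and N = borel];
            auto intro!: borel_measurable_continuous_onI continuous_intros)
      then show ?thesis
        unfolding split_beta' lborel_prod
        by (intro borel_measurable_times borel_measurable_inner pm)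
           (auto intro!: borel_measurable_continuous_onI continuous_intros)
    qed
    have "integrable lborel (\<lambda>z::'a. exp (- (norm z)\<^sup>2 / 2) * (\<integral>x. \<bar>f x \<bullet> f (x + r *\<^sub>R z)\<bar> \<partial>lborel))"
    proof (rule Bochner_Integration.integrable_bound)
      show "integrable lborel (\<lambda>z::'a. exp (- (norm z)\<^sup>2 / 2) * (\<integral>x. (norm (f x))\<^sup>2 \<partial>lborel))"
        by (intro integrable_mult_left integrable_gaussian)
      show "AE z in lborel. norm (exp (- (norm z)\<^sup>2 / 2) * (\<integral>x. \<bar>f x \<bullet> f (x + r *\<^sub>R z)\<bar> \<partial>lborel))
        \<le> norm (exp (- (norm z)\<^sup>2 / 2) * (\<integral>x. (norm (f x))\<^sup>2 \<partial>lborel))"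
      proof (rule AE_I2)
        fix z :: 'a
        have "(\<integral>x. \<bar>f x \<bullet> f (x + r *\<^sub>R z)\<bar> \<partial>lborel) \<le> (\<integral>x. norm (f x) * norm (f (x + r *\<^sub>R z)) \<partial>lborel)"
          by (rule integral_mono)
             (use integrable_inner_shift[OF _ f2, of "r *\<^sub>R z"] in \<open>auto simp: Cauchy_Schwarz_ineq2\<close>)
        also have "\<dots> \<le> (\<integral>x. (norm (f x))\<^sup>2 \<partial>lborel)"
          by (rule integrable_inner_shift(2)[OF _ f2]) simp
        finally show "norm (exp (- (norm z)\<^sup>2 / 2) * (\<integral>x. \<bar>f x \<bullet> f (x + r *\<^sub>R z)\<bar> \<partial>lborel))
          \<le> norm (exp (- (norm z)\<^sup>2 / 2) * (\<integral>x. (norm (f x))\<^sup>2 \<partial>lborel))"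
          by (simp add: abs_mult)
      qed
    qed measurable
    then show "integrable lborel (\<lambda>z. \<integral>x. norm (case (z, x) of (z, x) \<Rightarrow>
        exp (- (norm z)\<^sup>2 / 2) * (f x \<bullet> f (x + r *\<^sub>R z))) \<partial>lborel)"
      by (simp add: abs_mult)
    show "AE z in lborel. integrable lborel (\<lambda>x. case (z, x) of (z, x) \<Rightarrow>
        exp (- (norm z)\<^sup>2 / 2) * (f x \<bullet> f (x + r *\<^sub>R z)))"
      using integrable_inner_shift(3)[OF _ f2] by simp
  qed
  have "(\<integral>w. ?g w * ((norm (cos_transform f w))\<^sup>2 + (norm (sin_transform f w))\<^sup>2) \<partial>lborel)
      = (\<integral>p. (f (fst p) \<bullet> f (snd p)) * ?k (fst p - snd p) \<partial>lborel)"
    unfolding expand sw inner ..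
  also have "\<dots> = (\<integral>x. \<integral>y. (f x \<bullet> f y) * ?k (x - y) \<partial>lborel \<partial>lborel)"
    using lborel_pair.integral_fst[OF kp] by (simp add: lborel_prod split_beta')
  also have "\<dots> = sqrt (2 * pi) ^ DIM('a) *
      (\<integral>x. \<integral>z. exp (- (norm z)\<^sup>2 / 2) * (f x \<bullet> f (x + r *\<^sub>R z)) \<partial>lborel \<partial>lborel)"
    unfolding subst by simp
  also have "(\<integral>x. \<integral>z. exp (- (norm z)\<^sup>2 / 2) * (f x \<bullet> f (x + r *\<^sub>R z)) \<partial>lborel \<partial>lborel)
     = (\<integral>z. \<integral>x. exp (- (norm z)\<^sup>2 / 2) * (f x \<bullet> f (x + r *\<^sub>R z)) \<partial>lborel \<partial>lborel)"
    by (rule lborel_pair.Fubini_integral[OF G])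
  also have "\<dots> = (\<integral>z. exp (- (norm z)\<^sup>2 / 2) * autocorrelation f (r *\<^sub>R z) \<partial>lborel)"
    by (simp add: autocorrelation_def)
  finally show ?E .
qed

section \<open>Square integrable functions\<close>

definition L2_norm_sq :: "('a::euclidean_space \<Rightarrow> 'b::euclidean_space) \<Rightarrow> ennreal" where
  "L2_norm_sq f = (\<integral>\<^sup>+x. ennreal ((norm (f x))\<^sup>2) \<partial>lborel)"

lemma L2_norm_sq_finite_iff:
  fixes f :: "'a::euclidean_space \<Rightarrow> 'b::euclidean_space"
  assumes [measurable]: "f \<in> borel_measurable borel"
  shows "L2_norm_sq f < \<infinity> \<longleftrightarrow> integrable lborel (\<lambda>x. (norm (f x))\<^sup>2)"
  by (simp add: L2_norm_sq_def integrable_iff_bounded)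

lemma L2_norm_sq_eq_integral:
  fixes f :: "'a::euclidean_space \<Rightarrow> 'b::euclidean_space"
  assumes "f \<in> borel_measurable borel" "L2_norm_sq f < \<infinity>"
  shows "L2_norm_sq f = ennreal (\<integral>x. (norm (f x))\<^sup>2 \<partial>lborel)"
  using L2_norm_sq_finite_iff[OF assms(1)] assms(2) unfolding L2_norm_sq_def
  by (intro nn_integral_eq_integral) auto

text \<open>
  A squared triangle inequality whose leading constant is as close to 1 as desired. Being pointwise,
  it integrates to a comparison of \<open>L\<^sup>2\<close> norms valued in \<open>[0, \<infinity>]\<close>.
\<close>

lemma power2_norm_le_weighted:
  fixes a b :: "'b::real_normed_vector"
  assumes d: "d > 0"
  shows "(norm a)\<^sup>2 \<le> (1 + d) * (norm b)\<^sup>2 + (1 + 1 / d) * (norm (a - b))\<^sup>2"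
proof -
  let ?p = "norm b" and ?q = "norm (a - b)"
  have "norm a \<le> ?p + ?q" by norm
  then have "(norm a)\<^sup>2 \<le> (?p + ?q)\<^sup>2" by (intro power_mono) auto
  moreover have "2 * ?p * ?q \<le> d * ?p\<^sup>2 + ?q\<^sup>2 / d"
  proof -
    have "d * ?p\<^sup>2 + ?q\<^sup>2 / d - 2 * ?p * ?q = (d * ?p - ?q)\<^sup>2 / d"
      using d by (simp add: power2_diff field_simps power2_eq_square)
    also have "\<dots> \<ge> 0" using d by simp
    finally show ?thesis by simp
  qed
  ultimately show ?thesis by (simp add: power2_sum distrib_right)
qed

lemma L2_norm_sq_le_weighted:
  fixes u v :: "'a::euclidean_space \<Rightarrow> 'b::euclidean_space"
  assumes [measurable]: "u \<in> borel_measurable borel" "v \<in> borel_measurable borel" and d: "d > 0"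
  shows "L2_norm_sq u \<le> ennreal (1 + d) * L2_norm_sq v + ennreal (1 + 1 / d) * L2_norm_sq (\<lambda>x. u x - v x)"
proof -
  have "L2_norm_sq u \<le> (\<integral>\<^sup>+x. ennreal ((1 + d) * (norm (v x))\<^sup>2 + (1 + 1 / d) * (norm (u x - v x))\<^sup>2) \<partial>lborel)"
    unfolding L2_norm_sq_def by (intro nn_integral_mono ennreal_leI power2_norm_le_weighted[OF d])
  also have "\<dots> = ennreal (1 + d) * L2_norm_sq v + ennreal (1 + 1 / d) * L2_norm_sq (\<lambda>x. u x - v x)"
    using d by (simp add: L2_norm_sq_def ennreal_mult nn_integral_add nn_integral_cmult)
  finally show ?thesis .
qed

lemma L2_norm_sq_diff_commute: "L2_norm_sq (\<lambda>x. u x - v x) = L2_norm_sq (\<lambda>x. v x - u x)"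
  by (simp add: L2_norm_sq_def norm_minus_commute)

lemma L2_norm_sq_diff_le:
  fixes u v :: "'a::euclidean_space \<Rightarrow> 'b::euclidean_space"
  assumes [measurable]: "u \<in> borel_measurable borel" "v \<in> borel_measurable borel"
  shows "L2_norm_sq (\<lambda>x. u x - v x) \<le> 2 * L2_norm_sq u + 2 * L2_norm_sq v"
proof -
  have "L2_norm_sq (\<lambda>x. u x - v x) \<le> ennreal (1 + 1) * L2_norm_sq u
      + ennreal (1 + 1 / 1) * L2_norm_sq (\<lambda>x. u x - v x - u x)"
    by (rule L2_norm_sq_le_weighted) auto
  also have "L2_norm_sq (\<lambda>x. u x - v x - u x) = L2_norm_sq v"
    by (simp add: L2_norm_sq_def)
  finally show ?thesis by simp
qed

text \<open>
  Continuity of the \<open>L\<^sup>2\<close> norm, from the weighted inequality with a weight that tends to 0 more slowly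
  than the squared distance.
\<close>

lemma L2_norm_sq_tendsto:
  fixes u :: "nat \<Rightarrow> 'a::euclidean_space \<Rightarrow> 'b::euclidean_space"
  assumes [measurable]: "\<And>m. u m \<in> borel_measurable borel" "v \<in> borel_measurable borel"
    and v: "L2_norm_sq v < \<infinity>" and lim: "(\<lambda>m. L2_norm_sq (\<lambda>x. u m x - v x)) \<longlonglongrightarrow> 0"
  shows "(\<lambda>m. L2_norm_sq (u m)) \<longlonglongrightarrow> L2_norm_sq v"
proof -
  define D where "D m = enn2real (L2_norm_sq (\<lambda>x. u m x - v x))" for m
  define U where "U m = enn2real (L2_norm_sq (u m))" for m
  define V where "V = enn2real (L2_norm_sq v)"
  \<comment> \<open>the second summand keeps the weight positive when the distance vanishes\<close>
  define d where "d m = sqrt (D m) + inverse (real (Suc m))" for m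
  have V: "L2_norm_sq v = ennreal V" "V \<ge> 0" using v by (auto simp: V_def)
  have D0: "D m \<ge> 0" for m by (simp add: D_def)
  have d: "d m > 0" for m using D0[of m] by (simp add: d_def add_nonneg_pos)
  have Dlim: "D \<longlonglongrightarrow> 0"
    unfolding D_def using tendsto_enn2real[of "\<lambda>m. L2_norm_sq (\<lambda>x. u m x - v x)" 0] lim by simp
  have dlim: "d \<longlonglongrightarrow> 0"
  proof -
    have "d \<longlonglongrightarrow> sqrt 0 + 0"
      unfolding d_def by (intro tendsto_intros Dlim LIMSEQ_inverse_real_of_nat)
    then show ?thesis by simp
  qed
  have Dd: "(1 + 1 / d m) * D m \<le> D m + sqrt (D m)" for m
  proof -
    have "D m = sqrt (D m) * sqrt (D m)" using D0 by simp
    also have "\<dots> \<le> sqrt (D m) * d m"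
      by (rule mult_left_mono) (use D0 in \<open>auto simp: d_def\<close>)
    finally have "D m / d m \<le> sqrt (D m)" using d[of m] by (simp add: pos_divide_le_eq)
    then show ?thesis by (simp add: distrib_right)
  qed
  have fin: "eventually (\<lambda>m. L2_norm_sq (\<lambda>x. u m x - v x) < 1) sequentially"
    by (rule order_tendstoD[OF lim]) simp
  have ev: "eventually (\<lambda>m. L2_norm_sq (u m) = ennreal (U m) \<and>
      U m \<le> (1 + d m) * V + (D m + sqrt (D m)) \<and> V \<le> (1 + d m) * U m + (D m + sqrt (D m))) sequentially"
    using fin
  proof eventually_elim
    case (elim m)
    have D: "L2_norm_sq (\<lambda>x. u m x - v x) = ennreal (D m)"
      using less_trans[OF elim, of top] by (auto simp: D_def)
    note D' = D[unfolded L2_norm_sq_diff_commute[of "u m" v]]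
    have 1: "L2_norm_sq (u m) \<le> ennreal ((1 + d m) * V + (1 + 1 / d m) * D m)"
      using L2_norm_sq_le_weighted[of "u m" v, OF _ _ d[of m]] D V D0[of m] d[of m] by (simp add: ennreal_mult)
    then have U: "L2_norm_sq (u m) = ennreal (U m)"
      using le_less_trans[OF 1, of top] by (auto simp: U_def)
    have U0: "U m \<ge> 0" by (simp add: U_def)
    have "ennreal V \<le> ennreal ((1 + d m) * U m + (1 + 1 / d m) * D m)"
      using L2_norm_sq_le_weighted[of v "u m", OF _ _ d[of m]] D' V D0[of m] d[of m] U U0
      by (simp add: ennreal_mult)
    then have 2: "V \<le> (1 + d m) * U m + (1 + 1 / d m) * D m"
      using U0 D0[of m] d[of m] by (subst (asm) ennreal_le_iff) auto
    have "U m \<le> (1 + d m) * V + (1 + 1 / d m) * D m"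
      using 1 V D0[of m] d[of m] unfolding U by (subst (asm) ennreal_le_iff) auto
    with 2 U Dd[of m] show ?case by linarith
  qed
  have hi: "(\<lambda>m. (1 + d m) * V + (D m + sqrt (D m))) \<longlonglongrightarrow> (1 + 0) * V + (0 + sqrt 0)"
    by (intro tendsto_intros dlim Dlim)
  have lo: "(\<lambda>m. (V - (D m + sqrt (D m))) / (1 + d m)) \<longlonglongrightarrow> (V - (0 + sqrt 0)) / (1 + 0)"
    by (intro tendsto_intros dlim Dlim) simp
  have "U \<longlonglongrightarrow> V"
  proof (rule tendsto_sandwich[of "\<lambda>m. (V - (D m + sqrt (D m))) / (1 + d m)" U
        sequentially "\<lambda>m. (1 + d m) * V + (D m + sqrt (D m))"])
    show "eventually (\<lambda>m. (V - (D m + sqrt (D m))) / (1 + d m) \<le> U m) sequentially"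
      using ev
    proof eventually_elim
      case (elim m)
      then show ?case using d[of m] by (simp add: pos_divide_le_eq mult.commute)
    qed
    show "eventually (\<lambda>m. U m \<le> (1 + d m) * V + (D m + sqrt (D m))) sequentially"
      using ev by eventually_elim simp
  qed (use hi lo in simp_all)
  then have "(\<lambda>m. ennreal (U m)) \<longlonglongrightarrow> ennreal V" by (rule tendsto_ennrealI)
  then show ?thesis
    unfolding V
    by (rule Lim_transform_eventually) (use ev in eventually_elim, simp)
qed

lemma L2_norm_sq_shift:
  fixes f :: "'a::euclidean_space \<Rightarrow> 'b::euclidean_space"
  assumes [measurable]: "f \<in> borel_measurable borel"
  shows "L2_norm_sq (\<lambda>x. f (x + t)) = L2_norm_sq f"
  unfolding L2_norm_sq_def by (rule nn_integral_translate) measurable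

lemma L2_norm_sq_reflect:
  fixes f :: "'a::euclidean_space \<Rightarrow> 'b::euclidean_space"
  assumes [measurable]: "f \<in> borel_measurable borel"
  shows "L2_norm_sq (\<lambda>x. f (- x)) = L2_norm_sq f"
  unfolding L2_norm_sq_def
  by (subst (2) lborel_affine[of "-1" 0]) (auto simp: nn_integral_density nn_integral_distr)

text \<open>
  On a ball a square integrable function is integrable, since \<open>y \<le> 1 + y\<^sup>2\<close> and the ball has finite
  measure.
\<close>

lemma truncated_approximation:
  fixes f :: "'a::euclidean_space \<Rightarrow> 'b::euclidean_space"
  assumes [measurable]: "f \<in> borel_measurable borel" and f2: "L2_norm_sq f < \<infinity>" and e: "e > 0"
  shows "\<exists>\<psi>. integrable lborel \<psi> \<and> L2_norm_sq \<psi> < \<infinity> \<and> L2_norm_sq (\<lambda>x. \<psi> x - f x) < e"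
proof -
  define u where "u m x = indicator (ball 0 (real m)) x *\<^sub>R f x" for m :: nat and x :: 'a
  have [measurable]: "u m \<in> borel_measurable borel" for m
    unfolding u_def by (intro borel_measurable_scaleR borel_measurable_indicator) auto
  have i: "integrable lborel (\<lambda>x. (norm (f x))\<^sup>2)" using f2 by (subst (asm) L2_norm_sq_finite_iff) auto
  have "(\<lambda>m. \<integral>x. (norm (u m x - f x))\<^sup>2 \<partial>lborel) \<longlonglongrightarrow> (\<integral>x. 0 \<partial>(lborel :: 'a measure))"
  proof (rule integral_dominated_convergence[where w = "\<lambda>x. (norm (f x))\<^sup>2"])
    show "AE x in lborel. (\<lambda>m. (norm (u m x - f x))\<^sup>2) \<longlonglongrightarrow> 0"
    proof (rule AE_I2)
      fix x :: 'a
      obtain M where M: "norm x < real M" using reals_Archimedean2 by blast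
      have "eventually (\<lambda>m. (norm (u m x - f x))\<^sup>2 = 0) sequentially"
        using eventually_ge_at_top[of M] by eventually_elim (use M in \<open>auto simp: u_def\<close>)
      then show "(\<lambda>m. (norm (u m x - f x))\<^sup>2) \<longlonglongrightarrow> 0" by (rule tendsto_eventually)
    qed
  qed (use i in \<open>auto simp: u_def indicator_def\<close>)
  then have lim: "(\<lambda>m. ennreal (\<integral>x. (norm (u m x - f x))\<^sup>2 \<partial>lborel)) \<longlonglongrightarrow> ennreal 0"
    by (intro tendsto_ennrealI) simp
  have eq: "L2_norm_sq (\<lambda>x. u m x - f x) = ennreal (\<integral>x. (norm (u m x - f x))\<^sup>2 \<partial>lborel)" for m
  proof -
    have "integrable lborel (\<lambda>x. (norm (u m x - f x))\<^sup>2)"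
      by (rule Bochner_Integration.integrable_bound[OF i]) (auto simp: u_def indicator_def)
    then show ?thesis unfolding L2_norm_sq_def by (rule nn_integral_eq_integral) simp
  qed
  have "eventually (\<lambda>m. L2_norm_sq (\<lambda>x. u m x - f x) < e) sequentially"
    using order_tendstoD(2)[OF lim, of e] e unfolding eq by simp
  then obtain m where m: "L2_norm_sq (\<lambda>x. u m x - f x) < e" by (auto simp: eventually_sequentially)
  have "integrable lborel (u m)"
  proof (rule Bochner_Integration.integrable_bound)
    have "integrable lborel (\<lambda>x::'a. indicator (ball 0 (real m)) x :: real)"
      by (simp add: integrable_indicator_iff emeasure_bounded_finite[OF bounded_ball, simplified])
    then show "integrable lborel (\<lambda>x. indicator (ball 0 (real m)) x + (norm (f x))\<^sup>2)"
      using i by simp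
    have "y \<le> 1 + y\<^sup>2" for y :: real
    proof -
      have "2 * y \<le> y\<^sup>2 + 1" using sum_squares_bound[of y 1] by simp
      then show ?thesis using zero_le_power2[of y] by linarith
    qed
    then show "AE x in lborel. norm (u m x) \<le> norm (indicator (ball 0 (real m)) x + (norm (f x))\<^sup>2)"
      by (intro AE_I2) (auto simp: u_def indicator_def)
  qed simp
  moreover have "L2_norm_sq (u m) \<le> L2_norm_sq f"
    unfolding L2_norm_sq_def by (intro nn_integral_mono ennreal_leI) (auto simp: u_def indicator_def)
  ultimately show ?thesis using m f2 by (blast intro: le_less_trans)
qed

lemma convergent_of_geometric_increments:
  fixes G :: "nat \<Rightarrow> 'b::banach"
  assumes S: "(\<Sum>k. ennreal (4 ^ k * (norm (G (Suc k) - G k))\<^sup>2)) \<noteq> \<infinity>"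
  shows "convergent G"
proof -
  define s where "s = enn2real (\<Sum>k. ennreal (4 ^ k * (norm (G (Suc k) - G k))\<^sup>2))"
  have s: "(\<Sum>k. ennreal (4 ^ k * (norm (G (Suc k) - G k))\<^sup>2)) = ennreal s" "s \<ge> 0"
    using S by (auto simp: s_def less_top)
  define h where "h k = ennreal (4 ^ k * (norm (G (Suc k) - G k))\<^sup>2)" for k
  have h: "h k \<le> ennreal s" for k
  proof -
    have "sum h {k} \<le> suminf h" by (rule sum_le_suminf) auto
    then show ?thesis using s(1) by (simp add: h_def[abs_def])
  qed
  have b: "norm (G (Suc k) - G k) \<le> sqrt s * (1 / 2) ^ k" for k
  proof -
    let ?n = "norm (G (Suc k) - G k)"
    have le: "4 ^ k * ?n\<^sup>2 \<le> s" using h[of k] s(2) by (simp only: h_def ennreal_le_iff)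
    have "(2::real) ^ k * 2 ^ k = (2 * 2) ^ k" by (rule power_mult_distrib[symmetric])
    then have "(2 ^ k * ?n)\<^sup>2 = 4 ^ k * ?n\<^sup>2" by (simp add: power2_eq_square)
    then have "2 ^ k * ?n \<le> sqrt s" using le by (intro real_le_rsqrt) simp
    then show ?thesis by (simp add: power_divide pos_le_divide_eq mult.commute)
  qed
  have "summable (\<lambda>k. sqrt s * (1 / 2) ^ k)" by (intro summable_mult summable_geometric) simp
  then have "summable (\<lambda>k. G (Suc k) - G k)"
    by (rule summable_comparison_test') (rule b)
  then have "convergent (\<lambda>n. \<Sum>k<n. G (Suc k) - G k)" by (simp add: summable_iff_convergent)
  then have "convergent (\<lambda>n. G n - G 0)" by (simp add: sum_lessThan_telescope)
  then have "convergent (\<lambda>n. (G n - G 0) + G 0)" by (intro convergent_add convergent_const)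
  then show ?thesis by simp
qed

text \<open>
  Completeness of \<open>L\<^sup>2\<close> for rapidly converging Cauchy sequences. With squared distances of order \<open>8\<^sup>-\<^sup>k\<close>
  the series of \<open>4\<^sup>k\<close> times the squared increments has finite integral, so almost everywhere the
  increments are of order \<open>2\<^sup>-\<^sup>k\<close> and the sequence converges; the pointwise limit is the limit in \<open>L\<^sup>2\<close>
  by Fatou's lemma.
\<close>

lemma L2_complete_geometric:
  fixes G :: "nat \<Rightarrow> 'a::euclidean_space \<Rightarrow> 'b::euclidean_space"
  assumes [measurable]: "\<And>k. G k \<in> borel_measurable borel" and c: "c \<ge> 0"
    and G: "\<And>k j. k \<le> j \<Longrightarrow> L2_norm_sq (\<lambda>w. G k w - G j w) \<le> ennreal (c * (1 / 8) ^ k)"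
  shows "\<exists>g \<in> borel_measurable borel. (\<lambda>k. L2_norm_sq (\<lambda>w. G k w - g w)) \<longlonglongrightarrow> 0
     \<and> L2_norm_sq (\<lambda>w. G 0 w - g w) < \<infinity>"
proof -
  define g where "g w = lim (\<lambda>k. G k w)" for w
  have [measurable]: "g \<in> borel_measurable borel"
    unfolding g_def by (rule borel_measurable_lim_metric) measurable
  have "(\<integral>\<^sup>+w. (\<Sum>k. ennreal (4 ^ k * (norm (G (Suc k) w - G k w))\<^sup>2)) \<partial>lborel)
      = (\<Sum>k. \<integral>\<^sup>+w. ennreal (4 ^ k * (norm (G (Suc k) w - G k w))\<^sup>2) \<partial>lborel)"
    by (rule nn_integral_suminf) measurable
  also have "\<dots> \<le> (\<Sum>k. ennreal (c * (1 / 2) ^ k))"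
  proof (intro suminf_le summableI)
    fix k
    have "(\<integral>\<^sup>+w. ennreal (4 ^ k * (norm (G (Suc k) w - G k w))\<^sup>2) \<partial>lborel)
      = ennreal (4 ^ k) * L2_norm_sq (\<lambda>w. G k w - G (Suc k) w)"
      by (simp add: L2_norm_sq_def ennreal_mult nn_integral_cmult norm_minus_commute)
    also have "\<dots> \<le> ennreal (4 ^ k) * ennreal (c * (1 / 8) ^ k)"
      by (intro mult_left_mono G) auto
    also have "\<dots> = ennreal (4 ^ k * (c * (1 / 8) ^ k))"
      using c by (simp add: ennreal_mult)
    also have "4 ^ k * (c * (1 / 8) ^ k) = c * (1 / 2) ^ k"
    proof -
      have "(4 :: real) ^ k * (1 / 8) ^ k = (1 / 2) ^ k"
        unfolding power_mult_distrib[symmetric] by simp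
      then show ?thesis by (simp only: mult.left_commute)
    qed
    finally show "(\<integral>\<^sup>+w. ennreal (4 ^ k * (norm (G (Suc k) w - G k w))\<^sup>2) \<partial>lborel)
       \<le> ennreal (c * (1 / 2) ^ k)" .
  qed
  also have "\<dots> < \<infinity>"
    using c by (subst suminf_ennreal2) (auto intro!: summable_mult summable_geometric)
  finally have "AE w in lborel. (\<Sum>k. ennreal (4 ^ k * (norm (G (Suc k) w - G k w))\<^sup>2)) \<noteq> \<infinity>"
    by (intro nn_integral_noteq_infinite) auto
  then have conv: "AE w in lborel. (\<lambda>k. G k w) \<longlonglongrightarrow> g w"
    unfolding g_def
    by eventually_elim (rule convergent_LIMSEQ_iff[THEN iffD1, OF convergent_of_geometric_increments])
  have bound: "L2_norm_sq (\<lambda>w. G k w - g w) \<le> ennreal (c * (1 / 8) ^ k)" for k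
  proof -
    have "L2_norm_sq (\<lambda>w. G k w - g w) = (\<integral>\<^sup>+w. liminf (\<lambda>j. ennreal ((norm (G k w - G j w))\<^sup>2)) \<partial>lborel)"
      unfolding L2_norm_sq_def
    proof (rule nn_integral_cong_AE)
      show "AE w in lborel. ennreal ((norm (G k w - g w))\<^sup>2)
          = liminf (\<lambda>j. ennreal ((norm (G k w - G j w))\<^sup>2))"
        using conv
      proof eventually_elim
        case (elim w)
        have "(\<lambda>j. ennreal ((norm (G k w - G j w))\<^sup>2)) \<longlonglongrightarrow> ennreal ((norm (G k w - g w))\<^sup>2)"
          by (intro tendsto_intros elim)
        then show ?case by (intro lim_imp_Liminf[symmetric]) auto
      qed
    qed
    also have "\<dots> \<le> liminf (\<lambda>j. L2_norm_sq (\<lambda>w. G k w - G j w))"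
      unfolding L2_norm_sq_def by (rule nn_integral_liminf) measurable
    also have "\<dots> \<le> liminf (\<lambda>j. ennreal (c * (1 / 8) ^ k))"
      by (rule Liminf_mono) (use eventually_ge_at_top[of k] in eventually_elim, rule G)
    also have "\<dots> = ennreal (c * (1 / 8) ^ k)" by (simp add: Liminf_const)
    finally show ?thesis .
  qed
  have "(\<lambda>k. c * (1 / 8) ^ k) \<longlonglongrightarrow> c * 0"
    by (rule tendsto_mult_left[OF LIMSEQ_realpow_zero]) simp_all
  then have lim: "(\<lambda>k. ennreal (c * (1 / 8) ^ k)) \<longlonglongrightarrow> 0"
    using tendsto_ennrealI by fastforce
  have "(\<lambda>k. L2_norm_sq (\<lambda>w. G k w - g w)) \<longlonglongrightarrow> 0"
    by (rule tendsto_sandwich[OF _ _ tendsto_const lim]; intro always_eventually allI bound) simp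
  moreover have "L2_norm_sq (\<lambda>w. G 0 w - g w) < \<infinity>"
    using le_less_trans[OF bound[of 0]] by simp
  ultimately show ?thesis using \<open>g \<in> borel_measurable borel\<close> by blast
qed

section \<open>The energy identity for cosine and sine transforms\<close>

text \<open>
  Let the width of the damping Gaussian tend to infinity in the regularized identity: the left side
  increases to the full energy by monotone convergence, the right side converges by continuity of
  the autocorrelation at 0.
\<close>

lemma plancherel_cos_sin:
  fixes f :: "'a::euclidean_space \<Rightarrow> 'b::euclidean_space"
  assumes f: "integrable lborel f" and f2: "L2_norm_sq f < \<infinity>"
  shows "L2_norm_sq (cos_transform f) + L2_norm_sq (sin_transform f) = ennreal ((2 * pi) ^ DIM('a)) * L2_norm_sq f"
proof -
  have fm [measurable]: "f \<in> borel_measurable borel" using f by auto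
  have f2': "integrable lborel (\<lambda>x. (norm (f x))\<^sup>2)" using f2 L2_norm_sq_finite_iff[OF fm] by simp
  let ?F = "\<integral>x. (norm (f x))\<^sup>2 \<partial>lborel"
  define r where "r m = inverse (real (Suc m))" for m
  have r: "r m > 0" for m by (simp add: r_def)
  have r0: "r \<longlonglongrightarrow> 0" unfolding r_def by (rule LIMSEQ_inverse_real_of_nat)
  let ?h = "\<lambda>w. (norm (cos_transform f w))\<^sup>2 + (norm (sin_transform f w))\<^sup>2"
  let ?u = "\<lambda>m w. exp (- (norm (r m *\<^sub>R w))\<^sup>2 / 2) * ?h w"
  have "(\<lambda>m. \<integral>z. exp (- (norm z)\<^sup>2 / 2) * autocorrelation f (r m *\<^sub>R z) \<partial>lborel)
     \<longlonglongrightarrow> (\<integral>z. exp (- (norm (z::'a))\<^sup>2 / 2) * ?F \<partial>lborel)"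
  proof (rule integral_dominated_convergence[where w = "\<lambda>z. exp (- (norm z)\<^sup>2 / 2) * ?F"])
    have m [measurable]: "autocorrelation f \<in> borel_measurable borel"
      unfolding autocorrelation_def[abs_def]
      by (rule lborel.borel_measurable_lebesgue_integral) measurable
    show "(\<lambda>z. exp (- (norm z)\<^sup>2 / 2) * autocorrelation f (r i *\<^sub>R z)) \<in> borel_measurable lborel" for i
      by measurable
    show "integrable lborel (\<lambda>z::'a. exp (- (norm z)\<^sup>2 / 2) * ?F)"
      by (intro integrable_mult_left integrable_gaussian)
    show "AE z in lborel. (\<lambda>i. exp (- (norm z)\<^sup>2 / 2) * autocorrelation f (r i *\<^sub>R z))
       \<longlonglongrightarrow> exp (- (norm z)\<^sup>2 / 2) * ?F"
    proof (rule AE_I2)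
      fix z :: 'a
      have "(\<lambda>i. r i *\<^sub>R z) \<longlonglongrightarrow> 0 *\<^sub>R z" by (intro tendsto_intros r0)
      then show "(\<lambda>i. exp (- (norm z)\<^sup>2 / 2) * autocorrelation f (r i *\<^sub>R z))
       \<longlonglongrightarrow> exp (- (norm z)\<^sup>2 / 2) * ?F"
        by (intro tendsto_intros autocorrelation_tendsto[OF f f2']) simp
    qed
    show "AE z in lborel. norm (exp (- (norm z)\<^sup>2 / 2) * autocorrelation f (r i *\<^sub>R z))
       \<le> exp (- (norm z)\<^sup>2 / 2) * ?F" for i
      by (rule AE_I2) (simp add: abs_mult autocorrelation_bound[OF fm f2'])
  qed measurable
  then have "(\<lambda>m. sqrt (2 * pi) ^ DIM('a)
      * (\<integral>z. exp (- (norm z)\<^sup>2 / 2) * autocorrelation f (r m *\<^sub>R z) \<partial>lborel))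
     \<longlonglongrightarrow> sqrt (2 * pi) ^ DIM('a) * (\<integral>z. exp (- (norm (z::'a))\<^sup>2 / 2) * ?F \<partial>lborel)"
    by (intro tendsto_intros)
  also have "(\<integral>z. exp (- (norm (z::'a))\<^sup>2 / 2) * ?F \<partial>lborel) = sqrt (2 * pi) ^ DIM('a) * ?F"
    using gaussian_cos_sin(1)[of "0::'a"] by simp
  also have "sqrt (2 * pi) ^ DIM('a) * (sqrt (2 * pi) ^ DIM('a) * ?F) = (2 * pi) ^ DIM('a) * ?F"
  proof -
    have "sqrt (2 * pi) ^ DIM('a) * sqrt (2 * pi) ^ DIM('a) = (sqrt (2 * pi) * sqrt (2 * pi)) ^ DIM('a)"
      by (rule power_mult_distrib[symmetric])
    also have "sqrt (2 * pi) * sqrt (2 * pi) = 2 * pi" by simp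
    finally show ?thesis by (metis mult.assoc)
  qed
  finally have "(\<lambda>m. ennreal (\<integral>w. ?u m w \<partial>lborel)) \<longlonglongrightarrow> ennreal ((2 * pi) ^ DIM('a) * ?F)"
    unfolding regularized_energy(2)[OF f f2' r] by (rule tendsto_ennrealI)
  moreover have "ennreal (\<integral>w. ?u m w \<partial>lborel) = (\<integral>\<^sup>+w. ennreal (?u m w) \<partial>lborel)" for m
    by (rule nn_integral_eq_integral[symmetric, OF regularized_energy(1)[OF f f2' r]]) simp
  ultimately have "(\<lambda>m. \<integral>\<^sup>+w. ennreal (?u m w) \<partial>lborel) \<longlonglongrightarrow> ennreal ((2 * pi) ^ DIM('a) * ?F)"
    by (simp only:)
  moreover have "(\<lambda>m. \<integral>\<^sup>+w. ennreal (?u m w) \<partial>lborel) \<longlonglongrightarrow> (\<integral>\<^sup>+w. ennreal (?h w) \<partial>lborel)"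
  proof (rule nn_integral_LIMSEQ)
    show "incseq (\<lambda>m w. ennreal (?u m w))"
    proof (intro incseq_SucI le_funI ennreal_leI mult_right_mono)
      fix m and w :: 'a
      have "r (Suc m) \<le> r m" by (simp add: r_def field_simps)
      then have "norm (r (Suc m) *\<^sub>R w) \<le> norm (r m *\<^sub>R w)"
        using r[of m] r[of "Suc m"] by (auto intro!: mult_right_mono)
      then show "exp (- (norm (r m *\<^sub>R w))\<^sup>2 / 2) \<le> exp (- (norm (r (Suc m) *\<^sub>R w))\<^sup>2 / 2)"
        by (simp add: power_mono)
    qed simp
    show "(\<lambda>m. ennreal (?u m w)) \<longlonglongrightarrow> ennreal (?h w)" for w
    proof -
      have "(\<lambda>m. ?u m w) \<longlonglongrightarrow> exp (- (norm (0 *\<^sub>R w))\<^sup>2 / 2) * ?h w"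
        by (intro tendsto_intros r0) simp
      then show ?thesis by (intro tendsto_ennrealI) simp
    qed
  qed measurable
  ultimately have "(\<integral>\<^sup>+w. ennreal (?h w) \<partial>lborel) = ennreal ((2 * pi) ^ DIM('a) * ?F)"
    using LIMSEQ_unique by blast
  then show ?thesis
    unfolding L2_norm_sq_eq_integral[OF fm f2]
    by (simp add: L2_norm_sq_def nn_integral_add ennreal_mult)
qed

section \<open>The Fourier transform for a complex structure\<close>

text \<open>
  The axioms say that \<open>J\<close> is multiplication by the imaginary unit for a Hermitian structure on the real
  Euclidean space.
\<close>

locale complex_structure =
  fixes J :: "'b::euclidean_space \<Rightarrow> 'b"
  assumes linear_J: "linear J" and norm_J: "norm (J v) = norm v" and J_J: "J (J v) = - v"
begin

lemma inner_J: "v \<bullet> J v = 0"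
proof -
  have "J (v + J v) = J v - v" using linear_J by (simp add: linear_add J_J)
  then have "norm (v + J v) = norm (J v - v)" using norm_J[of "v + J v"] by simp
  then have "(v + J v) \<bullet> (v + J v) = (J v - v) \<bullet> (J v - v)" by (simp add: norm_eq)
  then show ?thesis by (simp add: inner_commute algebra_simps)
qed

lemma bounded_linear_J: "bounded_linear J"
  using linear_J by (simp add: linear_linear)

lemma measurable_J [measurable]: "J \<in> borel_measurable borel"
  using bounded_linear_J by (intro borel_measurable_continuous_onI linear_continuous_on)

text \<open>
  Multiplication by \<open>exp (J \<theta>)\<close>.
\<close>

definition rot :: "real \<Rightarrow> 'b \<Rightarrow> 'b" where
  "rot \<theta> v = cos \<theta> *\<^sub>R v + sin \<theta> *\<^sub>R J v"

lemma rot_diff: "rot \<theta> (v - w) = rot \<theta> v - rot \<theta> w"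
  using linear_J by (simp add: rot_def linear_diff algebra_simps)

lemma norm_rot [simp]: "norm (rot \<theta> v) = norm v"
proof -
  have "J v \<bullet> J v = v \<bullet> v" using norm_J[of v] by (simp add: norm_eq)
  moreover have "rot \<theta> v \<bullet> rot \<theta> v = (cos \<theta>)\<^sup>2 * (v \<bullet> v) + (sin \<theta>)\<^sup>2 * (J v \<bullet> J v)"
    by (simp add: rot_def inner_J inner_commute[of "J v" v] algebra_simps power2_eq_square)
  ultimately have "rot \<theta> v \<bullet> rot \<theta> v = ((cos \<theta>)\<^sup>2 + (sin \<theta>)\<^sup>2) * (v \<bullet> v)"
    by (simp only: distrib_right)
  then show ?thesis by (simp add: norm_eq)
qed

lemma norm_rot_diff_le: "(norm (rot \<theta> v - v))\<^sup>2 \<le> \<theta>\<^sup>2 * (norm v)\<^sup>2"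
proof -
  have "J v \<bullet> J v = v \<bullet> v" using norm_J[of v] by (simp add: norm_eq)
  moreover have "rot \<theta> v - v = (cos \<theta> - 1) *\<^sub>R v + sin \<theta> *\<^sub>R J v"
    by (simp add: rot_def algebra_simps)
  moreover have "(norm (a *\<^sub>R v + b *\<^sub>R J v))\<^sup>2 = a\<^sup>2 * (v \<bullet> v) + b\<^sup>2 * (J v \<bullet> J v)" for a b
    unfolding power2_norm_eq_inner
    by (simp add: inner_J inner_commute[of "J v" v] algebra_simps power2_eq_square)
  ultimately have "(norm (rot \<theta> v - v))\<^sup>2 = ((cos \<theta> - 1)\<^sup>2 + (sin \<theta>)\<^sup>2) * (norm v)\<^sup>2"
    by (simp only: power2_norm_eq_inner[of v] distrib_right)
  moreover have "(cos \<theta> - 1)\<^sup>2 + (sin \<theta>)\<^sup>2 = (2 * sin (\<theta> / 2))\<^sup>2"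
    using cos_double_sin[of "\<theta> / 2"] sin_cos_squared_add[of \<theta>]
    by (simp add: power2_diff power_mult_distrib)
  moreover have "(2 * sin (\<theta> / 2))\<^sup>2 \<le> \<theta>\<^sup>2"
    using abs_sin_x_le_abs_x[of "\<theta> / 2"] by (intro abs_le_square_iff[THEN iffD1]) (auto simp: abs_mult)
  ultimately show ?thesis by (simp add: mult_right_mono)
qed

definition FT :: "('a::euclidean_space \<Rightarrow> 'b) \<Rightarrow> 'a \<Rightarrow> 'b" where
  "FT f w = (\<integral>x. rot (- (x \<bullet> w)) (f x) \<partial>lborel)"

lemma FT_eq:
  assumes "integrable lborel f"
  shows "FT f w = cos_transform f w - J (sin_transform f w)"
proof -
  have "J (sin_transform f w) = (\<integral>x. J (sin (x \<bullet> w) *\<^sub>R f x) \<partial>lborel)"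
    unfolding sin_transform_def
    by (rule integral_bounded_linear[OF bounded_linear_J integrable_cos_sin(2)[OF assms], symmetric])
  moreover have "integrable lborel (\<lambda>x. J (sin (x \<bullet> w) *\<^sub>R f x))"
    by (rule integrable_bounded_linear[OF bounded_linear_J integrable_cos_sin(2)[OF assms]])
  moreover have "rot (- (x \<bullet> w)) (f x) = cos (x \<bullet> w) *\<^sub>R f x - J (sin (x \<bullet> w) *\<^sub>R f x)" for x
    using linear_J by (simp add: rot_def linear_scale)
  ultimately show ?thesis
    using integrable_cos_sin(1)[OF assms] by (simp add: FT_def cos_transform_def)
qed

lemma integrable_rot:
  assumes f: "integrable lborel f"
  shows "integrable lborel (\<lambda>x. rot (- (x \<bullet> w)) (f x))"
proof (rule Bochner_Integration.integrable_bound[OF f])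
  have [measurable]: "f \<in> borel_measurable borel" using f by auto
  show "(\<lambda>x. rot (- (x \<bullet> w)) (f x)) \<in> borel_measurable lborel"
    unfolding rot_def by measurable
qed simp

lemma FT_measurable:
  assumes "integrable lborel f"
  shows "FT f \<in> borel_measurable borel"
proof -
  have [measurable]: "f \<in> borel_measurable borel" using assms by auto
  have "FT f = (\<lambda>w. cos_transform f w - J (sin_transform f w))"
    using FT_eq[OF assms] by blast
  then show ?thesis by simp
qed

lemma FT_diff:
  assumes "integrable lborel f" "integrable lborel g"
  shows "FT (\<lambda>x. f x - g x) w = FT f w - FT g w"
  using integrable_rot[OF assms(1)] integrable_rot[OF assms(2)] by (simp add: FT_def rot_diff)

lemma rot_rot: "rot \<alpha> (rot \<beta> v) = rot (\<alpha> + \<beta>) v"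
proof -
  have "J (rot \<beta> v) = cos \<beta> *\<^sub>R J v - sin \<beta> *\<^sub>R v"
    using linear_J by (simp add: rot_def linear_add linear_scale J_J)
  then have "rot \<alpha> (rot \<beta> v) = cos \<alpha> *\<^sub>R rot \<beta> v + sin \<alpha> *\<^sub>R (cos \<beta> *\<^sub>R J v - sin \<beta> *\<^sub>R v)"
    by (simp only: rot_def[of \<alpha>])
  then show ?thesis by (simp add: rot_def cos_add sin_add algebra_simps)
qed

lemma bounded_linear_rot: "bounded_linear (rot \<theta>)"
  unfolding rot_def using bounded_linear_J
  by (intro bounded_linear_add bounded_linear_const_scaleR bounded_linear_ident)

lemma FT_shift:
  assumes f: "integrable lborel f"
  shows "FT (\<lambda>x. f (x + t)) w = rot (t \<bullet> w) (FT f w)"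
proof -
  have [measurable]: "f \<in> borel_measurable borel" using f by auto
  have [measurable]: "(\<lambda>x. rot (- (x \<bullet> w)) (f x)) \<in> borel_measurable borel"
    using integrable_rot[OF f, of w] by auto
  have "FT (\<lambda>x. f (x + t)) w = (\<integral>x. rot (t \<bullet> w) (rot (- ((x + t) \<bullet> w)) (f (x + t))) \<partial>lborel)"
    unfolding FT_def rot_rot
    by (intro Bochner_Integration.integral_cong) (auto simp: inner_add_left)
  also have "\<dots> = (\<integral>x. rot (t \<bullet> w) (rot (- (x \<bullet> w)) (f x)) \<partial>lborel)"
    using integral_shift[of "\<lambda>x. rot (t \<bullet> w) (rot (- (x \<bullet> w)) (f x))" t]
      measurable_compose[of "\<lambda>x. rot (- (x \<bullet> w)) (f x)" borel borel "rot (t \<bullet> w)" borel]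
      bounded_linear_rot[of "t \<bullet> w"]
    by (simp add: borel_measurable_continuous_onI linear_continuous_on)
  also have "\<dots> = rot (t \<bullet> w) (FT f w)"
    unfolding FT_def by (rule integral_bounded_linear[OF bounded_linear_rot integrable_rot[OF f]])
  finally show ?thesis .
qed

text \<open>
  The transform is \<open>C - J S\<close> with the cosine transform \<open>C\<close> even and the sine transform \<open>S\<close> odd. Adding
  the squared norms at \<open>w\<close> and \<open>-w\<close> therefore removes the mixed term, and reflection does not change
  the integral.
\<close>

theorem plancherel:
  fixes f :: "'a::euclidean_space \<Rightarrow> 'b"
  assumes f: "integrable lborel f" and f2: "L2_norm_sq f < \<infinity>"
  shows "L2_norm_sq (FT f) = ennreal ((2 * pi) ^ DIM('a)) * L2_norm_sq f"
proof -
  note [measurable] = FT_measurable[OF f]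
  have [measurable]: "f \<in> borel_measurable borel" using f by auto
  have odd: "cos_transform f (- w) = cos_transform f w" "sin_transform f (- w) = - sin_transform f w" for w
    by (simp_all add: cos_transform_def sin_transform_def)
  have pt: "(norm (FT f w))\<^sup>2 + (norm (FT f (- w)))\<^sup>2
      = 2 * (norm (cos_transform f w))\<^sup>2 + 2 * (norm (sin_transform f w))\<^sup>2" for w
  proof -
    have "J (- v) = - J v" for v using linear_J by (rule linear_neg)
    then show ?thesis
      using norm_J[of "sin_transform f w"]
      by (simp add: FT_eq[OF f] odd power2_norm_eq_inner norm_eq algebra_simps inner_commute)
  qed
  have "2 * L2_norm_sq (FT f) = L2_norm_sq (FT f) + L2_norm_sq (\<lambda>w. FT f (- w))"
    by (simp add: L2_norm_sq_reflect mult_2)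
  also have "\<dots> = (\<integral>\<^sup>+w. ennreal ((norm (FT f w))\<^sup>2 + (norm (FT f (- w)))\<^sup>2) \<partial>lborel)"
    by (simp add: L2_norm_sq_def nn_integral_add)
  also have "\<dots> = 2 * L2_norm_sq (cos_transform f) + 2 * L2_norm_sq (sin_transform f)"
    unfolding pt by (simp add: L2_norm_sq_def nn_integral_add nn_integral_cmult ennreal_mult)
  also have "\<dots> = 2 * (ennreal ((2 * pi) ^ DIM('a)) * L2_norm_sq f)"
    unfolding plancherel_cos_sin[OF f f2, symmetric] by (simp add: distrib_left)
  finally show ?thesis by (simp add: ennreal_mult_cancel_left)
qed

text \<open>
  The graph of the \<open>L\<^sup>2\<close> extension, in the class of Borel functions: the closure in \<open>L\<^sup>2 \<times> L\<^sup>2\<close> of the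
  graph of the transform on \<open>L\<^sup>1 \<inter> L\<^sup>2\<close>.
\<close>

definition is_FT :: "('a::euclidean_space \<Rightarrow> 'b) \<Rightarrow> ('a \<Rightarrow> 'b) \<Rightarrow> bool" where
  "is_FT f g \<longleftrightarrow> f \<in> borel_measurable borel \<and> g \<in> borel_measurable borel
     \<and> L2_norm_sq f < \<infinity> \<and> L2_norm_sq g < \<infinity>
     \<and> (\<exists>\<phi> :: nat \<Rightarrow> 'a \<Rightarrow> 'b. (\<forall>m. integrable lborel (\<phi> m) \<and> L2_norm_sq (\<phi> m) < \<infinity>)
         \<and> (\<lambda>m. L2_norm_sq (\<lambda>x. \<phi> m x - f x)) \<longlonglongrightarrow> 0
         \<and> (\<lambda>m. L2_norm_sq (\<lambda>w. FT (\<phi> m) w - g w)) \<longlonglongrightarrow> 0)"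

lemma is_FT_plancherel:
  fixes f :: "'a::euclidean_space \<Rightarrow> 'b"
  assumes "is_FT f g"
  shows "L2_norm_sq g = ennreal ((2 * pi) ^ DIM('a)) * L2_norm_sq f"
proof -
  obtain \<phi> :: "nat \<Rightarrow> 'a \<Rightarrow> 'b" where [measurable]: "f \<in> borel_measurable borel" "g \<in> borel_measurable borel"
    and fin: "L2_norm_sq f < \<infinity>" "L2_norm_sq g < \<infinity>" and \<phi>: "\<And>m. integrable lborel (\<phi> m)" "\<And>m. L2_norm_sq (\<phi> m) < \<infinity>"
    and lim: "(\<lambda>m. L2_norm_sq (\<lambda>x. \<phi> m x - f x)) \<longlonglongrightarrow> 0"
      "(\<lambda>m. L2_norm_sq (\<lambda>w. FT (\<phi> m) w - g w)) \<longlonglongrightarrow> 0"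
    using assms unfolding is_FT_def by blast
  note [measurable] = FT_measurable[OF \<phi>(1)]
  have [measurable]: "\<phi> m \<in> borel_measurable borel" for m using \<phi>(1)[of m] by auto
  have "(\<lambda>m. L2_norm_sq (\<phi> m)) \<longlonglongrightarrow> L2_norm_sq f" by (rule L2_norm_sq_tendsto[OF _ _ fin(1) lim(1)]) auto
  then have "(\<lambda>m. ennreal ((2 * pi) ^ DIM('a)) * L2_norm_sq (\<phi> m))
      \<longlonglongrightarrow> ennreal ((2 * pi) ^ DIM('a)) * L2_norm_sq f"
    by (intro ennreal_tendsto_cmult) auto
  moreover have "(\<lambda>m. L2_norm_sq (FT (\<phi> m))) \<longlonglongrightarrow> L2_norm_sq g" by (rule L2_norm_sq_tendsto[OF _ _ fin(2) lim(2)]) auto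
  ultimately show ?thesis
    unfolding plancherel[OF \<phi>] using LIMSEQ_unique by blast
qed

lemma is_FT_integrable:
  assumes "integrable lborel f" "L2_norm_sq f < \<infinity>"
  shows "is_FT f (FT f)"
  unfolding is_FT_def
proof (intro conjI exI allI)
  show "L2_norm_sq (FT f) < \<infinity>"
    using plancherel[OF assms] assms(2) by (simp add: ennreal_mult_less_top)
  show "(\<lambda>m. L2_norm_sq (\<lambda>x. f x - f x)) \<longlonglongrightarrow> 0" "(\<lambda>m. L2_norm_sq (\<lambda>w. FT f w - FT f w)) \<longlonglongrightarrow> 0"
    by (simp_all add: L2_norm_sq_def)
qed (use assms FT_measurable in auto)

lemma L2_norm_sq_diff_tendsto:
  fixes u v :: "nat \<Rightarrow> 'a::euclidean_space \<Rightarrow> 'b"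
  assumes [measurable]: "\<And>m. u m \<in> borel_measurable borel" "\<And>m. v m \<in> borel_measurable borel"
    and lim: "(\<lambda>m. L2_norm_sq (u m)) \<longlonglongrightarrow> 0" "(\<lambda>m. L2_norm_sq (v m)) \<longlonglongrightarrow> 0"
  shows "(\<lambda>m. L2_norm_sq (\<lambda>x. u m x - v m x)) \<longlonglongrightarrow> 0"
proof -
  have "(\<lambda>m. 2 * L2_norm_sq (u m) + 2 * L2_norm_sq (v m)) \<longlonglongrightarrow> 2 * 0 + 2 * 0"
    by (intro tendsto_add ennreal_tendsto_cmult lim) auto
  then have lim': "(\<lambda>m. 2 * L2_norm_sq (u m) + 2 * L2_norm_sq (v m)) \<longlonglongrightarrow> 0" by simp
  show ?thesis
    by (rule tendsto_sandwich[OF _ _ tendsto_const lim'])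
       (auto intro!: always_eventually L2_norm_sq_diff_le)
qed

lemma is_FT_diff:
  fixes f f' :: "'a::euclidean_space \<Rightarrow> 'b"
  assumes "is_FT f g" "is_FT f' g'"
  shows "is_FT (\<lambda>x. f x - f' x) (\<lambda>w. g w - g' w)"
proof -
  obtain \<phi> :: "nat \<Rightarrow> 'a \<Rightarrow> 'b" where [measurable]: "f \<in> borel_measurable borel" "g \<in> borel_measurable borel"
    and fin: "L2_norm_sq f < \<infinity>" "L2_norm_sq g < \<infinity>" and \<phi>: "\<And>m. integrable lborel (\<phi> m)" "\<And>m. L2_norm_sq (\<phi> m) < \<infinity>"
    and lim: "(\<lambda>m. L2_norm_sq (\<lambda>x. \<phi> m x - f x)) \<longlonglongrightarrow> 0"
      "(\<lambda>m. L2_norm_sq (\<lambda>w. FT (\<phi> m) w - g w)) \<longlonglongrightarrow> 0"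
    using assms(1) unfolding is_FT_def by blast
  obtain \<phi>' :: "nat \<Rightarrow> 'a \<Rightarrow> 'b" where [measurable]: "f' \<in> borel_measurable borel" "g' \<in> borel_measurable borel"
    and fin': "L2_norm_sq f' < \<infinity>" "L2_norm_sq g' < \<infinity>" and \<phi>': "\<And>m. integrable lborel (\<phi>' m)" "\<And>m. L2_norm_sq (\<phi>' m) < \<infinity>"
    and lim': "(\<lambda>m. L2_norm_sq (\<lambda>x. \<phi>' m x - f' x)) \<longlonglongrightarrow> 0"
      "(\<lambda>m. L2_norm_sq (\<lambda>w. FT (\<phi>' m) w - g' w)) \<longlonglongrightarrow> 0"
    using assms(2) unfolding is_FT_def by blast
  note [measurable] = FT_measurable[OF \<phi>(1)] FT_measurable[OF \<phi>'(1)]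
  have [measurable]: "\<phi> m \<in> borel_measurable borel" "\<phi>' m \<in> borel_measurable borel" for m
    using \<phi>(1)[of m] \<phi>'(1)[of m] by auto
  have finite_diff: "L2_norm_sq (\<lambda>x. u x - v x) < top" if "u \<in> borel_measurable borel" "v \<in> borel_measurable borel"
    "L2_norm_sq u < top" "L2_norm_sq v < top" for u v :: "'a \<Rightarrow> 'b"
    using le_less_trans[OF L2_norm_sq_diff_le[OF that(1,2)]] that(3,4) by (simp add: ennreal_mult_less_top)
  show ?thesis
    unfolding is_FT_def
  proof (intro conjI exI[of _ "\<lambda>m x. \<phi> m x - \<phi>' m x"] allI)
    have "(\<lambda>x. \<phi> m x - \<phi>' m x - (f x - f' x)) = (\<lambda>x. (\<phi> m x - f x) - (\<phi>' m x - f' x))" for m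
      by auto
    then show "(\<lambda>m. L2_norm_sq (\<lambda>x. \<phi> m x - \<phi>' m x - (f x - f' x))) \<longlonglongrightarrow> 0"
      using L2_norm_sq_diff_tendsto[OF _ _ lim(1) lim'(1)] by simp
    have "(\<lambda>w. FT (\<lambda>x. \<phi> m x - \<phi>' m x) w - (g w - g' w))
        = (\<lambda>w. (FT (\<phi> m) w - g w) - (FT (\<phi>' m) w - g' w))" for m
      by (auto simp: FT_diff \<phi> \<phi>')
    then show "(\<lambda>m. L2_norm_sq (\<lambda>w. FT (\<lambda>x. \<phi> m x - \<phi>' m x) w - (g w - g' w))) \<longlonglongrightarrow> 0"
      using L2_norm_sq_diff_tendsto[OF _ _ lim(2) lim'(2)] by simp
  qed (use fin fin' \<phi> \<phi>' in \<open>auto intro!: finite_diff\<close>)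
qed

lemma rot_measurable [measurable]:
  assumes [measurable]: "\<theta> \<in> borel_measurable M" "g \<in> borel_measurable M"
  shows "(\<lambda>w. rot (\<theta> w) (g w)) \<in> borel_measurable M"
  unfolding rot_def by measurable

lemma is_FT_shift:
  fixes f :: "'a::euclidean_space \<Rightarrow> 'b"
  assumes "is_FT f g"
  shows "is_FT (\<lambda>x. f (x + t)) (\<lambda>w. rot (t \<bullet> w) (g w))"
proof -
  obtain \<phi> :: "nat \<Rightarrow> 'a \<Rightarrow> 'b" where [measurable]: "f \<in> borel_measurable borel" "g \<in> borel_measurable borel"
    and fin: "L2_norm_sq f < \<infinity>" "L2_norm_sq g < \<infinity>" and \<phi>: "\<And>m. integrable lborel (\<phi> m)" "\<And>m. L2_norm_sq (\<phi> m) < \<infinity>"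
    and lim: "(\<lambda>m. L2_norm_sq (\<lambda>x. \<phi> m x - f x)) \<longlonglongrightarrow> 0"
      "(\<lambda>m. L2_norm_sq (\<lambda>w. FT (\<phi> m) w - g w)) \<longlonglongrightarrow> 0"
    using assms(1) unfolding is_FT_def by blast
  have [measurable]: "\<phi> m \<in> borel_measurable borel" for m using \<phi>(1)[of m] by auto
  have rot: "L2_norm_sq (\<lambda>w. rot (t \<bullet> w) (h w)) = L2_norm_sq h" for h :: "'a \<Rightarrow> 'b"
    by (simp add: L2_norm_sq_def)
  show ?thesis
    unfolding is_FT_def
  proof (intro conjI exI[of _ "\<lambda>m x. \<phi> m (x + t)"] allI)
    show "(\<lambda>m. L2_norm_sq (\<lambda>x. \<phi> m (x + t) - f (x + t))) \<longlonglongrightarrow> 0"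
      using lim(1) L2_norm_sq_shift[of "\<lambda>x. \<phi> _ x - f x" t] by simp
    show "(\<lambda>m. L2_norm_sq (\<lambda>w. FT (\<lambda>x. \<phi> m (x + t)) w - rot (t \<bullet> w) (g w))) \<longlonglongrightarrow> 0"
      using lim(2) by (simp add: FT_shift[OF \<phi>(1)] rot_diff[symmetric] rot)
  qed (use fin \<phi> in \<open>auto simp: L2_norm_sq_shift rot intro!: integrable_shift\<close>)
qed

lemma L2_norm_sq_eq_0_iff:
  fixes f :: "'a::euclidean_space \<Rightarrow> 'b"
  assumes [measurable]: "f \<in> borel_measurable borel"
  shows "L2_norm_sq f = 0 \<longleftrightarrow> (AE x in lborel. f x = 0)"
  unfolding L2_norm_sq_def by (subst nn_integral_0_iff_AE) auto

text \<open>
  By linearity the difference is a transform of 0, which the Plancherel identity forces to vanish.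
\<close>

lemma is_FT_unique:
  assumes "is_FT f g" "is_FT f g'"
  shows "AE w in lborel. g w = g' w"
proof -
  have [measurable]: "g \<in> borel_measurable borel" "g' \<in> borel_measurable borel"
    using assms by (auto simp: is_FT_def)
  have "L2_norm_sq (\<lambda>w. g w - g' w) = 0"
    using is_FT_plancherel[OF is_FT_diff[OF assms]] by (simp add: L2_norm_sq_def)
  then show ?thesis by (subst (asm) L2_norm_sq_eq_0_iff) auto
qed

text \<open>
  Truncations of \<open>f\<close> with squared errors at most \<open>8\<^sup>-\<^sup>k\<close> have transforms that converge as fast, up to the
  Plancherel constant.
\<close>

theorem is_FT_exists:
  fixes f :: "'a::euclidean_space \<Rightarrow> 'b"
  assumes [measurable]: "f \<in> borel_measurable borel" and f2: "L2_norm_sq f < \<infinity>"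
  shows "\<exists>g. is_FT f g"
proof -
  let ?K = "(2 * pi) ^ DIM('a)"
  have "\<exists>\<psi>. integrable lborel \<psi> \<and> L2_norm_sq \<psi> < \<infinity> \<and> L2_norm_sq (\<lambda>x. \<psi> x - f x) < ennreal ((1 / 8) ^ k)" for k
    by (rule truncated_approximation[OF assms], subst ennreal_0[symmetric], rule ennreal_lessI) auto
  then obtain \<psi> where \<psi>: "\<And>k. integrable lborel (\<psi> k)" "\<And>k. L2_norm_sq (\<psi> k) < \<infinity>"
    and close: "\<And>k. L2_norm_sq (\<lambda>x. \<psi> k x - f x) < ennreal ((1 / 8) ^ k)"
    by metis
  have [measurable]: "\<psi> k \<in> borel_measurable borel" for k using \<psi>(1)[of k] by auto
  note [measurable] = FT_measurable[OF \<psi>(1)]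
  have G: "L2_norm_sq (\<lambda>w. FT (\<psi> k) w - FT (\<psi> j) w) \<le> ennreal (4 * ?K * (1 / 8) ^ k)" if "k \<le> j" for k j
  proof -
    have "(\<lambda>x. \<psi> k x - \<psi> j x) = (\<lambda>x. (\<psi> k x - f x) - (\<psi> j x - f x))" by auto
    then have "L2_norm_sq (\<lambda>x. \<psi> k x - \<psi> j x) \<le> 2 * L2_norm_sq (\<lambda>x. \<psi> k x - f x) + 2 * L2_norm_sq (\<lambda>x. \<psi> j x - f x)"
      using L2_norm_sq_diff_le[of "\<lambda>x. \<psi> k x - f x" "\<lambda>x. \<psi> j x - f x"] by simp
    also have "\<dots> \<le> 2 * ennreal ((1 / 8) ^ k) + 2 * ennreal ((1 / 8) ^ k)"
    proof (intro add_mono mult_left_mono)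
      show "L2_norm_sq (\<lambda>x. \<psi> k x - f x) \<le> ennreal ((1 / 8) ^ k)" using close[of k] by simp
      have "(1 / 8 :: real) ^ j \<le> (1 / 8) ^ k" using that by (intro power_decreasing) auto
      then show "L2_norm_sq (\<lambda>x. \<psi> j x - f x) \<le> ennreal ((1 / 8) ^ k)"
        using close[of j] by (meson ennreal_leI less_imp_le order_trans)
    qed auto
    also have "\<dots> = ennreal (4 * (1 / 8) ^ k)"
      by (simp add: ennreal_mult distrib_right[symmetric])
    finally have le: "L2_norm_sq (\<lambda>x. \<psi> k x - \<psi> j x) \<le> ennreal (4 * (1 / 8) ^ k)" .
    have "L2_norm_sq (\<lambda>w. FT (\<psi> k) w - FT (\<psi> j) w) = L2_norm_sq (FT (\<lambda>x. \<psi> k x - \<psi> j x))"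
      by (simp add: L2_norm_sq_def FT_diff \<psi>)
    also have "\<dots> = ennreal ?K * L2_norm_sq (\<lambda>x. \<psi> k x - \<psi> j x)"
      by (rule plancherel) (use \<psi> le le_less_trans[OF le] in auto)
    also have "\<dots> \<le> ennreal ?K * ennreal (4 * (1 / 8) ^ k)" by (rule mult_left_mono[OF le]) simp
    also have "\<dots> = ennreal (?K * (4 * (1 / 8) ^ k))" by (rule ennreal_mult[symmetric]) auto
    also have "?K * (4 * (1 / 8) ^ k) = 4 * ?K * (1 / 8) ^ k" by (simp only: mult_ac)
    finally show ?thesis .
  qed
  obtain g where [measurable]: "g \<in> borel_measurable borel"
    and g: "(\<lambda>k. L2_norm_sq (\<lambda>w. FT (\<psi> k) w - g w)) \<longlonglongrightarrow> 0" "L2_norm_sq (\<lambda>w. FT (\<psi> 0) w - g w) < \<infinity>"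
    using L2_complete_geometric[of "\<lambda>k. FT (\<psi> k)" "4 * ?K", OF _ _ G] by auto
  have "(\<lambda>k. ennreal ((1 / 8) ^ k)) \<longlonglongrightarrow> ennreal 0"
    by (intro tendsto_ennrealI LIMSEQ_realpow_zero) auto
  then have lim0: "(\<lambda>k. ennreal ((1 / 8) ^ k)) \<longlonglongrightarrow> 0" by simp
  have lim: "(\<lambda>k. L2_norm_sq (\<lambda>x. \<psi> k x - f x)) \<longlonglongrightarrow> 0"
    by (rule tendsto_sandwich[OF _ _ tendsto_const lim0];
        intro always_eventually allI less_imp_le[OF close]) simp
  have "L2_norm_sq (\<lambda>w. FT (\<psi> 0) w - (FT (\<psi> 0) w - g w))
      \<le> 2 * L2_norm_sq (FT (\<psi> 0)) + 2 * L2_norm_sq (\<lambda>w. FT (\<psi> 0) w - g w)"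
    by (rule L2_norm_sq_diff_le) measurable
  also have "\<dots> < \<infinity>"
    using g(2) \<psi>(2)[of 0] by (simp add: plancherel[OF \<psi>] ennreal_mult_less_top)
  finally have "L2_norm_sq g < \<infinity>" by simp
  then have "is_FT f g"
    unfolding is_FT_def using \<psi> lim g(1) f2 by (auto intro!: exI[of _ \<psi>])
  then show "\<exists>g. is_FT f g" by (rule exI[of "is_FT f" g])
qed

end

section \<open>The uncertainty inequality\<close>

definition second_moment :: "'a::euclidean_space \<Rightarrow> ('a \<Rightarrow> 'b::euclidean_space) \<Rightarrow> ennreal" where
  "second_moment b f = (\<integral>\<^sup>+x. ennreal ((b \<bullet> x)\<^sup>2 * (norm (f x))\<^sup>2) \<partial>lborel)"

text \<open>
  The weight \<open>(b \<bullet> x)\<^sup>2\<close> vanishes only on a hyperplane, which is a null set.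
\<close>

lemma L2_norm_sq_eq_0_of_moment:
  fixes f :: "'a::euclidean_space \<Rightarrow> 'b::euclidean_space"
  assumes [measurable]: "f \<in> borel_measurable borel" and b: "b \<noteq> 0" and 0: "second_moment b f = 0"
  shows "L2_norm_sq f = 0"
proof -
  have "{x. b \<bullet> x = 0} \<in> null_sets lebesgue"
    using negligible_hyperplane[of b 0] b by (simp add: negligible_iff_null_sets)
  then have "AE x in lebesgue. x \<notin> {x. b \<bullet> x = 0}" by (rule AE_not_in)
  then have 1: "AE x in lborel. b \<bullet> x \<noteq> 0" by (simp add: AE_completion_iff)
  have "AE x in lborel. ennreal ((b \<bullet> x)\<^sup>2 * (norm (f x))\<^sup>2) = 0"
    using 0 unfolding second_moment_def by (subst (asm) nn_integral_0_iff_AE) auto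
  with 1 have "AE x in lborel. ennreal ((norm (f x))\<^sup>2) = 0"
  proof eventually_elim
    case (elim x)
    then have "(b \<bullet> x)\<^sup>2 * (norm (f x))\<^sup>2 \<le> 0" by (simp add: ennreal_eq_0_iff)
    moreover have "(b \<bullet> x)\<^sup>2 * (norm (f x))\<^sup>2 \<ge> 0" by simp
    ultimately have "(b \<bullet> x)\<^sup>2 * (norm (f x))\<^sup>2 = 0" by (rule antisym)
    with elim(1) show ?case by simp
  qed
  then show ?thesis unfolding L2_norm_sq_def by (subst nn_integral_0_iff_AE) auto
qed

lemma second_moment_shift_le:
  fixes f :: "'a::euclidean_space \<Rightarrow> 'b::euclidean_space"
  assumes [measurable]: "f \<in> borel_measurable borel" and t: "t > 0"
  shows "second_moment b (\<lambda>x. f (x + t *\<^sub>R b))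
    \<le> ennreal (1 + t) * second_moment b f + ennreal ((t\<^sup>2 + t) * norm b ^ 4) * L2_norm_sq f"
proof -
  let ?n = "(norm b)\<^sup>2"
  have "second_moment b (\<lambda>x. f (x + t *\<^sub>R b))
      = (\<integral>\<^sup>+x. ennreal ((b \<bullet> ((x + t *\<^sub>R b) - t *\<^sub>R b))\<^sup>2 * (norm (f (x + t *\<^sub>R b)))\<^sup>2) \<partial>lborel)"
    by (simp add: second_moment_def)
  also have "\<dots> = (\<integral>\<^sup>+x. ennreal ((b \<bullet> (x - t *\<^sub>R b))\<^sup>2 * (norm (f x))\<^sup>2) \<partial>lborel)"
    by (rule nn_integral_translate[of "\<lambda>x. ennreal ((b \<bullet> (x - t *\<^sub>R b))\<^sup>2 * (norm (f x))\<^sup>2)" "t *\<^sub>R b"]) measurable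
  also have "\<dots> \<le> (\<integral>\<^sup>+x. ennreal ((1 + t) * ((b \<bullet> x)\<^sup>2 * (norm (f x))\<^sup>2)
      + ((t\<^sup>2 + t) * norm b ^ 4) * (norm (f x))\<^sup>2) \<partial>lborel)"
  proof (intro nn_integral_mono ennreal_leI)
    fix x
    have "(b \<bullet> (x - t *\<^sub>R b))\<^sup>2 = (b \<bullet> x - t * ?n)\<^sup>2"
      by (simp add: inner_diff_right power2_norm_eq_inner)
    also have "\<dots> \<le> (1 + t) * (b \<bullet> x)\<^sup>2 + (t\<^sup>2 + t) * ?n\<^sup>2"
    proof -
      have "(1 + t) * (b \<bullet> x)\<^sup>2 + (t\<^sup>2 + t) * ?n\<^sup>2 - (b \<bullet> x - t * ?n)\<^sup>2 = t * (b \<bullet> x + ?n)\<^sup>2"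
        by (simp add: power2_eq_square algebra_simps)
      moreover have "t * (b \<bullet> x + ?n)\<^sup>2 \<ge> 0" using t by simp
      ultimately show ?thesis by linarith
    qed
    also have "?n\<^sup>2 = norm b ^ 4" by simp
    finally have "(b \<bullet> (x - t *\<^sub>R b))\<^sup>2 \<le> (1 + t) * (b \<bullet> x)\<^sup>2 + (t\<^sup>2 + t) * norm b ^ 4" .
    from mult_right_mono[OF this, of "(norm (f x))\<^sup>2"]
    show "(b \<bullet> (x - t *\<^sub>R b))\<^sup>2 * (norm (f x))\<^sup>2
      \<le> (1 + t) * ((b \<bullet> x)\<^sup>2 * (norm (f x))\<^sup>2) + ((t\<^sup>2 + t) * norm b ^ 4) * (norm (f x))\<^sup>2"
      by (simp add: distrib_right mult.assoc)
  qed
  also have "\<dots> = (\<integral>\<^sup>+x. ennreal (1 + t) * ennreal ((b \<bullet> x)\<^sup>2 * (norm (f x))\<^sup>2)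
      + ennreal ((t\<^sup>2 + t) * norm b ^ 4) * ennreal ((norm (f x))\<^sup>2) \<partial>lborel)"
  proof (rule nn_integral_cong)
    fix x
    show "ennreal ((1 + t) * ((b \<bullet> x)\<^sup>2 * (norm (f x))\<^sup>2) + ((t\<^sup>2 + t) * norm b ^ 4) * (norm (f x))\<^sup>2)
      = ennreal (1 + t) * ennreal ((b \<bullet> x)\<^sup>2 * (norm (f x))\<^sup>2)
        + ennreal ((t\<^sup>2 + t) * norm b ^ 4) * ennreal ((norm (f x))\<^sup>2)"
    proof -
      have "0 \<le> (1 + t)" "0 \<le> (b \<bullet> x)\<^sup>2 * (norm (f x))\<^sup>2" "0 \<le> (t\<^sup>2 + t) * norm b ^ 4"
        using t by auto
      then show ?thesis
        by (simp only: ennreal_plus ennreal_mult mult_nonneg_nonneg zero_le_power2)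
    qed
  qed
  also have "\<dots> = ennreal (1 + t) * second_moment b f + ennreal ((t\<^sup>2 + t) * norm b ^ 4) * L2_norm_sq f"
    unfolding second_moment_def L2_norm_sq_def
    by (subst nn_integral_add; (subst nn_integral_cmult)?; (subst nn_integral_cmult)?; measurable?)
  finally show ?thesis .
qed

lemma second_moment_add_le:
  fixes u v :: "'a::euclidean_space \<Rightarrow> 'b::euclidean_space"
  assumes [measurable]: "u \<in> borel_measurable borel" "v \<in> borel_measurable borel"
  shows "second_moment b (\<lambda>x. u x + v x) \<le> 2 * second_moment b u + 2 * second_moment b v"
proof -
  have "second_moment b (\<lambda>x. u x + v x) \<le> (\<integral>\<^sup>+x. 2 * ennreal ((b \<bullet> x)\<^sup>2 * (norm (u x))\<^sup>2)
      + 2 * ennreal ((b \<bullet> x)\<^sup>2 * (norm (v x))\<^sup>2) \<partial>lborel)"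
    unfolding second_moment_def
  proof (rule nn_integral_mono)
    fix x
    have "(norm (u x + v x))\<^sup>2 \<le> 2 * (norm (u x))\<^sup>2 + 2 * (norm (v x))\<^sup>2"
      using power2_norm_le_weighted[of 1 "u x + v x" "u x"] by simp
    from mult_left_mono[OF this, of "(b \<bullet> x)\<^sup>2"]
    have "ennreal ((b \<bullet> x)\<^sup>2 * (norm (u x + v x))\<^sup>2)
      \<le> ennreal (2 * ((b \<bullet> x)\<^sup>2 * (norm (u x))\<^sup>2) + 2 * ((b \<bullet> x)\<^sup>2 * (norm (v x))\<^sup>2))"
      by (intro ennreal_leI) (simp add: algebra_simps)
    also have "\<dots> = 2 * ennreal ((b \<bullet> x)\<^sup>2 * (norm (u x))\<^sup>2) + 2 * ennreal ((b \<bullet> x)\<^sup>2 * (norm (v x))\<^sup>2)"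
      by (simp add: ennreal_mult)
    finally show "ennreal ((b \<bullet> x)\<^sup>2 * (norm (u x + v x))\<^sup>2)
      \<le> 2 * ennreal ((b \<bullet> x)\<^sup>2 * (norm (u x))\<^sup>2) + 2 * ennreal ((b \<bullet> x)\<^sup>2 * (norm (v x))\<^sup>2)" .
  qed
  also have "\<dots> = 2 * second_moment b u + 2 * second_moment b v"
    unfolding second_moment_def by (simp add: nn_integral_add nn_integral_cmult)
  finally show ?thesis .
qed

text \<open>
  This plays the role of the canonical commutation relation: the shift moves the first moment of
  \<open>|f|\<^sup>2\<close> in direction \<open>b\<close> by \<open>t |b|\<^sup>2 \<parallel>f\<parallel>\<^sup>2\<close>. The change is also the integral of
  \<open>(b \<bullet> x) (f - f\<^sub>t) \<bullet> (f + f\<^sub>t)\<close>, to which the Cauchy-Schwarz inequality applies.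
\<close>

lemma shift_commutator_bound:
  fixes f :: "'a::euclidean_space \<Rightarrow> 'b::euclidean_space"
  assumes [measurable]: "f \<in> borel_measurable borel" and t: "t > 0"
    and F: "L2_norm_sq f = ennreal F" "F \<ge> 0" and X: "second_moment b f < \<infinity>"
  shows "(ennreal (t * (norm b)\<^sup>2 * F))\<^sup>2
     \<le> L2_norm_sq (\<lambda>x. f (x + t *\<^sub>R b) - f x) * second_moment b (\<lambda>x. f x + f (x + t *\<^sub>R b))"
proof -
  let ?s = "\<lambda>x. f (x + t *\<^sub>R b)"
  have i: "integrable lborel (\<lambda>x. (norm (f x))\<^sup>2)" using L2_norm_sq_finite_iff[of f] F by simp
  have Fi: "(\<integral>x. (norm (f x))\<^sup>2 \<partial>lborel) = F"
    using L2_norm_sq_eq_integral[of f] F by (simp add: ennreal_inj)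
  have i2: "integrable lborel (\<lambda>x. (b \<bullet> x)\<^sup>2 * (norm (f x))\<^sup>2)"
    using X unfolding second_moment_def by (intro integrableI_bounded) (simp_all add: abs_mult)
  have i1: "integrable lborel (\<lambda>x. (b \<bullet> x) * (norm (f x))\<^sup>2)"
  proof (rule Bochner_Integration.integrable_bound)
    show "integrable lborel (\<lambda>x. (norm (f x))\<^sup>2 + (b \<bullet> x)\<^sup>2 * (norm (f x))\<^sup>2)" using i i2 by simp
    have "\<bar>y\<bar> \<le> 1 + y\<^sup>2" for y :: real
    proof -
      have "2 * \<bar>y\<bar> \<le> \<bar>y\<bar>\<^sup>2 + 1" using sum_squares_bound[of "\<bar>y\<bar>" 1] by simp
      then have "2 * \<bar>y\<bar> \<le> y\<^sup>2 + 1" by (simp only: power2_abs)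
      then show ?thesis using zero_le_power2[of y] by linarith
    qed
    from mult_right_mono[OF this, of "(norm (f _))\<^sup>2"]
    show "AE x in lborel. norm ((b \<bullet> x) * (norm (f x))\<^sup>2)
        \<le> norm ((norm (f x))\<^sup>2 + (b \<bullet> x)\<^sup>2 * (norm (f x))\<^sup>2)"
      by (intro AE_I2) (simp add: abs_mult distrib_right)
  qed simp
  have c: "(\<lambda>x. ((b \<bullet> x) * (norm (f x))\<^sup>2 - t * (norm b)\<^sup>2 * (norm (f x))\<^sup>2))
      \<in> borel_measurable borel" by measurable
  \<comment> \<open>the weight in terms of the shifted point, so that the integral of the shifted function can be shifted back\<close>
  have sh: "(b \<bullet> x) * (norm (?s x))\<^sup>2 = (b \<bullet> (x + t *\<^sub>R b)) * (norm (?s x))\<^sup>2 - t * (norm b)\<^sup>2 * (norm (?s x))\<^sup>2" for x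
    by (simp add: inner_add_right power2_norm_eq_inner algebra_simps)
  have i3: "integrable lborel (\<lambda>x. (b \<bullet> x) * (norm (f x))\<^sup>2 - t * (norm b)\<^sup>2 * (norm (f x))\<^sup>2)"
    using i i1 by simp
  have i4: "integrable lborel (\<lambda>x. (b \<bullet> x) * (norm (?s x))\<^sup>2)"
    unfolding sh using integrable_shift[OF i3, of "t *\<^sub>R b"] .
  have "(\<integral>x. (b \<bullet> x) * (norm (?s x))\<^sup>2 \<partial>lborel)
      = (\<integral>x. (b \<bullet> x) * (norm (f x))\<^sup>2 - t * (norm b)\<^sup>2 * (norm (f x))\<^sup>2 \<partial>lborel)"
    unfolding sh by (rule integral_shift[OF c])
  also have "\<dots> = (\<integral>x. (b \<bullet> x) * (norm (f x))\<^sup>2 \<partial>lborel) - t * (norm b)\<^sup>2 * F"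
    using i i1 Fi by simp
  finally have "t * (norm b)\<^sup>2 * F
      = (\<integral>x. (b \<bullet> x) * (norm (f x))\<^sup>2 - (b \<bullet> x) * (norm (?s x))\<^sup>2 \<partial>lborel)"
    using i1 i4 by simp
  also have "\<dots> \<le> (\<integral>x. \<bar>(b \<bullet> x) * (norm (f x))\<^sup>2 - (b \<bullet> x) * (norm (?s x))\<^sup>2\<bar> \<partial>lborel)"
    using i1 i4 by (intro integral_mono) auto
  finally have "ennreal (t * (norm b)\<^sup>2 * F)
     \<le> ennreal (\<integral>x. \<bar>(b \<bullet> x) * (norm (f x))\<^sup>2 - (b \<bullet> x) * (norm (?s x))\<^sup>2\<bar> \<partial>lborel)"
    by (rule ennreal_leI)
  also have "\<dots> = (\<integral>\<^sup>+x. ennreal \<bar>(b \<bullet> x) * (norm (f x))\<^sup>2 - (b \<bullet> x) * (norm (?s x))\<^sup>2\<bar> \<partial>lborel)"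
    using i1 i4 by (intro nn_integral_eq_integral[symmetric]) auto
  also have "\<dots> \<le> (\<integral>\<^sup>+x. ennreal (norm (?s x - f x)) * ennreal (\<bar>b \<bullet> x\<bar> * norm (f x + ?s x)) \<partial>lborel)"
  proof (rule nn_integral_mono)
    fix x
    have "(b \<bullet> x) * (norm (f x))\<^sup>2 - (b \<bullet> x) * (norm (?s x))\<^sup>2 = - ((b \<bullet> x) * ((?s x - f x) \<bullet> (f x + ?s x)))"
      by (simp add: power2_norm_eq_inner inner_commute algebra_simps)
    then have "\<bar>(b \<bullet> x) * (norm (f x))\<^sup>2 - (b \<bullet> x) * (norm (?s x))\<^sup>2\<bar>
        \<le> \<bar>b \<bullet> x\<bar> * (norm (?s x - f x) * norm (f x + ?s x))"
      using Cauchy_Schwarz_ineq2[of "?s x - f x" "f x + ?s x"] by (simp add: abs_mult mult_left_mono)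
    also have "\<dots> = norm (?s x - f x) * (\<bar>b \<bullet> x\<bar> * norm (f x + ?s x))" by simp
    finally show "ennreal \<bar>(b \<bullet> x) * (norm (f x))\<^sup>2 - (b \<bullet> x) * (norm (?s x))\<^sup>2\<bar>
       \<le> ennreal (norm (?s x - f x)) * ennreal (\<bar>b \<bullet> x\<bar> * norm (f x + ?s x))"
      by (subst ennreal_mult[symmetric]) (auto intro: ennreal_leI)
  qed
  finally have "(ennreal (t * (norm b)\<^sup>2 * F))\<^sup>2
    \<le> (\<integral>\<^sup>+x. ennreal (norm (?s x - f x)) * ennreal (\<bar>b \<bullet> x\<bar> * norm (f x + ?s x)) \<partial>lborel)\<^sup>2"
    by (rule power_mono) simp
  also have "\<dots> \<le> (\<integral>\<^sup>+x. (ennreal (norm (?s x - f x)))\<^sup>2 \<partial>lborel)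
      * (\<integral>\<^sup>+x. (ennreal (\<bar>b \<bullet> x\<bar> * norm (f x + ?s x)))\<^sup>2 \<partial>lborel)"
    by (rule Cauchy_Schwarz_nn_integral) measurable
  also have "\<dots> = L2_norm_sq (\<lambda>x. ?s x - f x) * second_moment b (\<lambda>x. f x + ?s x)"
    by (simp add: L2_norm_sq_def second_moment_def ennreal_power power_mult_distrib)
  finally show ?thesis .
qed

context complex_structure begin

text \<open>
  On the transform side the difference \<open>f\<^sub>t - f\<close> is multiplication by \<open>exp (J t (b \<bullet> w)) - 1\<close>, of modulus
  at most \<open>|t (b \<bullet> w)|\<close>.
\<close>

lemma is_FT_shift_bound:
  fixes f :: "'a::euclidean_space \<Rightarrow> 'b"
  assumes "is_FT f g"
  shows "ennreal ((2 * pi) ^ DIM('a)) * L2_norm_sq (\<lambda>x. f (x + t *\<^sub>R b) - f x) \<le> ennreal (t\<^sup>2) * second_moment b g"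
proof -
  have [measurable]: "g \<in> borel_measurable borel" using assms by (simp add: is_FT_def)
  have "ennreal ((2 * pi) ^ DIM('a)) * L2_norm_sq (\<lambda>x. f (x + t *\<^sub>R b) - f x)
      = L2_norm_sq (\<lambda>w. rot ((t *\<^sub>R b) \<bullet> w) (g w) - g w)"
    by (rule is_FT_plancherel[OF is_FT_diff[OF is_FT_shift[OF assms] assms], symmetric])
  also have "\<dots> \<le> (\<integral>\<^sup>+w. ennreal (t\<^sup>2) * ennreal ((b \<bullet> w)\<^sup>2 * (norm (g w))\<^sup>2) \<partial>lborel)"
    unfolding L2_norm_sq_def
  proof (rule nn_integral_mono)
    fix w
    show "ennreal ((norm (rot ((t *\<^sub>R b) \<bullet> w) (g w) - g w))\<^sup>2)
        \<le> ennreal (t\<^sup>2) * ennreal ((b \<bullet> w)\<^sup>2 * (norm (g w))\<^sup>2)"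
      using norm_rot_diff_le[of "(t *\<^sub>R b) \<bullet> w" "g w"]
      by (subst ennreal_mult[symmetric]) (auto intro!: ennreal_leI simp: power_mult_distrib mult.assoc)
  qed
  also have "\<dots> = ennreal (t\<^sup>2) * second_moment b g"
    unfolding second_moment_def by (rule nn_integral_cmult) measurable
  finally show ?thesis .
qed

text \<open>
  When one second moment is infinite the other one has to be shown nonzero, since \<open>0 \<cdot> \<infinity> = 0\<close>; it
  vanishes only for \<open>f = 0\<close>. In the finite case the two preceding bounds combine to an
  inequality for every step \<open>t > 0\<close>, and \<open>t\<close> tends to 0.
\<close>

theorem heisenberg:
  fixes f g :: "'a::euclidean_space \<Rightarrow> 'b"
  assumes FT: "is_FT f g"
  shows "ennreal (1 / 4 * norm b ^ 4) * (L2_norm_sq f)\<^sup>2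
    \<le> second_moment b f * (ennreal (1 / (2 * pi) ^ DIM('a)) * second_moment b g)"
proof -
  have [measurable]: "f \<in> borel_measurable borel" "g \<in> borel_measurable borel"
    and f2: "L2_norm_sq f < \<infinity>" using FT by (auto simp: is_FT_def)
  define K where "K = (2 * pi) ^ DIM('a)"
  have K: "K > 0" by (simp add: K_def)
  show ?thesis
  proof (cases "b = 0 \<or> L2_norm_sq f = 0")
    case True
    then show ?thesis by auto
  next
    case False
    then have b: "b \<noteq> 0" and f0: "L2_norm_sq f \<noteq> 0" by auto
    have X0: "second_moment b f \<noteq> 0" using L2_norm_sq_eq_0_of_moment[of f b] b f0 by auto
    have "L2_norm_sq g \<noteq> 0" using is_FT_plancherel[OF FT] f0 by (simp add: ennreal_eq_0_iff not_le)
    then have W0: "second_moment b g \<noteq> 0" using L2_norm_sq_eq_0_of_moment[of g b] b by auto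
    show ?thesis
    proof (cases "second_moment b f = \<infinity> \<or> second_moment b g = \<infinity>")
      case True
      then have "second_moment b f * (ennreal (1 / K) * second_moment b g) = \<infinity>"
        using X0 W0 K by (auto simp: ennreal_mult_eq_top_iff ennreal_eq_0_iff not_le ennreal_top_mult ennreal_mult_top)
      then show ?thesis by (simp add: K_def)
    next
      case False
      define F where "F = enn2real (L2_norm_sq f)"
      define X where "X = enn2real (second_moment b f)"
      define W where "W = enn2real (second_moment b g)"
      have F: "L2_norm_sq f = ennreal F" "F \<ge> 0" using f2 by (auto simp: F_def)
      have X: "second_moment b f = ennreal X" "X \<ge> 0" using False by (auto simp: X_def less_top)
      have W: "second_moment b g = ennreal W" "W \<ge> 0" using False by (auto simp: W_def less_top)
      \<comment> \<open>the commutation and translation bounds combined and divided by \<open>t\<^sup>2\<close>; the bracket tends to \<open>4 X\<close>\<close>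
      have ineq: "K * (norm b ^ 4 * F\<^sup>2) \<le> W * (2 * X + 2 * ((1 + t) * X + (t\<^sup>2 + t) * norm b ^ 4 * F))"
        if t: "t > 0" for t
      proof -
        let ?P = "L2_norm_sq (\<lambda>x. f (x + t *\<^sub>R b) - f x)"
        let ?Q = "second_moment b (\<lambda>x. f x + f (x + t *\<^sub>R b))"
        let ?q = "2 * X + 2 * ((1 + t) * X + (t\<^sup>2 + t) * norm b ^ 4 * F)"
        have q0: "?q \<ge> 0" using X F t by auto
        have "?Q \<le> 2 * second_moment b f + 2 * second_moment b (\<lambda>x. f (x + t *\<^sub>R b))"
          by (rule second_moment_add_le) measurable
        also have "\<dots> \<le> 2 * second_moment b f + 2 * (ennreal (1 + t) * second_moment b f
            + ennreal ((t\<^sup>2 + t) * norm b ^ 4) * L2_norm_sq f)"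
          by (intro add_left_mono mult_left_mono second_moment_shift_le t) auto
        also have "\<dots> = ennreal ?q"
        proof -
          have "0 \<le> (t\<^sup>2 + t) * norm b ^ 4" using t by simp
          then show ?thesis unfolding X F using X(2) F(2) t by (simp add: ennreal_mult ennreal_plus del: power_eq_0_iff)
        qed
        finally have Q: "?Q \<le> ennreal ?q" .
        have P: "ennreal K * ?P \<le> ennreal (t\<^sup>2 * W)"
          using is_FT_shift_bound[OF FT, of t b] W by (simp add: K_def ennreal_mult)
        have "ennreal (K * (t * (norm b)\<^sup>2 * F)\<^sup>2) = ennreal K * (ennreal (t * (norm b)\<^sup>2 * F))\<^sup>2"
        proof -
          have "0 \<le> t * (norm b)\<^sup>2 * F" using t F by simp
          then show ?thesis using K by (simp only: ennreal_mult less_imp_le ennreal_power zero_le_power2)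
        qed
        also have "\<dots> \<le> ennreal K * (?P * ?Q)"
          by (intro mult_left_mono shift_commutator_bound F t) (use X in auto)
        also have "\<dots> \<le> ennreal (t\<^sup>2 * W) * ennreal ?q"
          unfolding mult.assoc[symmetric] by (intro mult_mono P Q) auto
        also have "\<dots> = ennreal (t\<^sup>2 * W * ?q)" using W q0 by (intro ennreal_mult[symmetric]) auto
        finally have "K * (t * (norm b)\<^sup>2 * F)\<^sup>2 \<le> t\<^sup>2 * W * ?q"
          using W q0 by (subst (asm) ennreal_le_iff) auto
        then have "t\<^sup>2 * (K * (norm b ^ 4 * F\<^sup>2)) \<le> t\<^sup>2 * (W * ?q)"
          by (simp add: power_mult_distrib mult_ac)
        then show ?thesis using t by simp
      qed
      have "((\<lambda>t. W * (2 * X + 2 * ((1 + t) * X + (t\<^sup>2 + t) * norm b ^ 4 * F)))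
          \<longlongrightarrow> W * (2 * X + 2 * ((1 + 0) * X + (0\<^sup>2 + 0) * norm b ^ 4 * F))) (at_right 0)"
        by (intro tendsto_intros)
      then have "K * (norm b ^ 4 * F\<^sup>2) \<le> W * (2 * X + 2 * ((1 + 0) * X + (0\<^sup>2 + 0) * norm b ^ 4 * F))"
        by (rule tendsto_lowerbound)
           (use ineq in \<open>auto simp: eventually_at_right_less intro: eventually_at_rightI[of 0 1]\<close>)
      then have "1 / 4 * norm b ^ 4 * F\<^sup>2 \<le> X * (1 / K * W)"
        using K by (simp add: field_simps)
      then have "ennreal (1 / 4 * norm b ^ 4 * F\<^sup>2) \<le> ennreal (X * (1 / K * W))"
        by (rule ennreal_leI)
      also have "\<dots> = second_moment b f * (ennreal (1 / K) * second_moment b g)"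
        unfolding X W using X W K by (simp only: ennreal_mult[symmetric] mult_nonneg_nonneg divide_nonneg_pos zero_le_one)
      also have "ennreal (1 / 4 * norm b ^ 4 * F\<^sup>2) = ennreal (1 / 4 * norm b ^ 4) * (L2_norm_sq f)\<^sup>2"
        unfolding F(1) ennreal_power[OF F(2)] by (rule ennreal_mult) auto
      finally show ?thesis by (simp add: K_def)
    qed
  qed
qed

end

section \<open>Second moments of Gaussians\<close>

lemma tendsto_DERIV_quotient:
  fixes f :: "real \<Rightarrow> real"
  assumes D: "(f has_real_derivative d) (at 0)" and h: "h \<longlonglongrightarrow> 0" "\<And>m. h m \<noteq> 0"
  shows "(\<lambda>m. (f (h m) - f 0) / h m) \<longlonglongrightarrow> d"
proof -
  have "((\<lambda>y. (f y - f 0) / y) \<longlongrightarrow> d) (at 0)"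
    using D by (simp add: has_field_derivative_iff)
  moreover have "filterlim h (at 0) sequentially"
    using h by (auto intro!: filterlim_atI)
  ultimately show ?thesis by (rule filterlim_compose)
qed

text \<open>
  The second moment is minus the second derivative of the Fourier transform at 0, taken here as the
  limit of the symmetric second difference, which is a multiple of \<open>sin\<^sup>2\<close> and is dominated by the
  quadratic itself.
\<close>

lemma gaussian_second_moment:
  fixes b :: "'a::euclidean_space"
  assumes r: "r > 0"
  shows "integrable lborel (\<lambda>x. exp (- (norm (r *\<^sub>R x))\<^sup>2 / 2) * (b \<bullet> x)\<^sup>2)" (is ?I)
    and "(\<integral>x. exp (- (norm (r *\<^sub>R x))\<^sup>2 / 2) * (b \<bullet> x)\<^sup>2 \<partial>lborel)
      = (norm b)\<^sup>2 / r\<^sup>2 * (\<integral>x. exp (- (norm (r *\<^sub>R x))\<^sup>2 / 2) \<partial>(lborel :: 'a measure))" (is ?E)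
proof -
  let ?g = "\<lambda>x::'a. exp (- (norm (r *\<^sub>R x))\<^sup>2 / 2)"
  define G where "G = (\<integral>x. ?g x \<partial>lborel)"
  define \<beta> where "\<beta> = (norm b)\<^sup>2 / r\<^sup>2"
  define h where "h m = inverse (real (Suc m))" for m
  have h: "h \<longlonglongrightarrow> 0" "\<And>m. h m \<noteq> 0" "\<And>m. h m > 0"
    unfolding h_def using LIMSEQ_inverse_real_of_nat by auto
  have gi: "integrable lborel ?g" by (rule gaussian_scaled(1)[OF r])
  show I: ?I
  proof (rule Bochner_Integration.integrable_bound)
    have "r / 2 > 0" using r by simp
    from gaussian_scaled(1)[OF this]
    \<comment> \<open>a quarter of the exponent survives; the rest absorbs the quadratic by \<open>y \<le> exp y\<close>, used at \<open>y = 3 r\<^sup>2 |x|\<^sup>2 / 8\<close>\<close>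
    show "integrable lborel (\<lambda>x::'a. (norm b)\<^sup>2 * (8 / (3 * r\<^sup>2)) * exp (- (norm ((r / 2) *\<^sub>R x))\<^sup>2 / 2))"
      by (rule integrable_mult_right)
    show "AE x in lborel. norm (?g x * (b \<bullet> x)\<^sup>2)
       \<le> norm ((norm b)\<^sup>2 * (8 / (3 * r\<^sup>2)) * exp (- (norm ((r / 2) *\<^sub>R x))\<^sup>2 / 2))"
    proof (rule AE_I2)
      fix x :: 'a
      define u where "u = r\<^sup>2 * (norm x)\<^sup>2"
      have "(b \<bullet> x)\<^sup>2 \<le> (norm b)\<^sup>2 * (norm x)\<^sup>2"
        using Cauchy_Schwarz_ineq[of b x] by (simp add: power2_norm_eq_inner)
      also have "(norm x)\<^sup>2 = 8 / (3 * r\<^sup>2) * (3 * u / 8)" using r by (simp add: u_def)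
      also have "(norm b)\<^sup>2 * (8 / (3 * r\<^sup>2) * (3 * u / 8)) \<le> (norm b)\<^sup>2 * (8 / (3 * r\<^sup>2) * exp (3 * u / 8))"
      proof (intro mult_left_mono)
        show "3 * u / 8 \<le> exp (3 * u / 8)" using exp_ge_add_one_self[of "3 * u / 8"] by linarith
      qed auto
      finally have "(b \<bullet> x)\<^sup>2 \<le> (norm b)\<^sup>2 * (8 / (3 * r\<^sup>2)) * exp (3 * u / 8)" by (simp only: mult.assoc)
      then have "(b \<bullet> x)\<^sup>2 * exp (- u / 2) \<le> (norm b)\<^sup>2 * (8 / (3 * r\<^sup>2)) * exp (3 * u / 8) * exp (- u / 2)"
        by (rule mult_right_mono) simp
      also have "\<dots> = (norm b)\<^sup>2 * (8 / (3 * r\<^sup>2)) * exp (- u / 8)"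
        by (simp add: mult.assoc exp_add[symmetric])
      finally show "norm (?g x * (b \<bullet> x)\<^sup>2)
         \<le> norm ((norm b)\<^sup>2 * (8 / (3 * r\<^sup>2)) * exp (- (norm ((r / 2) *\<^sub>R x))\<^sup>2 / 2))"
        by (simp add: u_def power_mult_distrib power_divide mult.commute abs_mult)
    qed
  qed measurable
  have lim: "(\<lambda>m. \<integral>x. ?g x * (sin (h m * (b \<bullet> x)) / h m)\<^sup>2 \<partial>lborel)
     \<longlonglongrightarrow> (\<integral>x. ?g x * (b \<bullet> x)\<^sup>2 \<partial>lborel)"
  proof (rule integral_dominated_convergence[where w = "\<lambda>x. ?g x * (b \<bullet> x)\<^sup>2"])
    show "AE x in lborel. (\<lambda>m. ?g x * (sin (h m * (b \<bullet> x)) / h m)\<^sup>2) \<longlonglongrightarrow> ?g x * (b \<bullet> x)\<^sup>2"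
    proof (rule AE_I2)
      fix x
      have "((\<lambda>y. sin (y * (b \<bullet> x))) has_real_derivative (b \<bullet> x)) (at 0)"
        by (auto intro!: derivative_eq_intros)
      from tendsto_DERIV_quotient[OF this h(1,2)]
      have "(\<lambda>m. sin (h m * (b \<bullet> x)) / h m) \<longlonglongrightarrow> b \<bullet> x" by simp
      then show "(\<lambda>m. ?g x * (sin (h m * (b \<bullet> x)) / h m)\<^sup>2) \<longlonglongrightarrow> ?g x * (b \<bullet> x)\<^sup>2"
        by (intro tendsto_intros)
    qed
    show "AE x in lborel. norm (?g x * (sin (h m * (b \<bullet> x)) / h m)\<^sup>2) \<le> ?g x * (b \<bullet> x)\<^sup>2" for m
    proof (rule AE_I2)
      fix x
      have "\<bar>sin (h m * (b \<bullet> x))\<bar> \<le> \<bar>h m * (b \<bullet> x)\<bar>" by (rule abs_sin_x_le_abs_x)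
      then have "\<bar>sin (h m * (b \<bullet> x)) / h m\<bar> \<le> \<bar>b \<bullet> x\<bar>"
        using h(3)[of m] by (simp add: abs_mult pos_divide_le_eq mult.commute)
      then have "(sin (h m * (b \<bullet> x)) / h m)\<^sup>2 \<le> (b \<bullet> x)\<^sup>2" by (rule abs_le_square_iff[THEN iffD1])
      then show "norm (?g x * (sin (h m * (b \<bullet> x)) / h m)\<^sup>2) \<le> ?g x * (b \<bullet> x)\<^sup>2" by simp
    qed
  qed (use I in measurable)
  have val: "(\<integral>x. ?g x * (sin (h m * (b \<bullet> x)) / h m)\<^sup>2 \<partial>lborel)
      = G * ((1 - exp (- 2 * (h m)\<^sup>2 * \<beta>)) / (2 * (h m)\<^sup>2))" for m
  proof -
    let ?v = "(2 * h m) *\<^sub>R b"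
    have ci: "integrable lborel (\<lambda>x. ?g x * cos (?v \<bullet> x))"
      by (rule Bochner_Integration.integrable_bound[OF gi]) (auto simp: abs_mult mult_left_le)
    have "(\<integral>x. ?g x * (sin (h m * (b \<bullet> x)) / h m)\<^sup>2 \<partial>lborel)
        = (\<integral>x. (?g x - ?g x * cos (?v \<bullet> x)) / (2 * (h m)\<^sup>2) \<partial>lborel)"
    proof (rule Bochner_Integration.integral_cong)
      fix x
      have c: "cos (?v \<bullet> x) = 1 - 2 * (sin (h m * (b \<bullet> x)))\<^sup>2"
        using cos_double_sin[of "h m * (b \<bullet> x)"] by (simp add: mult.assoc)
      then show "?g x * (sin (h m * (b \<bullet> x)) / h m)\<^sup>2 = (?g x - ?g x * cos (?v \<bullet> x)) / (2 * (h m)\<^sup>2)"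
        unfolding c by (simp add: power_divide right_diff_distrib)
    qed simp
    also have "\<dots> = (G - (\<integral>x. ?g x * cos (?v \<bullet> x) \<partial>lborel)) / (2 * (h m)\<^sup>2)"
      using gi ci by (simp add: G_def)
    also have "(\<integral>x. ?g x * cos (?v \<bullet> x) \<partial>lborel) = G * exp (- 2 * (h m)\<^sup>2 * \<beta>)"
    proof -
      have "G = (sqrt (2 * pi) / r) ^ DIM('a)"
        using gaussian_scaled(2)[OF r, of "0 :: 'a"] by (simp add: G_def)
      moreover have "- (norm ((1 / r) *\<^sub>R ?v))\<^sup>2 / 2 = - 2 * (h m)\<^sup>2 * \<beta>"
        using r by (simp add: \<beta>_def power_mult_distrib power_divide)
      ultimately show ?thesis using gaussian_scaled(2)[OF r, of ?v] by simp
    qed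
    finally show ?thesis by (simp add: right_diff_distrib)
  qed
  have "(\<lambda>m. ((- exp (- 2 * (h m)\<^sup>2 * \<beta>)) - (- exp (- 2 * 0 * \<beta>))) / (h m)\<^sup>2) \<longlonglongrightarrow> 2 * \<beta>"
  proof (rule tendsto_DERIV_quotient)
    show "((\<lambda>y. - exp (- 2 * y * \<beta>)) has_real_derivative 2 * \<beta>) (at 0)"
      by (auto intro!: derivative_eq_intros)
    have "(\<lambda>m. (h m)\<^sup>2) \<longlonglongrightarrow> 0\<^sup>2" by (intro tendsto_intros h)
    then show "(\<lambda>m. (h m)\<^sup>2) \<longlonglongrightarrow> 0" by simp
  qed (use h(2) in simp)
  then have "(\<lambda>m. G * (((- exp (- 2 * (h m)\<^sup>2 * \<beta>)) - (- exp (- 2 * 0 * \<beta>))) / (h m)\<^sup>2 / 2))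
      \<longlonglongrightarrow> G * (2 * \<beta> / 2)"
    by (intro tendsto_intros) auto
  moreover have "G * (((- exp (- 2 * (h m)\<^sup>2 * \<beta>)) - (- exp (- 2 * 0 * \<beta>))) / (h m)\<^sup>2 / 2)
     = G * ((1 - exp (- 2 * (h m)\<^sup>2 * \<beta>)) / (2 * (h m)\<^sup>2))" for m
    by simp
  ultimately have "(\<lambda>m. \<integral>x. ?g x * (sin (h m * (b \<bullet> x)) / h m)\<^sup>2 \<partial>lborel) \<longlonglongrightarrow> G * \<beta>"
    unfolding val by (simp add: mult.commute)
  with lim have "(\<integral>x. ?g x * (b \<bullet> x)\<^sup>2 \<partial>lborel) = G * \<beta>" by (rule LIMSEQ_unique)
  then show ?E by (simp add: G_def \<beta>_def)
qed

lemma second_moment_gaussian: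
  fixes f :: "'a::euclidean_space \<Rightarrow> 'b::euclidean_space"
  assumes r: "r > 0" and c: "c \<ge> 0"
    and f: "\<And>x. (norm (f x))\<^sup>2 = c * exp (- (norm (r *\<^sub>R x))\<^sup>2 / 2)"
  shows "second_moment b f = ennreal ((norm b)\<^sup>2 / r\<^sup>2) * L2_norm_sq f"
proof -
  let ?g = "\<lambda>x::'a. exp (- (norm (r *\<^sub>R x))\<^sup>2 / 2)"
  have "second_moment b f = (\<integral>\<^sup>+x. ennreal (c * (?g x * (b \<bullet> x)\<^sup>2)) \<partial>lborel)"
    unfolding second_moment_def f by (simp add: mult_ac)
  also have "\<dots> = ennreal (\<integral>x. c * (?g x * (b \<bullet> x)\<^sup>2) \<partial>lborel)"
    by (rule nn_integral_eq_integral, rule integrable_mult_right, rule gaussian_second_moment(1)[OF r])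
       (use c in simp)
  also have "(\<integral>x. c * (?g x * (b \<bullet> x)\<^sup>2) \<partial>lborel) = (norm b)\<^sup>2 / r\<^sup>2 * (\<integral>x. c * ?g x \<partial>lborel)"
    by (simp only: integral_mult_right_zero gaussian_second_moment(2)[OF r] mult.left_commute)
  also have "ennreal \<dots> = ennreal ((norm b)\<^sup>2 / r\<^sup>2) * ennreal (\<integral>x. c * ?g x \<partial>lborel)"
    using c by (intro ennreal_mult) (auto intro!: Bochner_Integration.integral_nonneg)
  also have "ennreal (\<integral>x. c * ?g x \<partial>lborel) = L2_norm_sq f"
    unfolding L2_norm_sq_def f
    by (rule nn_integral_eq_integral[symmetric], rule integrable_mult_right, rule gaussian_scaled(1)[OF r])
       (use c in simp)
  finally show ?thesis .
qed

context complex_structure begin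

lemma FT_gaussian:
  fixes w :: "'a::euclidean_space" and v :: 'b
  assumes r: "r > 0"
  defines "f \<equiv> \<lambda>x::'a. exp (- (norm (r *\<^sub>R x))\<^sup>2 / 2) *\<^sub>R v"
  shows "integrable lborel f"
    and "FT f w = ((sqrt (2 * pi) / r) ^ DIM('a) * exp (- (norm ((1 / r) *\<^sub>R w))\<^sup>2 / 2)) *\<^sub>R v"
proof -
  let ?g = "\<lambda>x::'a. exp (- (norm (r *\<^sub>R x))\<^sup>2 / 2)"
  have gi: "integrable lborel ?g" by (rule gaussian_scaled(1)[OF r])
  show fi: "integrable lborel f" unfolding f_def by (rule integrable_scaleR_left[OF gi])
  have ci: "integrable lborel (\<lambda>x. ?g x * cos (w \<bullet> x))" "integrable lborel (\<lambda>x. ?g x * sin (w \<bullet> x))"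
    by (rule Bochner_Integration.integrable_bound[OF gi]; auto simp: abs_mult mult_left_le)+
  have "cos_transform f w = (\<integral>x. (?g x * cos (w \<bullet> x)) *\<^sub>R v \<partial>lborel)"
    by (simp add: cos_transform_def f_def inner_commute mult.commute)
  also have "\<dots> = ((sqrt (2 * pi) / r) ^ DIM('a) * exp (- (norm ((1 / r) *\<^sub>R w))\<^sup>2 / 2)) *\<^sub>R v"
    by (simp only: integral_scaleR_left[OF ci(1)] gaussian_scaled(2)[OF r])
  finally have c: "cos_transform f w = \<dots>" .
  have "sin_transform f w = (\<integral>x. (?g x * sin (w \<bullet> x)) *\<^sub>R v \<partial>lborel)"
    by (simp add: sin_transform_def f_def inner_commute mult.commute)
  also have "\<dots> = 0"
    by (simp only: integral_scaleR_left[OF ci(2)] gaussian_scaled(3)[OF r] scaleR_zero_left)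
  finally show "FT f w = ((sqrt (2 * pi) / r) ^ DIM('a) * exp (- (norm ((1 / r) *\<^sub>R w))\<^sup>2 / 2)) *\<^sub>R v"
    using c FT_eq[OF fi, of w] linear_0[OF linear_J] by simp
qed

text \<open>
  Each second moment is \<open>|b|\<^sup>2\<close> times the variance times the total energy. The variances are \<open>1/(4k)\<close> for
  \<open>f\<close> and \<open>k\<close> for its transform, and the two energies are related by the Plancherel identity.
\<close>

theorem heisenberg_gaussian_eq:
  fixes f :: "'a::euclidean_space \<Rightarrow> 'b"
  assumes k: "k > 0" and f: "f = (\<lambda>x. exp (- k * (norm x)\<^sup>2) *\<^sub>R v)" and FT: "is_FT f g"
  shows "second_moment b f * (ennreal (1 / (2 * pi) ^ DIM('a)) * second_moment b g)
    = ennreal (1 / 4 * norm b ^ 4) * (L2_norm_sq f)\<^sup>2"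
proof -
  define r where "r = sqrt (2 * k)"
  have r: "r > 0" "r\<^sup>2 = 2 * k" using k by (auto simp: r_def)
  have f': "f = (\<lambda>x. exp (- (norm (r *\<^sub>R x))\<^sup>2 / 2) *\<^sub>R v)"
    unfolding f using r by (simp add: power_mult_distrib)
  have L2: "L2_norm_sq f < \<infinity>" using FT by (simp add: is_FT_def)
  have fi: "integrable lborel f" unfolding f' by (rule FT_gaussian(1)[OF r(1)])
  have ae: "AE w in lborel. g w = FT f w"
    by (rule is_FT_unique[OF FT is_FT_integrable[OF fi L2]])
  have "second_moment b g = second_moment b (FT f)"
    unfolding second_moment_def by (rule nn_integral_cong_AE) (use ae in eventually_elim, simp)
  also have "\<dots> = ennreal ((norm b)\<^sup>2 / (1 / sqrt k)\<^sup>2) * L2_norm_sq (FT f)"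
  proof (rule second_moment_gaussian)
    let ?c = "(sqrt (2 * pi) / r) ^ DIM('a)"
    show "(norm (FT f w))\<^sup>2 = (?c * norm v)\<^sup>2 * exp (- (norm ((1 / sqrt k) *\<^sub>R w))\<^sup>2 / 2)" for w
    proof -
      have "(exp (- (norm ((1 / r) *\<^sub>R w))\<^sup>2 / 2))\<^sup>2 = exp (- (norm ((1 / sqrt k) *\<^sub>R w))\<^sup>2 / 2)"
        using k r by (simp add: power2_eq_square exp_add[symmetric] power_mult_distrib power_divide field_simps)
      then show ?thesis
        unfolding f' FT_gaussian(2)[OF r(1)] using r(1) by (simp add: power_mult_distrib abs_mult)
    qed
  qed (use k in auto)
  also have "L2_norm_sq (FT f) = ennreal ((2 * pi) ^ DIM('a)) * L2_norm_sq f" by (rule plancherel[OF fi L2])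
  finally have W: "second_moment b g = ennreal ((norm b)\<^sup>2 * k) * (ennreal ((2 * pi) ^ DIM('a)) * L2_norm_sq f)"
    using k by (simp add: power_divide)
  have X: "second_moment b f = ennreal ((norm b)\<^sup>2 / (2 * sqrt k)\<^sup>2) * L2_norm_sq f"
  proof (rule second_moment_gaussian)
    show "(norm (f x))\<^sup>2 = (norm v)\<^sup>2 * exp (- (norm ((2 * sqrt k) *\<^sub>R x))\<^sup>2 / 2)" for x
      unfolding f using k
      by (simp add: power_mult_distrib power2_eq_square[of "exp _"] exp_add[symmetric])
  qed (use k in auto)
  define F where "F = enn2real (L2_norm_sq f)"
  have F: "L2_norm_sq f = ennreal F" "F \<ge> 0" using L2 by (auto simp: F_def)
  let ?K = "(2 * pi) ^ DIM('a)"
  have "second_moment b f * (ennreal (1 / ?K) * second_moment b g)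
      = ennreal ((norm b)\<^sup>2 / (2 * sqrt k)\<^sup>2 * F * (1 / ?K * ((norm b)\<^sup>2 * k * (?K * F))))"
  proof -
    have nn: "0 \<le> (norm b)\<^sup>2 / (2 * sqrt k)\<^sup>2" "0 \<le> 1 / ?K" "0 \<le> (norm b)\<^sup>2 * k" "0 \<le> ?K"
      using k by auto
    show ?thesis unfolding X W F(1) using nn F(2) by (simp only: ennreal_mult mult_nonneg_nonneg)
  qed
  also have "(norm b)\<^sup>2 / (2 * sqrt k)\<^sup>2 * F * (1 / ?K * ((norm b)\<^sup>2 * k * (?K * F)))
      = 1 / 4 * norm b ^ 4 * F\<^sup>2"
    using k by (simp add: power_mult_distrib field_simps power2_eq_square power4_eq_xxxx)
  also have "ennreal \<dots> = ennreal (1 / 4 * norm b ^ 4) * (L2_norm_sq f)\<^sup>2"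
    unfolding F(1) ennreal_power[OF F(2)] by (rule ennreal_mult) auto
  finally show ?thesis .
qed

end

section \<open>The complex structure of right multiplication by i\<close>

lemma blade_sign_sq: "blade_sign p A B * blade_sign p A B = 1"
proof -
  have "prod (eps p) (A \<inter> B) * prod (eps p) (A \<inter> B) = 1" by (simp add: prod.distrib[symmetric])
  moreover have "inv_sign A B * inv_sign A B = 1" by (simp add: inv_sign_def power_add[symmetric])
  moreover have "blade_sign p A B * blade_sign p A B
      = (inv_sign A B * inv_sign A B) * (prod (eps p) (A \<inter> B) * prod (eps p) (A \<inter> B))"
    by (simp add: blade_sign_alt mult_ac)
  ultimately show ?thesis by simp
qed

lemma principal_reverse_blade:
  "principal_reverse p (blade B) = blade_sign p B B *\<^sub>R blade B"
  by (simp add: vec_eq_iff principal_reverse_nth blade_nth blade_sign_def card_inversions)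

lemma principal_reverse_blade_mult: "cl_mult p (principal_reverse p (blade B)) (blade B) = cl_one"
  by (simp add: principal_reverse_blade cl_mult_scale_left cl_mult_blade blade_sign_sq)

lemma principal_reverse_expansion:
  "principal_reverse p M = (\<Sum>B\<in>UNIV. M $ B *\<^sub>R principal_reverse p (blade B))"
  by (simp add: vec_eq_iff principal_reverse_nth blade_nth if_distrib cong: if_cong)

text \<open>
  Multiplication by a blade permutes the basis blades up to sign, so it is orthogonal.
\<close>

lemma inner_mult_blade: "cl_mult p M (blade B) \<bullet> cl_mult p N (blade B) = M \<bullet> N"
proof -
  have inner_blade: "blade A \<bullet> blade C = (if A = C then 1 else 0)" for A C :: "'a set"
    by (simp add: blade_def inner_axis_axis)
  have b: "cl_mult p (blade A) (blade B) \<bullet> cl_mult p (blade C) (blade B) = blade A \<bullet> blade C" for A C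
  proof -
    have "symd A B = symd C B \<longleftrightarrow> A = C" by blast
    then show ?thesis by (auto simp: cl_mult_blade inner_blade blade_sign_sq)
  qed
  show ?thesis
    by (subst (1 2) blade_expansion[of M], subst (1 2) blade_expansion[of N])
       (simp only: cl_mult_sum_left cl_mult_scale_left inner_sum_left inner_sum_right
         inner_scaleR_left inner_scaleR_right b)
qed

text \<open>
  The reverse of a blade is its inverse, so for blades this is the orthogonality of right
  multiplication; both sides are linear in \<open>K\<close>.
\<close>

lemma inner_mult_right_adjoint: "cl_mult p M K \<bullet> N = M \<bullet> cl_mult p N (principal_reverse p K)"
proof -
  have b: "cl_mult p M (blade B) \<bullet> N = M \<bullet> cl_mult p N (principal_reverse p (blade B))" for B
    using inner_mult_blade[of p M B "cl_mult p N (principal_reverse p (blade B))"]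
    by (simp add: cl_mult_assoc principal_reverse_blade_mult cl_mult_one)
  show ?thesis
    by (subst blade_expansion[of K], subst principal_reverse_expansion)
       (simp only: cl_mult_sum_right cl_mult_scale_right inner_sum_left inner_sum_right
         inner_scaleR_left inner_scaleR_right b)
qed

lemma complex_structure_cl_mult:
  assumes "cl_mult p i i = - cl_one" "principal_reverse p i = - i"
  shows "complex_structure (\<lambda>M. cl_mult p M i)"
proof (rule complex_structure.intro)
  have neg: "cl_mult p M (- N) = - cl_mult p M N" for M N :: "'a multivector"
    using cl_mult_scale_right[of p M "-1" N] by simp
  show "linear (\<lambda>M. cl_mult p M i)" 
    by (auto intro!: linearI simp: cl_mult_add_left cl_mult_scale_left)
  show sq: "cl_mult p (cl_mult p M i) i = - M" for M
    by (simp add: cl_mult_assoc assms neg cl_mult_one)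
  show "norm (cl_mult p M i) = norm M" for M
  proof -
    have "cl_mult p M i \<bullet> cl_mult p M i = M \<bullet> M"
      by (simp add: inner_mult_right_adjoint assms neg sq)
    then show ?thesis by (simp add: norm_eq)
  qed
qed

section \<open>The Clifford Fourier transform as a Fourier transform\<close>

text \<open>
  Fubini's theorem and translations are convenient for Borel functions, while the transform is defined
  for Lebesgue measurable ones; each of the latter agrees almost everywhere with one of the former.
\<close>

lemma borel_version:
  fixes f :: "'a::euclidean_space \<Rightarrow> 'b::euclidean_space"
  assumes f: "f \<in> borel_measurable lebesgue"
  shows "\<exists>f' \<in> borel_measurable borel. AE x in lborel. f x = f' x"
proof -
  have "\<exists>h \<in> borel_measurable lborel. AE x in lborel. f x \<bullet> b = h x" for b
    by (rule completion_ex_borel_measurable_real) (use f in measurable)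
  then obtain h where h: "\<And>b. h b \<in> borel_measurable lborel" "\<And>b. AE x in lborel. f x \<bullet> b = h b x"
    by metis
  have "AE x in lborel. \<forall>b\<in>Basis. f x \<bullet> b = h b x"
    using h(2) by (intro AE_finite_allI) auto
  then have "AE x in lborel. f x = (\<Sum>b\<in>Basis. h b x *\<^sub>R b)"
  proof eventually_elim
    case (elim x)
    have "f x = (\<Sum>b\<in>Basis. (f x \<bullet> b) *\<^sub>R b)" by (simp add: euclidean_representation)
    also have "\<dots> = (\<Sum>b\<in>Basis. h b x *\<^sub>R b)" using elim by (intro sum.cong) auto
    finally show ?case .
  qed
  moreover have "(\<lambda>x. \<Sum>b\<in>Basis. h b x *\<^sub>R b) \<in> borel_measurable borel"
    using h(1) by (intro borel_measurable_sum borel_measurable_scaleR) simp_all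
  ultimately show ?thesis by (intro bexI)
qed

lemma nn_integral_modulus:
  assumes "AE x in lborel. f x = f' x"
  shows "(\<integral>\<^sup>+x. ennreal ((modulus p (f x))\<^sup>2) \<partial>lebesgue) = L2_norm_sq f'"
  unfolding L2_norm_sq_def nn_integral_completion modulus_eq_norm
  by (rule nn_integral_cong_AE) (use assms in eventually_elim, simp)

lemma L2_set_cl_iff:
  assumes "f \<in> borel_measurable lebesgue" "AE x in lborel. f x = f' x"
  shows "f \<in> L2_set_cl p \<longleftrightarrow> L2_norm_sq f' < \<infinity>"
  using assms by (simp add: L2_set_cl_def nn_integral_modulus)

lemma borel_imp_lebesgue: "f \<in> borel_measurable borel \<Longrightarrow> f \<in> borel_measurable lebesgue"
  by (rule measurable_completion) simp

lemma integrable_lebesgue_cong: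
  fixes f f' :: "'a::euclidean_space \<Rightarrow> 'b::euclidean_space"
  assumes "f \<in> borel_measurable lebesgue" "f' \<in> borel_measurable borel" "AE x in lborel. f x = f' x"
  shows "integrable lebesgue f \<longleftrightarrow> integrable lborel f'"
proof -
  have "integrable lebesgue f \<longleftrightarrow> integrable lebesgue f'"
    by (rule integrable_cong_AE[OF assms(1) borel_imp_lebesgue[OF assms(2)] AE_completion[OF assms(3)]])
  then show ?thesis using assms(2) by (simp add: integrable_completion)
qed

lemma cft_L1_eq:
  fixes f f' :: "'n::{finite,linorder} coords \<Rightarrow> 'n multivector"
  assumes J: "complex_structure (\<lambda>M. cl_mult p M i)"
    and f: "f \<in> borel_measurable lebesgue" and f': "f' \<in> borel_measurable borel"
    and eq: "AE x in lborel. f x = f' x"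
  shows "cft_L1 p i f w = complex_structure.FT (\<lambda>M. cl_mult p M i) f' w"
proof -
  interpret complex_structure "\<lambda>M. cl_mult p M i" by fact
  have neg: "cl_mult p M (N - N') = cl_mult p M N - cl_mult p M N'" for M N N' :: "'n multivector"
    using cl_mult_add_right[of p M "N - N'" N'] by simp
  have r: "cl_mult p M (cl_exp_minus i \<theta>) = rot (- \<theta>) M" for M \<theta>
    by (simp add: cl_exp_minus_def rot_def neg cl_mult_scale_right cl_mult_one)
  have m: "(\<lambda>x. rot (- (x \<bullet> w)) (f' x)) \<in> borel_measurable borel"
    using f' by measurable
  have l: "(\<lambda>x::'n coords. - (x \<bullet> w)) \<in> borel_measurable lebesgue"
    by (rule borel_imp_lebesgue) measurable
  have "cft_L1 p i f w = (\<integral>x. rot (- (x \<bullet> w)) (f x) \<partial>lebesgue)"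
    by (simp add: cft_L1_def r phase_eq_inner)
  also have "\<dots> = (\<integral>x. rot (- (x \<bullet> w)) (f' x) \<partial>lebesgue)"
  proof (rule integral_cong_AE)
    show "(\<lambda>x. rot (- (x \<bullet> w)) (f x)) \<in> borel_measurable lebesgue"
      by (rule rot_measurable[OF l f])
    show "(\<lambda>x. rot (- (x \<bullet> w)) (f' x)) \<in> borel_measurable lebesgue"
      by (rule borel_imp_lebesgue[OF m])
    show "AE x in lebesgue. rot (- (x \<bullet> w)) (f x) = rot (- (x \<bullet> w)) (f' x)"
      using AE_completion[OF eq] by eventually_elim simp
  qed
  also have "\<dots> = FT f' w"
    unfolding FT_def by (rule integral_completion) (use m in simp)
  finally show ?thesis .
qed

lemma is_cft_iff_is_FT:
  fixes f f' :: "'n::{finite,linorder} coords \<Rightarrow> 'n multivector"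
  assumes J: "complex_structure (\<lambda>M. cl_mult p M i)"
    and f: "f \<in> L2_set_cl p" and f': "f' \<in> borel_measurable borel" "AE x in lborel. f x = f' x"
    and g: "g \<in> borel_measurable lebesgue" and g': "g' \<in> borel_measurable borel" "AE w in lborel. g w = g' w"
  shows "is_cft p i f g \<longleftrightarrow> complex_structure.is_FT (\<lambda>M. cl_mult p M i) f' g'"
proof -
  interpret complex_structure "\<lambda>M. cl_mult p M i" by fact
  have fm: "f \<in> borel_measurable lebesgue" using f by (simp add: L2_set_cl_def)
  have f2: "L2_norm_sq f' < \<infinity>" using f L2_set_cl_iff[OF fm f'(2)] by simp
  have diff: "(\<integral>\<^sup>+x. ennreal ((modulus p (u x - v x))\<^sup>2) \<partial>lebesgue) = L2_norm_sq (\<lambda>x. u' x - v' x)"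
    if "AE x in lborel. u x = u' x" "AE x in lborel. v x = v' x"
    for u v u' v' :: "'n coords \<Rightarrow> 'n multivector"
    by (rule nn_integral_modulus) (use that in eventually_elim, simp)
  show ?thesis
  proof
    assume "is_cft p i f g"
    then obtain \<phi> where g2: "g \<in> L2_set_cl p"
      and \<phi>: "\<And>m. \<phi> m \<in> L2_set_cl p" "\<And>m. integrable lebesgue (\<phi> m)"
      and lim: "(\<lambda>m. \<integral>\<^sup>+x. ennreal ((modulus p (\<phi> m x - f x))\<^sup>2) \<partial>lebesgue) \<longlonglongrightarrow> 0"
        "(\<lambda>m. \<integral>\<^sup>+w. ennreal ((modulus p (cft_L1 p i (\<phi> m) w - g w))\<^sup>2) \<partial>lebesgue) \<longlonglongrightarrow> 0"
      unfolding is_cft_def by blast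
    have \<phi>m: "\<phi> m \<in> borel_measurable lebesgue" for m using \<phi>(1)[of m] by (simp add: L2_set_cl_def)
    obtain \<phi>' where \<phi>': "\<And>m. \<phi>' m \<in> borel_measurable borel" "\<And>m. AE x in lborel. \<phi> m x = \<phi>' m x"
      using borel_version[OF \<phi>m] by metis
    show "is_FT f' g'"
      unfolding is_FT_def
    proof (intro conjI exI[of _ \<phi>'] allI f2 f' g')
      show "L2_norm_sq g' < \<infinity>" using g2 L2_set_cl_iff[OF g g'(2)] by simp
      show "integrable lborel (\<phi>' m)" for m
        using integrable_lebesgue_cong[OF \<phi>m \<phi>'] \<phi>(2) by blast
      show "L2_norm_sq (\<phi>' m) < \<infinity>" for m
        using L2_set_cl_iff[OF \<phi>m \<phi>'(2)] \<phi>(1) by blast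
      show "(\<lambda>m. L2_norm_sq (\<lambda>x. \<phi>' m x - f' x)) \<longlonglongrightarrow> 0"
        using lim(1) unfolding diff[OF \<phi>'(2) f'(2)] .
      show "(\<lambda>m. L2_norm_sq (\<lambda>w. FT (\<phi>' m) w - g' w)) \<longlonglongrightarrow> 0"
        using lim(2) unfolding cft_L1_eq[OF J \<phi>m \<phi>'] diff[OF AE_I2[OF refl] g'(2)] .
    qed
  next
    assume "is_FT f' g'"
    then obtain \<phi> where g2: "L2_norm_sq g' < \<infinity>"
      and \<phi>: "\<And>m. integrable lborel (\<phi> m)" "\<And>m. L2_norm_sq (\<phi> m) < \<infinity>"
      and lim: "(\<lambda>m. L2_norm_sq (\<lambda>x. \<phi> m x - f' x)) \<longlonglongrightarrow> 0"
        "(\<lambda>m. L2_norm_sq (\<lambda>w. FT (\<phi> m) w - g' w)) \<longlonglongrightarrow> 0"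
      unfolding is_FT_def by blast
    have \<phi>m: "\<phi> m \<in> borel_measurable borel" for m using \<phi>(1)[of m] by auto
    note \<phi>l = borel_imp_lebesgue[OF \<phi>m]
    have rfl: "AE x in lborel. \<phi> m x = \<phi> m x" for m by simp
    show "is_cft p i f g"
      unfolding is_cft_def
    proof (intro conjI exI[of _ \<phi>] allI)
      show "g \<in> L2_set_cl p" using g2 L2_set_cl_iff[OF g g'(2)] by simp
      show "\<phi> m \<in> L2_set_cl p" for m using L2_set_cl_iff[OF \<phi>l rfl] \<phi>(2) by blast
      show "integrable lebesgue (\<phi> m)" for m
        using integrable_lebesgue_cong[OF \<phi>l \<phi>m rfl] \<phi>(1) by blast
      show "(\<lambda>m. \<integral>\<^sup>+x. ennreal ((modulus p (\<phi> m x - f x))\<^sup>2) \<partial>lebesgue) \<longlonglongrightarrow> 0"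
        using lim(1) unfolding diff[OF rfl f'(2)] .
      show "(\<lambda>m. \<integral>\<^sup>+w. ennreal ((modulus p (cft_L1 p i (\<phi> m) w - g w))\<^sup>2) \<partial>lebesgue) \<longlonglongrightarrow> 0"
        using lim(2) unfolding cft_L1_eq[OF J \<phi>l \<phi>m rfl] diff[OF AE_I2[OF refl] g'(2)] .
    qed
  qed
qed

text \<open>
  The choice in the definition of the transform has a witness because the \<open>L\<^sup>2\<close> extension exists, so the
  chosen function is itself an admissible transform.
\<close>

lemma cft_is_FT:
  fixes f f' :: "'n::{finite,linorder} coords \<Rightarrow> 'n multivector"
  assumes J: "complex_structure (\<lambda>M. cl_mult p M i)"
    and f: "f \<in> L2_set_cl p" and f': "f' \<in> borel_measurable borel" "AE x in lborel. f x = f' x"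
  shows "\<exists>g'. complex_structure.is_FT (\<lambda>M. cl_mult p M i) f' g' \<and> (AE w in lborel. cft p i f w = g' w)"
proof -
  interpret complex_structure "\<lambda>M. cl_mult p M i" by fact
  have fm: "f \<in> borel_measurable lebesgue" using f by (simp add: L2_set_cl_def)
  have "L2_norm_sq f' < \<infinity>" using f L2_set_cl_iff[OF fm f'(2)] by simp
  then obtain g0 where g0: "is_FT f' g0" using is_FT_exists[OF f'(1)] by blast
  then have "g0 \<in> borel_measurable borel" by (simp add: is_FT_def)
  with g0 have "is_cft p i f g0"
    using is_cft_iff_is_FT[OF J f f', of g0 g0] by (simp add: borel_imp_lebesgue)
  then have c: "is_cft p i f (cft p i f)" unfolding cft_def by (rule someI[of "is_cft p i f"])
  then have m: "cft p i f \<in> borel_measurable lebesgue" by (simp add: is_cft_def L2_set_cl_def)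
  then obtain g' where g': "g' \<in> borel_measurable borel" "AE w in lborel. cft p i f w = g' w"
    using borel_version by blast
  with c show ?thesis using is_cft_iff_is_FT[OF J f f' m g'] by blast
qed

lemma nn_integral_vdot_modulus:
  fixes f f' :: "'n::{finite,linorder} coords \<Rightarrow> 'n multivector"
  assumes "AE x in lborel. f x = f' x"
  shows "(\<integral>\<^sup>+x. ennreal ((vdot p a x)\<^sup>2 * (modulus p (f x))\<^sup>2) \<partial>lebesgue)
    = second_moment (\<chi> l. eps p l * a $ l) f'"
proof -
  have "vdot p a x = (\<chi> l. eps p l * a $ l) \<bullet> x" for x
    by (simp add: vdot_eq inner_vec_def)
  then show ?thesis
    unfolding second_moment_def nn_integral_completion modulus_eq_norm
    by (intro nn_integral_cong_AE) (use assms in eventually_elim, simp)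
qed

theorem corollary4p2:
  fixes p q :: nat
    and i :: "'n::{finite,linorder} multivector"
    and f :: "'n coords \<Rightarrow> 'n multivector"
    and a :: "'n coords"
  assumes dim: "CARD('n) = p + q"
    and i_square: "cl_mult p i i = - cl_one"
    and i_reverse: "principal_reverse p i = - i"
    and f_L2: "f \<in> L2_set_cl p"
  defines "F \<equiv> \<integral>\<^sup>+x. ennreal ((modulus p (f x))\<^sup>2) \<partial>lebesgue"
    and "X \<equiv> \<integral>\<^sup>+x. ennreal ((vdot p a x)\<^sup>2 * (modulus p (f x))\<^sup>2) \<partial>lebesgue"
    and "W \<equiv> \<integral>\<^sup>+w. ennreal ((vdot p a w)\<^sup>2 * (modulus p (cft p i f w))\<^sup>2) \<partial>lebesgue"
  shows "X * (ennreal (1 / (2 * pi) ^ (p + q)) * W) \<ge> ennreal (1 / 4 * vmod p a ^ 4) * F\<^sup>2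
    \<and> (\<forall>C0 k. k > 0 \<longrightarrow> f = (\<lambda>x. exp (- k * (vmod p x)\<^sup>2) *\<^sub>R C0) \<longrightarrow>
          X * (ennreal (1 / (2 * pi) ^ (p + q)) * W) = ennreal (1 / 4 * vmod p a ^ 4) * F\<^sup>2)"
proof -
  note J = complex_structure_cl_mult[OF i_square i_reverse]
  interpret complex_structure "\<lambda>M. cl_mult p M i" by (rule J)
  define b :: "'n coords" where "b = (\<chi> l. eps p l * a $ l)"
  have "b \<bullet> b = a \<bullet> a"
    by (auto simp: b_def inner_vec_def eps_def intro!: sum.cong)
  then have b: "vmod p a = norm b" by (simp add: vmod_eq_norm norm_eq)
  have DIM: "p + q = DIM('n coords)" using dim by simp
  have eqs: "F = L2_norm_sq f'" "X = second_moment b f'" "W = second_moment b g'"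
    if "AE x in lborel. f x = f' x" "AE w in lborel. cft p i f w = g' w" for f' g'
    unfolding F_def X_def W_def b_def
    using nn_integral_modulus[OF that(1)] nn_integral_vdot_modulus[OF that(1)]
      nn_integral_vdot_modulus[OF that(2)] by auto
  show ?thesis
  proof (intro conjI allI impI)
    have "f \<in> borel_measurable lebesgue" using f_L2 by (simp add: L2_set_cl_def)
    then obtain f' where f': "f' \<in> borel_measurable borel" "AE x in lborel. f x = f' x"
      using borel_version by blast
    obtain g' where g': "is_FT f' g'" "AE w in lborel. cft p i f w = g' w"
      using cft_is_FT[OF J f_L2 f'] by blast
    show "X * (ennreal (1 / (2 * pi) ^ (p + q)) * W) \<ge> ennreal (1 / 4 * vmod p a ^ 4) * F\<^sup>2"
      unfolding eqs[OF f'(2) g'(2)] b DIM by (rule heisenberg[OF g'(1)])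
  next
    fix C0 :: "'n multivector" and k :: real
    assume k: "k > 0" and f: "f = (\<lambda>x. exp (- k * (vmod p x)\<^sup>2) *\<^sub>R C0)"
    then have f': "f = (\<lambda>x. exp (- k * (norm x)\<^sup>2) *\<^sub>R C0)" by (simp add: vmod_eq_norm)
    have fm: "f \<in> borel_measurable borel" unfolding f' by measurable
    have rfl: "AE x in lborel. f x = f x" by simp
    obtain g' where g': "is_FT f g'" "AE w in lborel. cft p i f w = g' w"
      using cft_is_FT[OF J f_L2 fm rfl] by blast
    show "X * (ennreal (1 / (2 * pi) ^ (p + q)) * W) = ennreal (1 / 4 * vmod p a ^ 4) * F\<^sup>2"
      unfolding eqs[OF rfl g'(2)] b DIM by (rule heisenberg_gaussian_eq[OF k f' g'(1)])
  qed
qed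

end
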